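(* Let $\Omega$ be a compact connected Riemannian manifold and let $T:\Omega\to\Omega$ be a continuously differentiable $k$-to-$1$ uniformly expanding map with $JT:=|\det DT|:\Omega\to\mathbb{R}$ in $\mathcal{C}^{\beta\log}(\Omega)$ for some $\beta>1$. Then $T$ has an absolutely continuous invariant probability measure whose density is in $\mathcal{C}^{(\beta-1)\log}(\Omega)$, with at least polynomial decay of correlations of degree $\beta-1$.
   Context: $d$ is the Riemannian distance; absolute continuity and densities are with respect to the Riemannian volume. A $k$-to-$1$ map $T$ is uniformly expanding if there is $\lambda>1$ such that for all $x,y\in\Omega$ one can enumerate $T^{-1}(x)=\{x^1,\dots,x^k\}$ and $T^{-1}(y)=\{y^1,\dots,y^k\}$ so that $d(x^j,y^j)\le d(x,y)/\lambda$ for all $j$ (this includes the classical case $\|D_xT(v)\|\ge\lambda\|v\|$ for all $x\in\Omega$, $v\in T_x\Omega$). For $\beta>0$, $\omega_{\beta\log}$ is a modulus of continuity (continuous, increasing, concave on $[0,\infty)$, vanishing at $0$) equal to $(\log\frac{r_0}{r})^{-\beta}$ for $r\in(0,1]$, where $r_0$ is a constant large enough to make it increasing and concave on $[0,1]$. $\mathcal{C}^{\beta\log}(\Omega)$ is the Banach space of $f:\Omega\to\mathbb{R}$ with $|f(x)-f(y)|\le C\omega_{\beta\log}(d(x,y))$ for some $C$ (least such $C$ denoted $\mathrm{Hol}_{\beta\log}(f)$), with norm $\|f\|_\infty+\mathrm{Hol}_{\beta\log}(f)$. At least polynomial decay of correlations of degree $\beta-1$ for an invariant probability measure $\mu$: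 there is $C$ such that for all $f\in\mathcal{C}^{(\beta-1)\log}(\Omega)$, $g\in L^1(\mu)$ and $t\ge1$, $\left|\int f\cdot g\circ T^t\,d\mu-\int f\,d\mu\int g\,d\mu\right|\le C\,\mathrm{Hol}_{(\beta-1)\log}(f)\,\|g\|_{L^1(\mu)}/t^{\beta-1}$. *)

theory Defs
  imports "HOL-Analysis.Analysis"
begin

section \<open>Smooth functions between Euclidean spaces\<close>

text \<open>Intended for open \<open>S\<close>: \<open>Ck_on r S f\<close> says that \<open>f\<close> is \<open>r\<close> times continuously
  differentiable on \<open>S\<close>, stated through iterated directional derivatives.\<close>

primrec Ck_on :: "nat \<Rightarrow> 'a::real_normed_vector set \<Rightarrow> ('a \<Rightarrow> 'b::real_normed_vector) \<Rightarrow> bool" where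
  "Ck_on 0 S f \<longleftrightarrow> continuous_on S f"
| "Ck_on (Suc r) S f \<longleftrightarrow>
     f differentiable_on S \<and> (\<forall>v. Ck_on r S (\<lambda>x. frechet_derivative f (at x) v))"

definition smooth_on :: "'a::real_normed_vector set \<Rightarrow> ('a \<Rightarrow> 'b::real_normed_vector) \<Rightarrow> bool" where
  "smooth_on S f \<longleftrightarrow> (\<forall>r. Ck_on r S f)"


section \<open>Riemannian manifolds\<close>

text \<open>The manifold is the whole type \<open>'a\<close>. A chart \<open>(U, \<phi>)\<close> is a homeomorphism \<open>\<phi>\<close> of the open
  set \<open>U\<close> onto an open subset of \<open>real ^ 'n\<close>; the values of \<open>\<phi>\<close> outside \<open>U\<close> are irrelevant.\<close>

type_synonym ('a, 'n) chart = "'a set \<times> ('a \<Rightarrow> real ^ 'n)"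

abbreviation chart_dom :: "('a, 'n) chart \<Rightarrow> 'a set" where
  "chart_dom c \<equiv> fst c"

abbreviation chart_map :: "('a, 'n) chart \<Rightarrow> 'a \<Rightarrow> real ^ 'n" where
  "chart_map c \<equiv> snd c"

definition chart_inv :: "('a, 'n::finite) chart \<Rightarrow> real ^ 'n \<Rightarrow> 'a" where
  "chart_inv c = inv_into (chart_dom c) (chart_map c)"

definition is_chart :: "('a::topological_space, 'n::finite) chart \<Rightarrow> bool" where
  "is_chart c \<longleftrightarrow>
     open (chart_dom c) \<and> open (chart_map c ` chart_dom c) \<and>
     homeomorphism (chart_dom c) (chart_map c ` chart_dom c) (chart_map c) (chart_inv c)"

text \<open>The coordinate expression of a map \<open>F\<close> in a chart \<open>c\<close> of the source and \<open>d\<close> of the target,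
  and the open set on which it is meaningful.\<close>

definition local_rep ::
    "('a, 'n::finite) chart \<Rightarrow> ('a, 'n) chart \<Rightarrow> ('a \<Rightarrow> 'a) \<Rightarrow> real ^ 'n \<Rightarrow> real ^ 'n" where
  "local_rep c d F = chart_map d \<circ> F \<circ> chart_inv c"

definition local_dom ::
    "('a, 'n::finite) chart \<Rightarrow> ('a, 'n) chart \<Rightarrow> ('a \<Rightarrow> 'a) \<Rightarrow> (real ^ 'n) set" where
  "local_dom c d F = chart_map c ` (chart_dom c \<inter> F -` chart_dom d)"

definition smooth_atlas :: "('a::topological_space, 'n::finite) chart set \<Rightarrow> bool" where
  "smooth_atlas A \<longleftrightarrow>
     (\<forall>c\<in>A. is_chart c) \<and> (\<Union>c\<in>A. chart_dom c) = UNIV \<and>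
     (\<forall>c\<in>A. \<forall>d\<in>A. smooth_on (local_dom c d id) (local_rep c d id))"

text \<open>A Riemannian metric is given by its Gram matrices: \<open>g c u\<close> is the matrix of the inner product
  of the tangent space at \<open>chart_inv c u\<close>, in the basis of coordinate vectors of the chart \<open>c\<close>.\<close>

type_synonym ('a, 'n) metric_tensor = "('a, 'n) chart \<Rightarrow> real ^ 'n \<Rightarrow> real ^ 'n ^ 'n"

definition riemannian_metric ::
    "('a::topological_space, 'n::finite) chart set \<Rightarrow> ('a, 'n) metric_tensor \<Rightarrow> bool" where
  "riemannian_metric A g \<longleftrightarrow>
     (\<forall>c\<in>A. smooth_on (chart_map c ` chart_dom c) (g c) \<and>
        (\<forall>u \<in> chart_map c ` chart_dom c.
           transpose (g c u) = g c u \<and> (\<forall>v. v \<noteq> 0 \<longrightarrow> v \<bullet> (g c u *v v) > 0))) \<and>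
     (\<forall>c\<in>A. \<forall>d\<in>A. \<forall>u \<in> local_dom c d id.
        g c u = transpose (jacobian (local_rep c d id) (at u)) ** g d (local_rep c d id u)
                ** jacobian (local_rep c d id) (at u))"

definition riemannian_manifold ::
    "('a::{second_countable_topology,t2_space}, 'n::finite) chart set \<Rightarrow>
     ('a, 'n) metric_tensor \<Rightarrow> bool" where
  "riemannian_manifold A g \<longleftrightarrow> smooth_atlas A \<and> riemannian_metric A g"

text \<open>A chart around a point. The quantities defined with it below do not depend on the choice.\<close>

definition chart_at :: "('a, 'n::finite) chart set \<Rightarrow> 'a \<Rightarrow> ('a, 'n) chart" where
  "chart_at A x = (SOME c. c \<in> A \<and> x \<in> chart_dom c)"


subsection \<open>Riemannian distance\<close>

definition piecewise_C1_curve ::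
    "('a::topological_space, 'n::finite) chart set \<Rightarrow> (real \<Rightarrow> 'a) \<Rightarrow> bool" where
  "piecewise_C1_curve A \<gamma> \<longleftrightarrow>
     path \<gamma> \<and>
     (\<exists>S. finite S \<and>
       (\<forall>c\<in>A. (chart_map c \<circ> \<gamma>) C1_differentiable_on (({0..1} - S) \<inter> \<gamma> -` chart_dom c)))"

definition speed ::
    "('a, 'n::finite) chart set \<Rightarrow> ('a, 'n) metric_tensor \<Rightarrow> (real \<Rightarrow> 'a) \<Rightarrow> real \<Rightarrow> real" where
  "speed A g \<gamma> t =
     (let c = chart_at A (\<gamma> t); v = vector_derivative (chart_map c \<circ> \<gamma>) (at t)
      in sqrt (v \<bullet> (g c (chart_map c (\<gamma> t)) *v v)))"

text \<open>The length is taken in \<open>ennreal\<close>, so that a curve whose speed is not integrable has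
  length \<open>\<infinity>\<close> rather than the default value 0 of a non-existing integral.\<close>

definition curve_length ::
    "('a, 'n::finite) chart set \<Rightarrow> ('a, 'n) metric_tensor \<Rightarrow> (real \<Rightarrow> 'a) \<Rightarrow> ennreal" where
  "curve_length A g \<gamma> = (\<integral>\<^sup>+t\<in>{0..1}. ennreal (speed A g \<gamma> t) \<partial>lborel)"

text \<open>The infimum is finite whenever the manifold is connected.\<close>

definition riem_dist ::
    "('a::topological_space, 'n::finite) chart set \<Rightarrow> ('a, 'n) metric_tensor \<Rightarrow> 'a \<Rightarrow> 'a \<Rightarrow> real" where
  "riem_dist A g x y =
     enn2real (INF \<gamma> \<in> {\<gamma>. piecewise_C1_curve A \<gamma> \<and> pathstart \<gamma> = x \<and> pathfinish \<gamma> = y}.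
       curve_length A g \<gamma>)"


subsection \<open>Riemannian volume\<close>

text \<open>The unique Borel measure that has density \<open>sqrt (det g)\<close> with respect to Lebesgue measure in
  every chart.\<close>

definition riem_volume ::
    "('a::topological_space, 'n::finite) chart set \<Rightarrow> ('a, 'n) metric_tensor \<Rightarrow> 'a measure" where
  "riem_volume A g =
     (THE M. sets M = sets borel \<and>
       (\<forall>c\<in>A. \<forall>B\<in>sets borel. B \<subseteq> chart_dom c \<longrightarrow>
          emeasure M B = (\<integral>\<^sup>+u\<in>chart_map c ` B. ennreal (sqrt (det (g c u))) \<partial>lborel)))"


subsection \<open>Differentiable maps and their Jacobian\<close>

definition C1_map :: "('a::topological_space, 'n::finite) chart set \<Rightarrow> ('a \<Rightarrow> 'a) \<Rightarrow> bool" where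
  "C1_map A T \<longleftrightarrow>
     continuous_on UNIV T \<and> (\<forall>c\<in>A. \<forall>d\<in>A. Ck_on 1 (local_dom c d T) (local_rep c d T))"

text \<open>The absolute value of the determinant of \<open>D\<^sub>xT\<close> with respect to orthonormal bases of the
  tangent spaces at \<open>x\<close> and \<open>T x\<close>. If the columns of \<open>P\<close> and \<open>Q\<close> are orthonormal bases for the Gram
  matrices \<open>G\<close> (at \<open>x\<close>) and \<open>H\<close> (at \<open>T x\<close>), then \<open>\<bar>det P\<bar> = 1 / sqrt (det G)\<close>,
  \<open>\<bar>det Q\<bar> = 1 / sqrt (det H)\<close>, and the matrix of \<open>D\<^sub>xT\<close> in these bases is the coordinate
  Jacobian matrix multiplied by the inverse of \<open>Q\<close> on the left and by \<open>P\<close> on the right.\<close>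

definition abs_det_D ::
    "('a, 'n::finite) chart set \<Rightarrow> ('a, 'n) metric_tensor \<Rightarrow> ('a \<Rightarrow> 'a) \<Rightarrow> 'a \<Rightarrow> real" where
  "abs_det_D A g T x =
     (let c = chart_at A x; d = chart_at A (T x)
      in \<bar>det (jacobian (local_rep c d T) (at (chart_map c x)))\<bar>
         * sqrt (det (g d (chart_map d (T x)))) / sqrt (det (g c (chart_map c x))))"


section \<open>Expanding maps\<close>

definition k_to_one :: "nat \<Rightarrow> ('a \<Rightarrow> 'a) \<Rightarrow> bool" where
  "k_to_one k T \<longleftrightarrow> (\<forall>x. finite (T -` {x}) \<and> card (T -` {x}) = k)"

definition uniformly_expanding :: "('a \<Rightarrow> 'a \<Rightarrow> real) \<Rightarrow> nat \<Rightarrow> ('a \<Rightarrow> 'a) \<Rightarrow> bool" where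
  "uniformly_expanding d k T \<longleftrightarrow>
     (\<exists>l>1. \<forall>x y. \<exists>\<xi> \<eta>.
        bij_betw \<xi> {1..k} (T -` {x}) \<and> bij_betw \<eta> {1..k} (T -` {y}) \<and>
        (\<forall>j\<in>{1..k}. d (\<xi> j) (\<eta> j) \<le> d x y / l))"


section \<open>Logarithmic moduli of continuity\<close>

text \<open>The behaviour of \<open>\<omega>\<close> beyond 1 and the value of \<open>r\<^sub>0\<close> are only subject to the stated
  conditions; two such \<open>\<omega>\<close> with the same \<open>\<beta>\<close> give the same function space when \<open>d\<close> is bounded.\<close>

definition log_modulus :: "real \<Rightarrow> (real \<Rightarrow> real) \<Rightarrow> bool" where
  "log_modulus \<beta> \<omega> \<longleftrightarrow>
     continuous_on {0..} \<omega> \<and> mono_on {0..} \<omega> \<and> concave_on {0..} \<omega> \<and> \<omega> 0 = 0 \<and>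
     (\<exists>r0>1. \<forall>r\<in>{0<..1}. \<omega> r = ln (r0 / r) powr (- \<beta>))"

definition mod_space :: "('a \<Rightarrow> 'a \<Rightarrow> real) \<Rightarrow> (real \<Rightarrow> real) \<Rightarrow> ('a \<Rightarrow> real) set" where
  "mod_space d \<omega> = {f. \<exists>C. \<forall>x y. \<bar>f x - f y\<bar> \<le> C * \<omega> (d x y)}"

definition Hol :: "('a \<Rightarrow> 'a \<Rightarrow> real) \<Rightarrow> (real \<Rightarrow> real) \<Rightarrow> ('a \<Rightarrow> real) \<Rightarrow> real" where
  "Hol d \<omega> f = Inf {C. 0 \<le> C \<and> (\<forall>x y. \<bar>f x - f y\<bar> \<le> C * \<omega> (d x y))}"


section \<open>Invariant measures and decay of correlations\<close>

definition invariant_prob :: "('a::topological_space \<Rightarrow> 'a) \<Rightarrow> 'a measure \<Rightarrow> bool" where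
  "invariant_prob T \<mu> \<longleftrightarrow>
     sets \<mu> = sets borel \<and> emeasure \<mu> (space \<mu>) = 1 \<and> T \<in> measurable \<mu> \<mu> \<and> distr \<mu> \<mu> T = \<mu>"

definition polynomial_decay ::
    "('a \<Rightarrow> 'a \<Rightarrow> real) \<Rightarrow> (real \<Rightarrow> real) \<Rightarrow> real \<Rightarrow> ('a \<Rightarrow> 'a) \<Rightarrow> 'a measure \<Rightarrow> bool" where
  "polynomial_decay d \<omega> \<alpha> T \<mu> \<longleftrightarrow>
     (\<exists>C. \<forall>f \<in> mod_space d \<omega>. \<forall>g. integrable \<mu> g \<longrightarrow> (\<forall>t\<ge>1.
        \<bar>(\<integral>x. f x * g ((T ^^ t) x) \<partial>\<mu>) - (\<integral>x. f x \<partial>\<mu>) * (\<integral>x. g x \<partial>\<mu>)\<bar>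
          \<le> C * Hol d \<omega> f * (\<integral>x. \<bar>g x\<bar> \<partial>\<mu>) / real t powr \<alpha>))"

end

theory Submission
  imports Defs
begin

text \<open>Let \<open>L\<close> be the transfer operator of \<open>T\<close>, \<open>(L f) x = (\<Sum>z \<in> T\<^sup>-\<^sup>1 x. f z / JT z)\<close>, which is dual to
  composition with \<open>T\<close> for the Riemannian volume. Matching the fibres of two points \<open>x\<close>, \<open>y\<close> under
  \<open>T\<^sup>n\<close> branch by branch contracts distances by \<open>\<lambda>\<^sup>-\<^sup>n\<close>. With \<open>\<omega>\<^sub>\<beta>\<close> for the modulus of exponent
  \<open>\<beta>\<close>, the logarithms of the two Jacobians of \<open>T\<^sup>n\<close> differ by at most a multiple of the sum of the
  \<open>\<omega>\<^sub>\<beta> (d x y / \<lambda>\<^sup>i)\<close>, hence by \<open>O (\<omega>\<^sub>\<beta>\<^sub>-\<^sub>1 (d x y))\<close>.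
  So \<open>L\<^sup>n f / L\<^sup>n 1\<close> are averages over fibres, and the averages at two points share a fixed
  proportion of mass along matched branches. Splitting \<open>n = m + r\<close>, the oscillation \<open>u n\<close> of
  \<open>L\<^sup>n f / L\<^sup>n 1\<close> satisfies \<open>u (m + r) \<le> C m\<^sup>1\<^sup>-\<^sup>\<beta> + (1 - \<epsilon>) u r\<close>; choosing \<open>r\<close> proportional to \<open>n\<close> gives
  \<open>u n = O (n\<^sup>1\<^sup>-\<^sup>\<beta>)\<close>. Applied to \<open>f = L\<^sup>p 1\<close> this makes \<open>L\<^sup>n 1\<close> uniformly Cauchy with limit the
  invariant density \<open>\<rho>\<close>; applied to \<open>f \<rho>\<close> minus a multiple of \<open>\<rho>\<close> it gives the decay.\<close>

text \<open>Contracting a distance by l^(-n) only adds n * ln l to the logarithm, so moduli improve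
  just polynomially in n. Hence the fixed mixing proportion \<epsilon> cannot simply be iterated:
  each use needs a waiting time m after which the matched part is small. Taking r near \<theta> * n
  with (1 - \<epsilon>) * \<theta>^(-\<alpha>) < 1 works because rescaling time then costs less than
  mixing gains. Dividing by L^n 1 yields true averages before any invariant density is known.
  Preservation of the integral identifies the constant that these averages approach, and since the
  approach is uniform, g need only be integrable. The geometric obstacle is that expansion is given
  only as a matching of whole fibres in the Riemannian distance, whereas duality with the volume
  requires T to be locally injective with nonvanishing Jacobian determinant. Both are extracted from
  the matching; the second needs upper and lower comparisons of the distance with coordinate
  norms.\<close>

section \<open>Transfer operators of expanding maps with logarithmic moduli\<close>

text \<open>On (0, D] the base \<open>1 + ln (D / r)\<close> is at least 1, so the weight is
  increasing and at most 1 over the whole range of distances. It replaces the moduli of the theorem,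
  whose formula is prescribed only up to 1; see \<open>log_modulus_comparable\<close>.\<close>

definition log_weight :: "real \<Rightarrow> real \<Rightarrow> real \<Rightarrow> real" where
  "log_weight D \<gamma> r = (if r \<le> 0 then 0 else (1 + ln (D / r)) powr (- \<gamma>))"

lemma log_weight_zero [simp]: "log_weight D \<gamma> 0 = 0"
  by (simp add: log_weight_def)

lemma log_weight_nonneg [simp]: "0 \<le> log_weight D \<gamma> r"
  by (simp add: log_weight_def)

lemma log_weight_le_one:
  assumes "r \<le> D" "0 \<le> \<gamma>"
  shows "log_weight D \<gamma> r \<le> 1"
proof (cases "r \<le> 0")
  case False
  then have "1 \<le> (1 + ln (D / r)) powr \<gamma>"
    using assms by (intro ge_one_powr_ge_zero) auto
  then show ?thesis
    using False by (simp add: log_weight_def powr_minus_divide divide_le_eq_1)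
qed (simp add: log_weight_def)

lemma log_weight_mono:
  assumes "r \<le> s" "s \<le> D" "0 \<le> \<gamma>"
  shows "log_weight D \<gamma> r \<le> log_weight D \<gamma> s"
proof (cases "r \<le> 0")
  case False
  with assms have "0 < r" "0 < s" "0 < D" by auto
  then have "ln (D / s) \<le> ln (D / r)" "0 \<le> ln (D / s)"
    using assms by (auto intro!: divide_left_mono)
  then have "(1 + ln (D / r)) powr (- \<gamma>) \<le> (1 + ln (D / s)) powr (- \<gamma>)"
    using assms by (intro powr_mono2') auto
  then show ?thesis
    using \<open>0 < r\<close> \<open>0 < s\<close> by (simp add: log_weight_def)
qed (simp add: log_weight_def)

lemma log_weight_div_power:
  assumes "0 < D" "1 < l"
  shows "log_weight D \<gamma> (D / l ^ n) = (1 + real n * ln l) powr (- \<gamma>)"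
  proof -
  have "\<not> D / l ^ n \<le> 0" using assms by (simp add: not_le)
  then show ?thesis using assms by (simp add: log_weight_def ln_realpow)
qed

text \<open>Mean value theorem: the derivative of x^(-a) is -a * z^(-a-1) at some intermediate z,
  and z^(-a-1) is at least its value at the right end.\<close>

lemma powr_neg_diff_ge:
  fixes x t a :: real
  assumes "0 < x" "0 < t" "0 < a"
  shows "a * t * (x + t) powr (- (a + 1)) \<le> x powr (- a) - (x + t) powr (- a)"
proof -
  have "\<exists>z. x < z \<and> z < x + t \<and>
      (x + t) powr (- a) - x powr (- a) = (x + t - x) * (- a * z powr (- a - 1))"
    using assms by (intro MVT2) (auto intro!: derivative_eq_intros simp: powr_diff field_simps)
  then obtain z where z: "x < z" "z < x + t"
    "(x + t) powr (- a) - x powr (- a) = (x + t - x) * (- a * z powr (- a - 1))"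
    by blast
  have "(x + t) powr (- a - 1) \<le> z powr (- a - 1)"
    using z assms by (intro powr_mono2') auto
  then have "a * t * (x + t) powr (- a - 1) \<le> a * t * z powr (- a - 1)"
    using assms by (intro mult_left_mono) auto
  moreover have "- a - 1 = - (a + 1)" by simp
  ultimately show ?thesis
    using z(3) by (simp only:) (simp add: algebra_simps)
qed

text \<open>Dividing by l adds ln l to the base of the power, so \<open>powr_neg_diff_ge\<close>
  applies with t = ln l. Summed along a branch, weights of exponent \<alpha> + 1 are controlled by a
  single weight of exponent \<alpha>: this is where one unit of \<beta> is lost.\<close>

lemma log_weight_telescope:
  assumes "1 < l" "0 < \<alpha>" "l * r \<le> D"
  shows "\<alpha> * ln l * log_weight D (\<alpha> + 1) r + log_weight D \<alpha> r \<le> log_weight D \<alpha> (l * r)"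
proof (cases "r \<le> 0")
  case False
  define x where "x = 1 + ln (D / (l * r))"
  have "0 < l * r" using False assms by simp
  then have "0 < D" using assms by linarith
  have "1 \<le> x" using \<open>0 < l * r\<close> assms by (simp add: x_def)
  have "\<not> l * r \<le> 0" using \<open>0 < l * r\<close> by simp
  have *: "1 + ln (D / r) = x + ln l"
    using False assms \<open>0 < D\<close> by (simp add: x_def ln_div ln_mult)
  show ?thesis
    using powr_neg_diff_ge[of x "ln l" \<alpha>] \<open>1 \<le> x\<close> assms False \<open>\<not> l * r \<le> 0\<close>
    by (simp only: log_weight_def * x_def[symmetric] if_False) simp
qed (use assms in \<open>simp add: log_weight_def mult_nonneg_nonpos\<close>)

text \<open>Coupling argument: replacing a by b costs v. Afterwards the part \<delta> * q of p
  cancels against q, and only the remaining mass 1 - \<delta> can be charged with the full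
  oscillation U.\<close>

lemma weighted_average_diff_le:
  fixes p q a b :: "'i \<Rightarrow> real"
  assumes "finite Z" "sum p Z = 1" "sum q Z = 1"
    and "\<And>z. z \<in> Z \<Longrightarrow> 0 \<le> p z" "\<And>z. z \<in> Z \<Longrightarrow> 0 \<le> q z" "\<And>z. z \<in> Z \<Longrightarrow> \<delta> * q z \<le> p z"
    and ab: "\<And>z. z \<in> Z \<Longrightarrow> a z \<le> b z + v"
    and U: "\<And>z z'. z \<in> Z \<Longrightarrow> z' \<in> Z \<Longrightarrow> b z - b z' \<le> U"
  shows "(\<Sum>z\<in>Z. p z * a z) - (\<Sum>z\<in>Z. q z * b z) \<le> v + (1 - \<delta>) * U"
proof -
  have "(\<Sum>z\<in>Z. p z * a z) \<le> (\<Sum>z\<in>Z. p z * (b z + v))"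
    using assms by (intro sum_mono mult_left_mono) auto
  also have "\<dots> = (\<Sum>z\<in>Z. p z * b z) + v"
    using assms by (simp add: distrib_left sum.distrib flip: sum_distrib_right)
  finally have 1: "(\<Sum>z\<in>Z. p z * a z) \<le> (\<Sum>z\<in>Z. p z * b z) + v" .
  \<comment> \<open>Summing b z - b z' against the nonnegative product weight (p - \<delta> q)(z) *
    q(z') gives exactly the difference of the p-average and the q-average of b, while the total
    weight is 1 - \<delta>.\<close>
  have "(\<Sum>z\<in>Z. \<Sum>z'\<in>Z. (p z - \<delta> * q z) * q z' * (b z - b z'))
      \<le> (\<Sum>z\<in>Z. \<Sum>z'\<in>Z. (p z - \<delta> * q z) * q z' * U)"
    using assms by (intro sum_mono mult_left_mono mult_nonneg_nonneg) auto
  also have "\<dots> = (\<Sum>z\<in>Z. p z - \<delta> * q z) * (\<Sum>z'\<in>Z. q z') * U"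
    by (subst sum_product) (simp only: sum_distrib_right)
  also have "\<dots> = (1 - \<delta>) * U"
    using assms by (simp add: sum_subtractf flip: sum_distrib_left)
  also have "(\<Sum>z\<in>Z. \<Sum>z'\<in>Z. (p z - \<delta> * q z) * q z' * (b z - b z'))
      = (\<Sum>z\<in>Z. (p z - \<delta> * q z) * b z * sum q Z - (p z - \<delta> * q z) * (\<Sum>z'\<in>Z. q z' * b z'))"
  proof (intro sum.cong refl)
    fix z
    have "(\<Sum>z'\<in>Z. (p z - \<delta> * q z) * q z' * (b z - b z'))
        = (\<Sum>z'\<in>Z. (p z - \<delta> * q z) * b z * q z' - (p z - \<delta> * q z) * (q z' * b z'))"
      by (intro sum.cong refl) (simp add: algebra_simps)
    then show "(\<Sum>z'\<in>Z. (p z - \<delta> * q z) * q z' * (b z - b z'))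
        = (p z - \<delta> * q z) * b z * sum q Z - (p z - \<delta> * q z) * (\<Sum>z'\<in>Z. q z' * b z')"
      by (simp only: sum_subtractf sum_distrib_left)
  qed
  also have "\<dots> = (\<Sum>z\<in>Z. p z * b z) - (\<Sum>z\<in>Z. q z * b z)"
  proof -
    have *: "(\<Sum>z\<in>Z. (p z - \<delta> * q z) * b z) = (\<Sum>z\<in>Z. p z * b z) - \<delta> * (\<Sum>z\<in>Z. q z * b z)"
      by (simp add: algebra_simps sum_subtractf sum_distrib_left)
    have **: "(\<Sum>z\<in>Z. (p z - \<delta> * q z)) = 1 - \<delta>"
      using assms by (simp add: sum_subtractf flip: sum_distrib_left)
    have "(\<Sum>z\<in>Z. (p z - \<delta> * q z) * b z * sum q Z - (p z - \<delta> * q z) * (\<Sum>z'\<in>Z. q z' * b z'))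
       = (\<Sum>z\<in>Z. (p z - \<delta> * q z) * b z) - (\<Sum>z\<in>Z. (p z - \<delta> * q z)) * (\<Sum>z'\<in>Z. q z' * b z')"
      using assms by (simp add: sum_subtractf flip: sum_distrib_right)
    then show ?thesis unfolding * ** by (simp add: algebra_simps)
  qed
  finally show ?thesis using 1 by linarith
qed

text \<open>The part that involves only fibres and distortion; no topology or measure enters. It is
  instantiated with \<alpha> = \<beta> - 1, the Riemannian distance for d and the Riemannian
  Jacobian for J.\<close>

locale expanding_branches =
  fixes d :: "'a \<Rightarrow> 'a \<Rightarrow> real" and T :: "'a \<Rightarrow> 'a" and J :: "'a \<Rightarrow> real" and l D K \<alpha> :: real
  assumes d_nonneg: "0 \<le> d x y" and d_le: "d x y \<le> D" and D_pos: "0 < D"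
    and l_gt_1: "1 < l" and K_nonneg: "0 \<le> K" and \<alpha>_pos: "0 < \<alpha>"
    and finite_fibre: "finite (T -` {x})" and fibre_nonempty: "T -` {x} \<noteq> {}"
    and fibre_matching: "\<exists>b. bij_betw b (T -` {x}) (T -` {y}) \<and> (\<forall>z\<in>T -` {x}. d z (b z) \<le> d x y / l)"
    and J_pos: "0 < J x"
    and ln_J_diff: "\<bar>ln (J x) - ln (J y)\<bar> \<le> K * log_weight D (\<alpha> + 1) (d x y)"
begin

text \<open>The factor is the one with which \<open>log_weight_telescope\<close> lets the increment
  of W from r to l * r pay for the distortion K * \<open>log_weight D (\<alpha> + 1) r\<close> of
  one step.\<close>

definition W :: "real \<Rightarrow> real" where
  "W r = K / (\<alpha> * ln l) * log_weight D \<alpha> r"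

lemma ln_l_pos: "0 < ln l"
  using l_gt_1 by simp

lemma W_nonneg: "0 \<le> W r"
  unfolding W_def using K_nonneg \<alpha>_pos ln_l_pos by (intro mult_nonneg_nonneg) auto

lemma W_mono: "r \<le> s \<Longrightarrow> s \<le> D \<Longrightarrow> W r \<le> W s"
  unfolding W_def using K_nonneg \<alpha>_pos ln_l_pos by (intro mult_left_mono log_weight_mono) auto

lemma W_telescope:
  assumes "l * r \<le> D"
  shows "K * log_weight D (\<alpha> + 1) r + W r \<le> W (l * r)"
proof -
  have "K / (\<alpha> * ln l) * (\<alpha> * ln l * log_weight D (\<alpha> + 1) r + log_weight D \<alpha> r) \<le> W (l * r)"
    unfolding W_def using K_nonneg \<alpha>_pos ln_l_pos l_gt_1 assms
    by (intro mult_left_mono log_weight_telescope) auto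
  then show ?thesis
    using \<alpha>_pos ln_l_pos by (simp add: W_def algebra_simps add_divide_distrib)
qed

section \<open>Branches of the iterates and their distortion\<close>

definition Jn :: "nat \<Rightarrow> 'a \<Rightarrow> real" where
  "Jn n z = (\<Prod>i<n. J ((T ^^ i) z))"

lemma Jn_pos: "0 < Jn n z"
  by (auto simp: Jn_def J_pos intro: prod_pos)

lemma Jn_add: "Jn (m + n) z = Jn n z * Jn m ((T ^^ n) z)"
proof (induction m)
  case (Suc m)
  then show ?case by (simp add: Jn_def funpow_add)
qed (simp add: Jn_def)

definition fibre :: "nat \<Rightarrow> 'a \<Rightarrow> 'a set" where
  "fibre n x = {z. (T ^^ n) z = x}"

lemma in_fibre [simp]: "z \<in> fibre n x \<longleftrightarrow> (T ^^ n) z = x"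
  by (simp add: fibre_def)

lemma fibre_Suc: "fibre (Suc n) x = (\<Union>w\<in>T -` {x}. fibre n w)"
  by auto

lemma finite_fibre_pow: "finite (fibre n x)"
proof (induction n arbitrary: x)
  case (Suc n)
  then show ?case using finite_fibre by (simp add: fibre_Suc)
qed (simp add: fibre_def)

lemma fibre_pow_nonempty: "fibre n x \<noteq> {}"
proof (induction n arbitrary: x)
  case 0
  have "x \<in> fibre 0 x" by simp
  then show ?case by blast
next
  case (Suc n)
  obtain w where "w \<in> T -` {x}" using fibre_nonempty by blast
  moreover obtain z where "z \<in> fibre n w" using Suc.IH by blast
  ultimately have "z \<in> fibre (Suc n) x" by simp
  then show ?case by blast
qed

text \<open>Subtracting \<open>W (d z (b z))\<close> makes the distortion bound telescope along the branch.\<close>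

lemma branch_matching:
  "\<exists>b. bij_betw b (fibre n x) (fibre n y) \<and>
     (\<forall>z\<in>fibre n x. d z (b z) \<le> d x y / l ^ n \<and>
        \<bar>ln (Jn n z) - ln (Jn n (b z))\<bar> \<le> W (d x y) - W (d z (b z)))"
proof (induction n arbitrary: x y)
  case 0
  have "bij_betw (\<lambda>_. y) (fibre 0 x) (fibre 0 y)"
    by (auto simp: bij_betw_def inj_on_def)
  then show ?case by (intro exI[of _ "\<lambda>_. y"]) (auto simp: Jn_def)
next
  case (Suc n)
  obtain b where b: "bij_betw b (T -` {x}) (T -` {y})"
    and db: "\<And>z. z \<in> T -` {x} \<Longrightarrow> d z (b z) \<le> d x y / l"
    using fibre_matching by blast
  obtain c where c: "\<And>u v. bij_betw (c u v) (fibre n u) (fibre n v)"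
    and dc: "\<And>u v z. z \<in> fibre n u \<Longrightarrow> d z (c u v z) \<le> d u v / l ^ n"
    and Jc: "\<And>u v z. z \<in> fibre n u \<Longrightarrow>
        \<bar>ln (Jn n z) - ln (Jn n (c u v z))\<bar> \<le> W (d u v) - W (d z (c u v z))"
    using Suc.IH by metis
  \<comment> \<open>The last points before x and y are matched first; z then follows the branch of
    T^n attached to that matched pair.\<close>
  define b' where "b' z = c ((T ^^ n) z) (b ((T ^^ n) z)) z" for z
  have cz: "(T ^^ n) (c u v z) = v" if "(T ^^ n) z = u" for u v z
    using c[of u v] that by (auto dest: bij_betwE)
  have bT: "T (b w) = y" if "T w = x" for w
    using b that by (auto dest: bij_betwE)
  have "inj_on b' (fibre (Suc n) x)"
  proof (rule inj_onI)
    fix z z' assume z: "z \<in> fibre (Suc n) x" "z' \<in> fibre (Suc n) x" and eq: "b' z = b' z'"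
    have "b ((T ^^ n) z) = b ((T ^^ n) z')"
      using arg_cong[OF eq, of "T ^^ n"] by (simp add: b'_def cz)
    then have "(T ^^ n) z = (T ^^ n) z'"
      using b z by (auto simp: bij_betw_def dest: inj_onD)
    then show "z = z'"
      using eq c[of "(T ^^ n) z" "b ((T ^^ n) z)"] by (auto simp: b'_def bij_betw_def dest: inj_onD)
  qed
  moreover have "b' ` fibre (Suc n) x = fibre (Suc n) y"
  proof (intro equalityI subsetI)
    fix z assume "z \<in> b' ` fibre (Suc n) x"
    then show "z \<in> fibre (Suc n) y" by (auto simp: b'_def cz bT)
  next
    fix z assume "z \<in> fibre (Suc n) y"
    then have "(T ^^ n) z \<in> b ` (T -` {x})"
      using b by (simp add: bij_betw_def)
    then obtain w where w: "w \<in> T -` {x}" "b w = (T ^^ n) z" by fastforce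
    have "z \<in> fibre n (b w)" using w by simp
    then have "z \<in> c w (b w) ` fibre n w"
      unfolding bij_betw_imp_surj_on[OF c] .
    then obtain z0 where z0: "z0 \<in> fibre n w" "c w (b w) z0 = z" by (elim imageE) simp
    then have "(T ^^ n) z0 = w" by simp
    then have "z = b' z0" "z0 \<in> fibre (Suc n) x"
      using w(1) z0(2) by (simp_all add: b'_def)
    then show "z \<in> b' ` fibre (Suc n) x" by blast
  qed
  moreover have "d z (b' z) \<le> d x y / l ^ Suc n \<and>
        \<bar>ln (Jn (Suc n) z) - ln (Jn (Suc n) (b' z))\<bar> \<le> W (d x y) - W (d z (b' z))"
    if "z \<in> fibre (Suc n) x" for z
  proof
    define w where "w = (T ^^ n) z"
    have w: "w \<in> T -` {x}" using that by (simp add: w_def)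
    have z: "z \<in> fibre n w" by (simp add: w_def)
    have b'z: "b' z = c w (b w) z" by (simp add: b'_def w_def)
    have "d w (b w) / l ^ n \<le> d x y / l / l ^ n"
      using db[OF w] l_gt_1 by (intro divide_right_mono) auto
    then show "d z (b' z) \<le> d x y / l ^ Suc n"
      using dc[OF z, of "b w"] by (simp add: b'z)
    have "l * d w (b w) \<le> d x y"
      using db[OF w] l_gt_1 by (simp add: field_simps)
    then have "W (l * d w (b w)) \<le> W (d x y)" "l * d w (b w) \<le> D"
      using d_le[of x y] by (auto intro!: W_mono)
    \<comment> \<open>Since w and b w are matched over x and y, their distance grows by a factor l
      at least, and the increase of W pays for the distortion of the last step.\<close>
    then have *: "K * log_weight D (\<alpha> + 1) (d w (b w)) + W (d w (b w)) \<le> W (d x y)"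
      using W_telescope[of "d w (b w)"] by simp
    have J1: "ln (Jn (Suc n) z) = ln (Jn n z) + ln (J w)" if "(T ^^ n) z = w" for z w
    proof -
      have "Jn (Suc n) z = Jn n z * J w" using that by (simp add: Jn_def)
      then show ?thesis using ln_mult_pos[OF Jn_pos J_pos] by simp
    qed
    have "ln (Jn (Suc n) z) = ln (Jn n z) + ln (J w)"
      "ln (Jn (Suc n) (b' z)) = ln (Jn n (b' z)) + ln (J (b w))"
      by (auto intro!: J1 simp: w_def b'_def cz)
    then show "\<bar>ln (Jn (Suc n) z) - ln (Jn (Suc n) (b' z))\<bar> \<le> W (d x y) - W (d z (b' z))"
      using Jc[OF z, of "b w"] ln_J_diff[of w "b w"] * by (simp add: b'z)
  qed
  ultimately show ?case unfolding bij_betw_def by blast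
qed

definition transfer :: "nat \<Rightarrow> ('a \<Rightarrow> real) \<Rightarrow> 'a \<Rightarrow> real" where
  "transfer n f x = (\<Sum>z\<in>fibre n x. f z / Jn n z)"

text \<open>The fibre of T^(m+n) is grouped by the value of T^n, and the Jacobian product factors
  accordingly.\<close>

lemma transfer_add: "transfer (m + n) f = transfer m (transfer n f)"
proof
  fix x
  have "transfer (m + n) f x = (\<Sum>w\<in>fibre m x. \<Sum>z | z \<in> fibre (m + n) x \<and> (T ^^ n) z = w. f z / Jn (m + n) z)"
    unfolding transfer_def
    by (intro sum.group[symmetric] finite_fibre_pow) (auto simp: funpow_add)
  also have "\<dots> = (\<Sum>w\<in>fibre m x. transfer n f w / Jn m w)"
  proof (intro sum.cong refl)
    fix w assume "w \<in> fibre m x"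
    then have "{z \<in> fibre (m + n) x. (T ^^ n) z = w} = fibre n w"
      by (auto simp: funpow_add)
    then show "(\<Sum>z | z \<in> fibre (m + n) x \<and> (T ^^ n) z = w. f z / Jn (m + n) z) = transfer n f w / Jn m w"
      unfolding transfer_def sum_divide_distrib by (intro sum.cong) (auto simp: Jn_add)
  qed
  finally show "transfer (m + n) f x = transfer m (transfer n f) x"
    by (simp add: transfer_def)
qed


lemma transfer_zero [simp]: "transfer 0 f = f"
proof
  fix x
  have "fibre 0 x = {x}" by (auto simp: fibre_def)
  then show "transfer 0 f x = f x" by (simp add: transfer_def Jn_def)
qed

lemma transfer_nonneg: "(\<And>z. 0 \<le> f z) \<Longrightarrow> 0 \<le> transfer n f x"
  unfolding transfer_def using Jn_pos by (intro sum_nonneg divide_nonneg_pos) auto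

lemma transfer_diff: "transfer n (\<lambda>z. f z - g z) x = transfer n f x - transfer n g x"
  by (simp add: transfer_def diff_divide_distrib sum_subtractf)

lemma transfer_cmult: "transfer n (\<lambda>z. c * f z) x = c * transfer n f x"
  by (simp add: transfer_def sum_distrib_left)

abbreviation N :: "nat \<Rightarrow> 'a \<Rightarrow> real" where
  "N n \<equiv> transfer n (\<lambda>_. 1)"

lemma N_pos: "0 < N n x"
  unfolding transfer_def using Jn_pos finite_fibre_pow fibre_pow_nonempty
  by (intro sum_pos) auto

lemma branch_distortion:
  "\<exists>b. bij_betw b (fibre n x) (fibre n y) \<and>
     (\<forall>z\<in>fibre n x. d z (b z) \<le> d x y / l ^ n \<and>
        Jn n z \<le> exp (W (d x y)) * Jn n (b z) \<and> Jn n (b z) \<le> exp (W (d x y)) * Jn n z)"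
proof -
  obtain b where b: "bij_betw b (fibre n x) (fibre n y)"
    and db: "\<And>z. z \<in> fibre n x \<Longrightarrow> d z (b z) \<le> d x y / l ^ n"
    and Jb: "\<And>z. z \<in> fibre n x \<Longrightarrow> \<bar>ln (Jn n z) - ln (Jn n (b z))\<bar> \<le> W (d x y) - W (d z (b z))"
    using branch_matching[of n x y] by blast
  have *: "u \<le> exp w * v" if "0 < u" "0 < v" "ln u \<le> w + ln v" for u v w :: real
    using that exp_le_cancel_iff[of "ln u" "w + ln v"] by (simp add: exp_add)
  have "ln (Jn n z) \<le> W (d x y) + ln (Jn n (b z))" "ln (Jn n (b z)) \<le> W (d x y) + ln (Jn n z)"
    if "z \<in> fibre n x" for z
    using Jb[OF that] W_nonneg[of "d z (b z)"] by linarith+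
  then show ?thesis
    using b db by (intro exI[of _ b] conjI ballI *[OF Jn_pos Jn_pos])
qed

text \<open>Matched branches compare the two sums term by term, so the distortion of a single branch
  bounds that of the sum, with a constant independent of n.\<close>

lemma N_distortion:
  "N n x \<le> exp (W (d x y)) * N n y" "N n y \<le> exp (W (d x y)) * N n x"
proof -
  obtain b where b: "bij_betw b (fibre n x) (fibre n y)"
    and J: "\<forall>z\<in>fibre n x. d z (b z) \<le> d x y / l ^ n \<and>
        Jn n z \<le> exp (W (d x y)) * Jn n (b z) \<and> Jn n (b z) \<le> exp (W (d x y)) * Jn n z"
    using branch_distortion[of n x y] by (elim exE conjE)
  have Ny: "N n y = (\<Sum>z\<in>fibre n x. 1 / Jn n (b z))"
    unfolding transfer_def using sum.reindex_bij_betw[OF b, of "\<lambda>z. 1 / Jn n z"] by simp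
  have *: "1 / u \<le> exp w * (1 / v)" if "0 < u" "0 < v" "v \<le> exp w * u" for u v w :: real
    using that by (simp add: divide_simps mult.commute)
  show "N n x \<le> exp (W (d x y)) * N n y" "N n y \<le> exp (W (d x y)) * N n x"
    unfolding Ny unfolding transfer_def sum_distrib_left
    using J Jn_pos by (intro sum_mono *; simp)+
qed

end

section \<open>Normalised averages and the decay of their oscillation\<close>

context expanding_branches begin
text \<open>The constant function 1 need not be fixed by the transfer operator; division by
  \<open>N n\<close> makes the operator preserve constants without using an invariant
  density.\<close>

definition ratio :: "nat \<Rightarrow> ('a \<Rightarrow> real) \<Rightarrow> 'a \<Rightarrow> real" where
  "ratio n f x = transfer n f x / N n x"

text \<open>Multiplying and dividing by \<open>N r z\<close> produces these weights. Their sum is 1,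
  because for f = 1 both ratios are 1.\<close>

lemma ratio_add:
  "ratio (m + r) f x = (\<Sum>z\<in>fibre m x. N r z / (Jn m z * N (m + r) x) * ratio r f z)"
proof -
  have "ratio (m + r) f x = transfer m (transfer r f) x / N (m + r) x"
    by (simp add: ratio_def transfer_add)
  also have "\<dots> = (\<Sum>z\<in>fibre m x. transfer r f z / Jn m z / N (m + r) x)"
    by (simp only: transfer_def[of m] sum_divide_distrib)
  also have "\<dots> = (\<Sum>z\<in>fibre m x. N r z / (Jn m z * N (m + r) x) * ratio r f z)"
  proof (intro sum.cong refl)
    fix z
    have "N r z \<noteq> 0" using N_pos[of r z] by simp
    then show "transfer r f z / Jn m z / N (m + r) x = N r z / (Jn m z * N (m + r) x) * ratio r f z"
      by (simp add: ratio_def)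
  qed
  finally show ?thesis .
qed

text \<open>\<open>ratio (m + r) f x\<close> averages \<open>ratio r f\<close> over the fibre of \<open>x\<close>; matching the fibres of two
  points, a proportion \<open>exp (- 3 W)\<close> of the two averages is transported along nearby points.\<close>

lemma ratio_step:
  assumes V: "\<And>x y. \<bar>ratio r f x - ratio r f y\<bar> \<le> V (d x y)"
    and V_mono: "\<And>s t. 0 \<le> s \<Longrightarrow> s \<le> t \<Longrightarrow> t \<le> D \<Longrightarrow> V s \<le> V t"
    and U: "\<And>x y. \<bar>ratio r f x - ratio r f y\<bar> \<le> U"
  shows "\<bar>ratio (m + r) f x - ratio (m + r) f y\<bar> \<le> V (d x y / l ^ m) + (1 - exp (- 3 * W (d x y))) * U"
proof -
  define w where "w = W (d x y)"
  obtain b where b: "bij_betw b (fibre m x) (fibre m y)"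
    and bz: "\<forall>z\<in>fibre m x. d z (b z) \<le> d x y / l ^ m \<and>
        Jn m z \<le> exp w * Jn m (b z) \<and> Jn m (b z) \<le> exp w * Jn m z"
    unfolding w_def using branch_distortion[of m x y] by (elim exE conjE)
  from bz have db: "d z (b z) \<le> d x y / l ^ m" and J1: "Jn m z \<le> exp w * Jn m (b z)"
    and J2: "Jn m (b z) \<le> exp w * Jn m z" if "z \<in> fibre m x" for z
    using that by blast+
  define p where "p x z = N r z / (Jn m z * N (m + r) x)" for x z
  have p_nonneg: "0 \<le> p x z" for x z
    unfolding p_def using N_pos Jn_pos by (intro divide_nonneg_pos mult_pos_pos less_imp_le) auto
  \<comment> \<open>The case f = 1 of \<open>ratio_add\<close>.\<close>
  have p_sum: "sum (p x) (fibre m x) = 1" for x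
  proof -
    have "ratio n (\<lambda>_. 1) z = 1" for n z
      using N_pos[of n z] by (simp add: ratio_def)
    then show ?thesis using ratio_add[of m r "\<lambda>_. 1" x] by (simp add: p_def)
  qed
  have q_sum: "(\<Sum>z\<in>fibre m x. p y (b z)) = 1"
    using sum.reindex_bij_betw[OF b, of "p y"] p_sum by simp
  have dxy: "d x y / l ^ m \<le> d x y"
    using d_nonneg[of x y] l_gt_1 by (simp add: divide_le_eq mult_le_cancel_left1)
  \<comment> \<open>The points z and b z are no further apart than the bound for x and y, so the
    same w controls the distortion of \<open>N r\<close> between them.\<close>
  have Nb: "N r z \<le> exp w * N r (b z)" "N r (b z) \<le> exp w * N r z" if "z \<in> fibre m x" for z
  proof -
    have "W (d z (b z)) \<le> w"
      unfolding w_def using db[OF that] dxy d_le[of x y] by (intro W_mono) auto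
    then have "exp (W (d z (b z))) * N r z' \<le> exp w * N r z'" for z'
      using N_pos[of r z'] by simp
    then show "N r z \<le> exp w * N r (b z)" "N r (b z) \<le> exp w * N r z"
      using order_trans[OF N_distortion(1)[where y = "b z"]] order_trans[OF N_distortion(2)[where x = z]] by blast+
  qed
  \<comment> \<open>The exponent 3 counts the quantities compared up to a factor exp w: the value of
    \<open>N r\<close>, the Jacobian \<open>Jn m\<close> and the normalisation
    \<open>N (m + r)\<close>.\<close>
  have comb: "exp (- 3 * w) * (n2 / (j2 * k2)) \<le> n1 / (j1 * k1)"
    if "0 < n1" "0 < n2" "0 < j1" "0 < j2" "0 < k1" "0 < k2"
      "n2 \<le> exp w * n1" "j1 \<le> exp w * j2" "k1 \<le> exp w * k2" for n1 n2 j1 j2 k1 k2 :: real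
  proof -
    have e3: "exp (- 3 * w) * exp (3 * w) = 1" by (simp flip: exp_add)
    have "n2 * (j1 * k1) \<le> (exp w * n1) * ((exp w * j2) * (exp w * k2))"
      using that by (intro mult_mono mult_nonneg_nonneg) auto
    also have "\<dots> = exp (3 * w) * (n1 * (j2 * k2))"
      using exp_of_nat_mult[of 3 w] by (simp add: power3_eq_cube)
    finally have "exp (- 3 * w) * (n2 * (j1 * k1)) \<le> exp (- 3 * w) * (exp (3 * w) * (n1 * (j2 * k2)))"
      by (intro mult_left_mono) auto
    also have "\<dots> = n1 * (j2 * k2)"
      using e3 by (metis mult.assoc mult_1)
    finally show ?thesis
      using that by (simp add: frac_le_eq divide_le_0_iff divide_simps)
  qed
  have pq: "exp (- 3 * w) * p y (b z) \<le> p x z" "exp (- 3 * w) * p x z \<le> p y (b z)"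
    if "z \<in> fibre m x" for z
    unfolding p_def
    using Nb[OF that] J1[OF that] J2[OF that] N_distortion[where x = x and y = y, folded w_def]
    by (intro comb N_pos Jn_pos; simp)+
  have close: "\<bar>ratio r f z - ratio r f (b z)\<bar> \<le> V (d x y / l ^ m)" if "z \<in> fibre m x" for z
    using V[of z "b z"] V_mono[of "d z (b z)" "d x y / l ^ m"] db[OF that] dxy d_le[of x y] d_nonneg
    by (meson order_trans)
  have rx: "ratio (m + r) f x = (\<Sum>z\<in>fibre m x. p x z * ratio r f z)"
    by (simp add: ratio_add p_def)
  have ry: "ratio (m + r) f y = (\<Sum>z\<in>fibre m x. p y (b z) * ratio r f (b z))"
    using sum.reindex_bij_betw[OF b, of "\<lambda>z. p y z * ratio r f z"] by (simp add: ratio_add p_def)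
  have Uz: "ratio r f z - ratio r f z' \<le> U" for z z'
    using U[of z z'] by linarith
  have "ratio (m + r) f x - ratio (m + r) f y \<le> V (d x y / l ^ m) + (1 - exp (- 3 * w)) * U"
    unfolding rx ry using p_nonneg pq p_sum q_sum finite_fibre_pow Uz
  proof (intro weighted_average_diff_le)
    show "ratio r f z \<le> ratio r f (b z) + V (d x y / l ^ m)" if "z \<in> fibre m x" for z
      using close[OF that] by linarith
  qed auto
  moreover have "ratio (m + r) f y - ratio (m + r) f x \<le> V (d x y / l ^ m) + (1 - exp (- 3 * w)) * U"
    unfolding rx ry using p_nonneg pq p_sum q_sum finite_fibre_pow Uz
  proof (intro weighted_average_diff_le)
    show "ratio r f (b z) \<le> ratio r f z + V (d x y / l ^ m)" if "z \<in> fibre m x" for z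
      using close[OF that] by linarith
  qed auto
  ultimately show ?thesis unfolding w_def by linarith
qed

text \<open>The summand 1 comes from the matched part of the averages, the other from 1 - exp (-3 *
  W) \<le> 3 * W, as in \<open>ratio_modulus\<close>.\<close>

definition modulus_const :: real where
  "modulus_const = 1 + 3 * (K / (\<alpha> * ln l))"

lemma modulus_const_ge: "1 \<le> modulus_const"
  unfolding modulus_const_def using K_nonneg \<alpha>_pos ln_l_pos by simp

lemma lw_diff_le_const:
  assumes "\<And>x y. \<bar>f x - f y\<bar> \<le> H * log_weight D \<alpha> (d x y)" "0 \<le> H"
  shows "\<bar>f x - f y\<bar> \<le> H"
proof -
  have "H * log_weight D \<alpha> (d x y) \<le> H * 1"
    using assms \<alpha>_pos d_le by (intro mult_left_mono log_weight_le_one) auto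
  then show ?thesis using assms(1)[of x y] by simp
qed

text \<open>This is \<open>ratio_step\<close> with r = 0. The unmatched mass 1 - exp (-3 * W) is
  itself at most a multiple of the log weight, which keeps the modulus uniform in n.\<close>

lemma ratio_modulus:
  assumes f: "\<And>x y. \<bar>f x - f y\<bar> \<le> H * log_weight D \<alpha> (d x y)" and "0 \<le> H"
  shows "\<bar>ratio n f x - ratio n f y\<bar> \<le> modulus_const * H * log_weight D \<alpha> (d x y)"
proof -
  have r0: "ratio 0 f = f" by (simp add: ratio_def fun_eq_iff)
  have "\<bar>ratio (n + 0) f x - ratio (n + 0) f y\<bar>
      \<le> H * log_weight D \<alpha> (d x y / l ^ n) + (1 - exp (- 3 * W (d x y))) * H"
    using f \<open>0 \<le> H\<close> \<alpha>_pos lw_diff_le_const[OF f]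
    by (intro ratio_step) (auto simp: r0 intro!: mult_left_mono log_weight_mono)
  also have "H * log_weight D \<alpha> (d x y / l ^ n) \<le> H * log_weight D \<alpha> (d x y)"
    using \<open>0 \<le> H\<close> \<alpha>_pos d_nonneg[of x y] l_gt_1 d_le
    by (intro mult_left_mono log_weight_mono) (auto simp: divide_le_eq mult_le_cancel_left1)
  also have "(1 - exp (- 3 * W (d x y))) * H \<le> (3 * W (d x y)) * H"
    using exp_ge_add_one_self[of "- 3 * W (d x y)"] \<open>0 \<le> H\<close> by (intro mult_right_mono) auto
  finally show ?thesis
    by (simp add: modulus_const_def W_def algebra_simps)
qed

text \<open>The modulus of \<open>ratio r f\<close> is uniform in r, so after m further steps its
  matched part is evaluated at distance at most D / l^m, where the weight is explicit. For the
  unmatched mass the worst case W D is taken.\<close>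

lemma ratio_contract:
  assumes f: "\<And>x y. \<bar>f x - f y\<bar> \<le> H * log_weight D \<alpha> (d x y)" and "0 \<le> H"
    and U: "\<And>x y. \<bar>ratio r f x - ratio r f y\<bar> \<le> U"
  shows "\<bar>ratio (m + r) f x - ratio (m + r) f y\<bar>
    \<le> modulus_const * H * (1 + real m * ln l) powr (- \<alpha>) + (1 - exp (- 3 * W D)) * U"
proof -
  have "0 \<le> U" using U[of x y] by linarith
  have "\<bar>ratio (m + r) f x - ratio (m + r) f y\<bar>
    \<le> modulus_const * H * log_weight D \<alpha> (d x y / l ^ m) + (1 - exp (- 3 * W (d x y))) * U"
    using \<open>0 \<le> H\<close> modulus_const_ge \<alpha>_pos U
    by (intro ratio_step ratio_modulus[OF f]) (auto intro!: mult_left_mono log_weight_mono)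
  also have "modulus_const * H * log_weight D \<alpha> (d x y / l ^ m) \<le> modulus_const * H * log_weight D \<alpha> (D / l ^ m)"
    using \<open>0 \<le> H\<close> modulus_const_ge \<alpha>_pos d_le l_gt_1 D_pos
    by (intro mult_left_mono log_weight_mono)
      (auto simp: divide_le_eq mult_le_cancel_left1 intro!: divide_right_mono)
  also have "(1 - exp (- 3 * W (d x y))) * U \<le> (1 - exp (- 3 * W D)) * U"
    using W_mono[of "d x y" D] d_le \<open>0 \<le> U\<close> by (intro mult_right_mono) auto
  finally show ?thesis using D_pos l_gt_1 by (simp add: log_weight_div_power)
qed

end

text \<open>\<open>P n U\<close> stands for "U bounds the oscillation at time n". A predicate avoids
  suprema of functions, and B is obtained before P and H, so that it serves all functions f
  simultaneously.\<close>

lemma polynomial_recursion: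
  fixes \<alpha> \<epsilon> C c :: real
  assumes "0 < \<alpha>" "0 < \<epsilon>" "\<epsilon> \<le> 1" "0 < C" "0 < c"
  obtains B where "0 < B"
    and "\<And>(P :: nat \<Rightarrow> real \<Rightarrow> bool) H n. 0 \<le> H \<Longrightarrow> (\<And>n. P n H) \<Longrightarrow> (\<And>n U V. P n U \<Longrightarrow> U \<le> V \<Longrightarrow> P n V) \<Longrightarrow>
      (\<And>m r U. P r U \<Longrightarrow> P (m + r) (C * H * (1 + real m * c) powr (- \<alpha>) + (1 - \<epsilon>) * U)) \<Longrightarrow>
      1 \<le> n \<Longrightarrow> P n (B * H * real n powr (- \<alpha>))"
proof -
  \<comment> \<open>Chosen so that \<theta>^(-\<alpha>) = 1 / (1 - \<epsilon> / 2). As 1 -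
    \<epsilon> \<le> (1 - \<epsilon> / 2)^2, passing from time n to \<theta> * n leaves a factor 1 -
    \<epsilon> / 2.\<close>
  define \<theta> where "\<theta> = (1 - \<epsilon> / 2) powr (1 / \<alpha>)"
  have "0 < \<theta>" using assms by (simp add: \<theta>_def)
  have "\<theta> < 1" using assms powr_less_mono2[of "1 / \<alpha>" "1 - \<epsilon> / 2" 1] by (simp add: \<theta>_def)
  have \<theta>_powr: "\<theta> powr (- \<alpha>) = 1 / (1 - \<epsilon> / 2)"
    using assms by (simp add: \<theta>_def powr_powr powr_minus_divide)
  have "(1 - \<epsilon>) / (1 - \<epsilon> / 2) \<le> 1 - \<epsilon> / 2"
  proof -
    have "(1 - \<epsilon> / 2) * (1 - \<epsilon> / 2) = (1 - \<epsilon>) + (\<epsilon> / 2) * (\<epsilon> / 2)"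
      by (simp add: algebra_simps)
    then show ?thesis using assms by (simp add: pos_divide_le_eq)
  qed
  then have \<theta>_\<epsilon>: "(1 - \<epsilon>) * \<theta> powr (- \<alpha>) \<le> 1 - \<epsilon> / 2"
    by (simp add: \<theta>_powr)
  \<comment> \<open>A lower bound for the waiting time: rounding r up leaves m \<ge> (1 - \<theta>)
    * n - 1, hence e * n \<le> 1 + m * c.\<close>
  define e where "e = min 1 c * (1 - \<theta>)"
  have "0 < e" using assms \<open>\<theta> < 1\<close> by (simp add: e_def)
  \<comment> \<open>The saving \<epsilon> / 2 * B must pay for C * e^(-\<alpha>), which gives the
    first summand; the second covers the small n for which rounding leaves no waiting time.\<close>
  define B where "B = 2 * C * e powr (- \<alpha>) / \<epsilon> + (1 - \<theta>) powr (- \<alpha>)"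
  have "0 < B" unfolding B_def using assms \<open>0 < e\<close> \<open>\<theta> < 1\<close> by (intro add_pos_pos divide_pos_pos mult_pos_pos) auto
  have B1: "C * e powr (- \<alpha>) + (1 - \<epsilon> / 2) * B \<le> B"
    unfolding B_def using assms by (simp add: field_simps)
  have B2: "(1 - \<theta>) powr (- \<alpha>) \<le> B"
    unfolding B_def using assms by simp
  show thesis
  proof (rule that[OF \<open>0 < B\<close>])
    fix P :: "nat \<Rightarrow> real \<Rightarrow> bool" and H :: real and n :: nat
    assume "0 \<le> H" and base: "\<And>n. P n H"
      and mono: "\<And>n U V. P n U \<Longrightarrow> U \<le> V \<Longrightarrow> P n V"
      and rec: "\<And>m r U. P r U \<Longrightarrow> P (m + r) (C * H * (1 + real m * c) powr (- \<alpha>) + (1 - \<epsilon>) * U)"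
      and "1 \<le> n"
    from \<open>1 \<le> n\<close> show "P n (B * H * real n powr (- \<alpha>))"
    proof (induction n rule: less_induct)
      case (less n)
      define r where "r = nat \<lceil>\<theta> * real n\<rceil>"
      have \<theta>n: "0 < \<theta> * real n" using less.prems \<open>0 < \<theta>\<close> by simp
      have r1: "\<theta> * real n \<le> real r" "real r < \<theta> * real n + 1"
        unfolding r_def using \<theta>n by linarith+
      show ?case
      proof (cases "r < n")
        case True
        have "1 \<le> r" using r1 \<theta>n by (cases r) auto
        define m where "m = n - r"
        have n: "n = m + r" using True by (simp add: m_def)
        have "e * real n \<le> 1 + real m * c"
        proof -
          have "(1 - \<theta>) * real n \<le> 1 + real m"
            using r1 n by (simp add: algebra_simps)
          then have "min 1 c * ((1 - \<theta>) * real n) \<le> min 1 c * (1 + real m)"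
            using assms by (intro mult_left_mono) auto
          also have "\<dots> \<le> 1 + real m * c"
          proof -
            have "min 1 c * real m \<le> c * real m" by (intro mult_right_mono) auto
            then show ?thesis by (simp add: algebra_simps)
          qed
          finally show ?thesis by (simp add: e_def)
        qed
        then have "(1 + real m * c) powr (- \<alpha>) \<le> (e * real n) powr (- \<alpha>)"
          using \<open>0 < e\<close> less.prems assms by (intro powr_mono2') auto
        then have 1: "C * H * (1 + real m * c) powr (- \<alpha>) \<le> C * H * (e powr (- \<alpha>) * real n powr (- \<alpha>))"
          using assms \<open>0 \<le> H\<close> \<open>0 < e\<close> by (intro mult_left_mono) (auto simp: powr_mult)
        have "real r powr (- \<alpha>) \<le> (\<theta> * real n) powr (- \<alpha>)"
          using r1 \<theta>n assms by (intro powr_mono2') auto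
        then have "(1 - \<epsilon>) * real r powr (- \<alpha>) \<le> (1 - \<epsilon>) * \<theta> powr (- \<alpha>) * real n powr (- \<alpha>)"
          using assms \<open>0 < \<theta>\<close> by (simp add: powr_mult mult_left_mono mult.assoc)
        also have "\<dots> \<le> (1 - \<epsilon> / 2) * real n powr (- \<alpha>)"
          using \<theta>_\<epsilon> by (intro mult_right_mono) auto
        finally have "B * H * ((1 - \<epsilon>) * real r powr (- \<alpha>)) \<le> B * H * ((1 - \<epsilon> / 2) * real n powr (- \<alpha>))"
          using \<open>0 < B\<close> \<open>0 \<le> H\<close> by (intro mult_left_mono) auto
        then have "C * H * (1 + real m * c) powr (- \<alpha>) + (1 - \<epsilon>) * (B * H * real r powr (- \<alpha>))
          \<le> (C * e powr (- \<alpha>) + (1 - \<epsilon> / 2) * B) * (H * real n powr (- \<alpha>))"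
          using 1 by (simp add: algebra_simps)
        also have "\<dots> \<le> B * (H * real n powr (- \<alpha>))"
          using B1 \<open>0 \<le> H\<close> by (intro mult_right_mono) auto
        finally have "C * H * (1 + real m * c) powr (- \<alpha>) + (1 - \<epsilon>) * (B * H * real r powr (- \<alpha>))
          \<le> B * H * real n powr (- \<alpha>)" by (simp add: mult.assoc)
        then show ?thesis
          using mono[OF rec[OF less.IH[OF True \<open>1 \<le> r\<close>]]] n by simp
      next
        case False
        \<comment> \<open>Rounding up reaches n only if (1 - \<theta>) * n \<le> 1. For such n the
          trivial bound H is already below B * H * n^(-\<alpha>).\<close>
        then have "(1 - \<theta>) * real n \<le> 1" using r1 by (simp add: algebra_simps)
        then have "1 \<le> ((1 - \<theta>) * real n) powr (- \<alpha>)"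
          using \<open>\<theta> < 1\<close> less.prems assms powr_mono2'[of "- \<alpha>" "(1 - \<theta>) * real n" 1] by simp
        also have "\<dots> \<le> B * real n powr (- \<alpha>)"
          using B2 \<open>\<theta> < 1\<close> by (simp add: powr_mult mult_right_mono)
        finally have "H * 1 \<le> H * (B * real n powr (- \<alpha>))"
          using \<open>0 \<le> H\<close> by (intro mult_left_mono)
        then show ?thesis using mono[OF base] by (simp add: mult.commute mult.left_commute)
      qed
    qed
  qed
qed

text \<open>Independence of B from f is essential: the bound is applied to L^p 1 for all p at once
  and to functions built from arbitrary observables.\<close>

lemma (in expanding_branches) ratio_decay:
  "\<exists>B>0. \<forall>f H n x y. (\<forall>x y. \<bar>f x - f y\<bar> \<le> H * log_weight D \<alpha> (d x y)) \<longrightarrow> 0 \<le> H \<longrightarrow> 1 \<le> n \<longrightarrow>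
    \<bar>ratio n f x - ratio n f y\<bar> \<le> B * H * real n powr (- \<alpha>)"
proof (rule polynomial_recursion[of \<alpha> "exp (- 3 * W D)" modulus_const "ln l"])
  show "exp (- 3 * W D) \<le> 1" "0 < modulus_const" using W_nonneg[of D] modulus_const_ge by auto
  fix B assume "0 < B" and B: "\<And>(P :: nat \<Rightarrow> real \<Rightarrow> bool) H n. 0 \<le> H \<Longrightarrow> (\<And>n. P n H) \<Longrightarrow>
      (\<And>n U V. P n U \<Longrightarrow> U \<le> V \<Longrightarrow> P n V) \<Longrightarrow>
      (\<And>m r U. P r U \<Longrightarrow> P (m + r) (modulus_const * H * (1 + real m * ln l) powr (- \<alpha>) + (1 - exp (- 3 * W D)) * U)) \<Longrightarrow>
      1 \<le> n \<Longrightarrow> P n (B * H * real n powr (- \<alpha>))"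
  show "\<exists>B>0. \<forall>f H n x y. (\<forall>x y. \<bar>f x - f y\<bar> \<le> H * log_weight D \<alpha> (d x y)) \<longrightarrow> 0 \<le> H \<longrightarrow> 1 \<le> n \<longrightarrow>
    \<bar>ratio n f x - ratio n f y\<bar> \<le> B * H * real n powr (- \<alpha>)"
  proof (intro exI[of _ "modulus_const * B"] conjI allI impI)
    show "0 < modulus_const * B" using \<open>0 < B\<close> modulus_const_ge by simp
    fix f H and n :: nat and x y
    assume "\<forall>x y. \<bar>f x - f y\<bar> \<le> H * log_weight D \<alpha> (d x y)" and H: "0 \<le> H" and n: "1 \<le> n"
    then have f: "\<And>x y. \<bar>f x - f y\<bar> \<le> H * log_weight D \<alpha> (d x y)" by blast
    have H1: "H \<le> modulus_const * H" using modulus_const_ge H by (simp add: mult_le_cancel_right1)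
    have f': "\<bar>f x - f y\<bar> \<le> modulus_const * H * log_weight D \<alpha> (d x y)" for x y
      using f[of x y] mult_right_mono[OF H1 log_weight_nonneg[of D \<alpha> "d x y"]] by linarith
    define P where "P n U \<longleftrightarrow> (\<forall>x y. \<bar>ratio n f x - ratio n f y\<bar> \<le> U)" for n U
    have "P n (B * (modulus_const * H) * real n powr (- \<alpha>))"
    proof (rule B)
      show "P n (modulus_const * H)" for n
        unfolding P_def using lw_diff_le_const[OF ratio_modulus[OF f H]] modulus_const_ge H by auto
      show "P (m + r) (modulus_const * (modulus_const * H) * (1 + real m * ln l) powr (- \<alpha>) + (1 - exp (- 3 * W D)) * U)"
        if "P r U" for m r U
        using that ratio_contract[OF f'] modulus_const_ge H unfolding P_def by auto
    qed (use modulus_const_ge H n in \<open>auto simp: P_def intro: order_trans\<close>)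
    then show "\<bar>ratio n f x - ratio n f y\<bar> \<le> modulus_const * B * H * real n powr (- \<alpha>)"
      by (simp add: P_def mult.commute mult.left_commute)
  qed
qed (use \<alpha>_pos ln_l_pos in auto)

lemma exp_minus_one_le:
  fixes w :: real
  shows "exp w - 1 \<le> w * exp w"
proof -
  have "(1 - w) * exp w \<le> exp (- w) * exp w"
    using exp_ge_add_one_self[of "- w"] by (intro mult_right_mono) auto
  then show ?thesis by (simp add: algebra_simps flip: exp_add)
qed

text \<open>Duality is required only for one step and nonnegative F; iterates follow by induction
  and signed observables are later shifted by a constant. \<open>modulus_measurable\<close> stands
  for the continuity of functions with a log modulus.\<close>

locale expanding_transfer = expanding_branches d T J l D K \<alpha> + finite_measure M
  for d :: "'a \<Rightarrow> 'a \<Rightarrow> real" and T J l D K \<alpha> and M :: "'a measure" +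
  assumes space_M: "space M = UNIV" and M_pos: "0 < measure M UNIV"
    and measurable_T: "T \<in> measurable M M"
    and modulus_measurable:
      "(\<And>x y. \<bar>f x - f y\<bar> \<le> H * log_weight D \<alpha> (d x y)) \<Longrightarrow> f \<in> borel_measurable M"
    and transfer_one_measurable:
      "F \<in> borel_measurable M \<Longrightarrow> (\<And>x. 0 \<le> F x) \<Longrightarrow> (\<lambda>x. \<Sum>z\<in>T -` {x}. F z / J z) \<in> borel_measurable M"
    and transfer_one_duality:
      "F \<in> borel_measurable M \<Longrightarrow> (\<And>x. 0 \<le> F x) \<Longrightarrow>
        distr (density M (\<lambda>x. ennreal (F x))) M T = density M (\<lambda>x. ennreal (\<Sum>z\<in>T -` {x}. F z / J z))"
begin

section \<open>Duality for iterates and bounds for L^n 1\<close>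

abbreviation V :: real where "V \<equiv> measure M UNIV"

lemma transfer_one: "transfer 1 F = (\<lambda>x. \<Sum>z\<in>T -` {x}. F z / J z)"
proof
  fix x
  have "fibre 1 x = T -` {x}" by auto
  then show "transfer 1 F x = (\<Sum>z\<in>T -` {x}. F z / J z)" by (simp add: transfer_def Jn_def)
qed

lemma measurable_T_pow [measurable]: "T ^^ n \<in> measurable M M"
proof (induction n)
  case (Suc n)
  then show ?case using measurable_T by (simp add: measurable_comp)
qed (simp add: id_def)

lemma transfer_measurable_and_duality:
  assumes "F \<in> borel_measurable M" "\<And>x. 0 \<le> F x"
  shows "transfer n F \<in> borel_measurable M \<and>
    distr (density M (\<lambda>x. ennreal (F x))) M (T ^^ n) = density M (\<lambda>x. ennreal (transfer n F x))"
  using assms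
proof (induction n arbitrary: F)
  case 0
  then show ?case by (simp add: id_def distr_id2)
next
  case (Suc n)
  have F1: "transfer 1 F \<in> borel_measurable M" "0 \<le> transfer 1 F x" for x
    using transfer_one_measurable[OF Suc.prems] transfer_nonneg[of F 1 x] Suc.prems(2)
    by (simp_all only: transfer_one)
  have eq: "transfer (Suc n) F = transfer n (transfer 1 F)"
    using transfer_add[of n 1 F] by simp
  have "distr (density M (\<lambda>x. ennreal (F x))) M (T ^^ Suc n)
      = distr (distr (density M (\<lambda>x. ennreal (F x))) M T) M (T ^^ n)"
    using measurable_T by (subst distr_distr) (auto simp: funpow_Suc_right simp del: funpow.simps)
  also have "\<dots> = distr (density M (\<lambda>x. ennreal (transfer 1 F x))) M (T ^^ n)"
    using transfer_one_duality[OF Suc.prems] by (simp only: transfer_one)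
  also have "\<dots> = density M (\<lambda>x. ennreal (transfer (Suc n) F x))"
    unfolding eq using Suc.IH[OF F1] by (rule conjunct2)
  finally have "distr (density M (\<lambda>x. ennreal (F x))) M (T ^^ Suc n)
      = density M (\<lambda>x. ennreal (transfer (Suc n) F x))" .
  moreover have "transfer (Suc n) F \<in> borel_measurable M"
    unfolding eq using Suc.IH[OF F1] by (rule conjunct1)
  ultimately show ?case by (intro conjI)
qed

lemmas transfer_measurable = transfer_measurable_and_duality[THEN conjunct1]

lemma integral_transfer:
  assumes F: "F \<in> borel_measurable M" "\<And>x. 0 \<le> F x" and g: "g \<in> borel_measurable M"
  shows "(\<integral>x. F x * g ((T ^^ n) x) \<partial>M) = (\<integral>x. transfer n F x * g x \<partial>M)"
proof -
  have "(\<integral>x. F x * g ((T ^^ n) x) \<partial>M) = (\<integral>x. g ((T ^^ n) x) \<partial>density M (\<lambda>x. ennreal (F x)))"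
    using F g by (subst integral_density) auto
  also have "\<dots> = (\<integral>x. g x \<partial>distr (density M (\<lambda>x. ennreal (F x))) M (T ^^ n))"
    using g by (subst integral_distr) auto
  also have "\<dots> = (\<integral>x. g x \<partial>density M (\<lambda>x. ennreal (transfer n F x)))"
    using transfer_measurable_and_duality[OF F] by simp
  also have "\<dots> = (\<integral>x. transfer n F x * g x \<partial>M)"
    using transfer_measurable[OF F] transfer_nonneg[OF F(2)] g by (subst integral_density) auto
  finally show ?thesis .
qed

lemma integrable_bounded:
  assumes "f \<in> borel_measurable M" "\<And>x. \<bar>f x\<bar> \<le> B"
  shows "integrable M (f :: 'a \<Rightarrow> real)"
  using assms by (intro integrable_const_bound[of _ B]) auto

text \<open>As W is increasing and distances are at most D, this is the largest factor by which two
  values of \<open>N n\<close> can differ.\<close>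

definition E :: real where "E = exp (W D)"

lemma E_ge: "1 \<le> E"
  using W_nonneg[of D] by (simp add: E_def)

lemma N_measurable: "N n \<in> borel_measurable M"
  by (intro transfer_measurable) auto

lemma N_le_N: "N n x \<le> E * N n y"
proof -
  have "exp (W (d x y)) * N n y \<le> E * N n y"
    using W_mono[of "d x y" D] d_le[of x y] N_pos[of n y] by (simp add: E_def)
  then show ?thesis using N_distortion(1)[of n x y] by linarith
qed

lemma integrable_N: "integrable M (N n)"
  using N_le_N[of n _ undefined] N_pos[of n]
  by (intro integrable_bounded[OF N_measurable, of n "E * N n undefined"]) (simp add: abs_of_pos)

lemma integral_N: "(\<integral>x. N n x \<partial>M) = V"
  using integral_transfer[of "\<lambda>_. 1" "\<lambda>_. 1" n] by (simp add: space_M)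

text \<open>The integral of \<open>N n\<close> is the total mass V, so its mean value is 1; values
  that differ at most by a factor E then lie between 1 / E and E.\<close>

lemma N_bounds: "N n x \<le> E" "1 \<le> E * N n x"
proof -
  have "(\<integral>y. N n x \<partial>M) \<le> (\<integral>y. E * N n y \<partial>M)"
    using integrable_N N_le_N by (intro integral_mono) auto
  then show "N n x \<le> E"
    using M_pos by (simp add: integral_N space_M mult.commute)
  have "(\<integral>y. N n y \<partial>M) \<le> (\<integral>y. E * N n x \<partial>M)"
    using integrable_N N_le_N by (intro integral_mono) auto
  then show "1 \<le> E * N n x"
    using M_pos by (simp add: integral_N space_M)
qed

text \<open>One factor E bounds exp w in exp w - 1 \<le> w * exp w, the other bounds
  \<open>N n\<close>; together they turn the multiplicative distortion into an additive
  modulus.\<close>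

definition N_const :: real where "N_const = E * E * (K / (\<alpha> * ln l))"

lemma N_const_nonneg: "0 \<le> N_const"
  unfolding N_const_def using E_ge K_nonneg \<alpha>_pos ln_l_pos by (intro mult_nonneg_nonneg) auto

lemma N_modulus: "\<bar>N n x - N n y\<bar> \<le> N_const * log_weight D \<alpha> (d x y)"
proof -
  define w where "w = W (d x y)"
  have w: "0 \<le> w" "exp w \<le> E" using W_mono[of "d x y" D] d_le[of x y] W_nonneg by (auto simp: w_def E_def)
  have "exp w - 1 \<le> w * E"
    using exp_minus_one_le[of w] mult_left_mono[OF w(2,1)] by linarith
  then have *: "(exp w - 1) * N n z \<le> (w * E) * E" for z
    using N_bounds(1)[of n z] N_pos[of n z] w E_ge by (intro mult_mono) auto
  have "N n x - N n y \<le> (exp w - 1) * N n y" "N n y - N n x \<le> (exp w - 1) * N n x"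
    using N_distortion(1)[of n x y] N_distortion(2)[of n y x] unfolding left_diff_distrib by (simp_all add: w_def)
  then have "\<bar>N n x - N n y\<bar> \<le> (w * E) * E"
    using *[of x] *[of y] by linarith
  then show ?thesis by (simp add: w_def W_def N_const_def mult_ac)
qed

text \<open>With respect to the probability density \<open>N n / V\<close>, a function of
  oscillation \<epsilon> stays within \<epsilon> of its mean. S is the product R *
  \<open>N n\<close>, which in the applications is a transferred function.\<close>

lemma mean_bound:
  assumes R: "\<And>x y. \<bar>R x - R y\<bar> \<le> \<epsilon>" and S: "integrable M S" "\<And>y. S y = R y * N n y"
  shows "\<bar>R x * V - (\<integral>y. S y \<partial>M)\<bar> \<le> \<epsilon> * V"
proof -
  have "R x * V - (\<integral>y. S y \<partial>M) = (\<integral>y. R x * N n y - S y \<partial>M)"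
    using S(1) integrable_N[of n] by (subst Bochner_Integration.integral_diff) (auto simp: integral_N)
  also have "\<bar>\<dots>\<bar> \<le> (\<integral>y. \<bar>R x * N n y - S y\<bar> \<partial>M)"
    by (rule integral_abs_bound)
  also have "\<dots> \<le> (\<integral>y. \<epsilon> * N n y \<partial>M)"
  proof (rule integral_mono)
    fix y
    have "\<bar>R x * N n y - S y\<bar> = \<bar>R x - R y\<bar> * N n y"
      using N_pos[of n y] by (simp add: S(2) abs_mult flip: left_diff_distrib)
    then show "\<bar>R x * N n y - S y\<bar> \<le> \<epsilon> * N n y"
      using R N_pos[of n y] by (simp add: mult_right_mono)
  qed (use S(1) integrable_N in auto)
  finally show ?thesis by (simp add: integral_N)
qed

text \<open>The quotient \<open>N (n + p) / N n\<close> is \<open>ratio n (N p)\<close>, and its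
  mean for the density \<open>N n / V\<close> is 1 since the integral is preserved. Small
  oscillation therefore forces it close to 1.\<close>

lemma N_Cauchy:
  assumes B: "0 < B" "\<And>f H n x y. (\<And>x y. \<bar>f x - f y\<bar> \<le> H * log_weight D \<alpha> (d x y)) \<Longrightarrow> 0 \<le> H \<Longrightarrow> 1 \<le> n \<Longrightarrow>
      \<bar>ratio n f x - ratio n f y\<bar> \<le> B * H * real n powr (- \<alpha>)"
    and "1 \<le> n"
  shows "\<bar>N (n + p) x - N n x\<bar> \<le> E * (B * N_const * real n powr (- \<alpha>))"
proof -
  define \<epsilon> where "\<epsilon> = B * N_const * real n powr (- \<alpha>)"
  have N0: "N n y \<noteq> 0" for y using N_pos[of n y] by simp
  have "\<bar>ratio n (N p) x * V - (\<integral>y. N (n + p) y \<partial>M)\<bar> \<le> \<epsilon> * V"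
  proof (rule mean_bound)
    show "\<bar>ratio n (N p) x - ratio n (N p) y\<bar> \<le> \<epsilon>" for x y
      unfolding \<epsilon>_def using N_modulus N_const_nonneg \<open>1 \<le> n\<close> by (intro B(2)) auto
    show "N (n + p) y = ratio n (N p) y * N n y" for y
      using N0 by (simp add: ratio_def transfer_add)
  qed (rule integrable_N)
  then have "\<bar>ratio n (N p) x - 1\<bar> * V \<le> \<epsilon> * V"
  proof -
    assume *: "\<bar>ratio n (N p) x * V - (\<integral>y. N (n + p) y \<partial>M)\<bar> \<le> \<epsilon> * V"
    have "\<bar>ratio n (N p) x - 1\<bar> * V = \<bar>(ratio n (N p) x - 1) * V\<bar>"
      using M_pos by (simp only: abs_mult abs_of_pos)
    also have "\<dots> = \<bar>ratio n (N p) x * V - (\<integral>y. N (n + p) y \<partial>M)\<bar>"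
      by (simp only: integral_N left_diff_distrib mult_1)
    finally show ?thesis using * by simp
  qed
  then have 1: "\<bar>ratio n (N p) x - 1\<bar> \<le> \<epsilon>" using M_pos by (simp only: mult_le_cancel_right_pos)
  have "N (n + p) x - N n x = (ratio n (N p) x - 1) * N n x"
    using N0 by (simp add: ratio_def transfer_add left_diff_distrib)
  then have "\<bar>N (n + p) x - N n x\<bar> = \<bar>ratio n (N p) x - 1\<bar> * N n x"
    using N_pos[of n x] by (simp add: abs_mult)
  also have "\<dots> \<le> \<epsilon> * E"
    using 1 N_bounds(1)[of n x] N_pos[of n x] by (intro mult_mono) auto
  finally show ?thesis by (simp add: \<epsilon>_def mult.commute)
qed

lemma invariant_function:
  obtains h where "\<And>x y. \<bar>h x - h y\<bar> \<le> N_const * log_weight D \<alpha> (d x y)"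
    and "\<And>x. h x \<le> E" "\<And>x. 1 \<le> E * h x" "\<And>n. transfer n h = h" "(\<integral>x. h x \<partial>M) = V"
proof -
  obtain B where "0 < B" and B0: "\<forall>f H n x y. (\<forall>x y. \<bar>f x - f y\<bar> \<le> H * log_weight D \<alpha> (d x y)) \<longrightarrow> 0 \<le> H \<longrightarrow> 1 \<le> n \<longrightarrow>
      \<bar>ratio n f x - ratio n f y\<bar> \<le> B * H * real n powr (- \<alpha>)"
    using ratio_decay by (elim exE conjE)
  from B0 have "\<bar>ratio n f x - ratio n f y\<bar> \<le> B * H * real n powr (- \<alpha>)"
    if "\<And>x y. \<bar>f x - f y\<bar> \<le> H * log_weight D \<alpha> (d x y)" "0 \<le> H" "1 \<le> n" for f H n x y
    using that by blast
  note B = \<open>0 < B\<close> this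
  have "Cauchy (\<lambda>n. N n x)" for x
  proof (rule CauchyI')
    fix e :: real assume "0 < e"
    have "(\<lambda>n. E * (B * N_const * real n powr (- \<alpha>))) \<longlonglongrightarrow> E * (B * N_const * 0)"
      using \<alpha>_pos filterlim_real_sequentially by (intro tendsto_mult tendsto_const tendsto_neg_powr) auto
    then have "eventually (\<lambda>n. E * (B * N_const * real n powr (- \<alpha>)) < e) sequentially"
      using \<open>0 < e\<close> by (intro order_tendstoD) auto
    then obtain n0 where n0: "\<And>n. n0 \<le> n \<Longrightarrow> E * (B * N_const * real n powr (- \<alpha>)) < e"
      by (auto simp: eventually_sequentially)
    show "\<exists>M. \<forall>m\<ge>M. \<forall>n>m. dist (N m x) (N n x) < e"
    proof (intro exI[of _ "max 1 n0"] allI impI)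
      fix m n :: nat assume "max 1 n0 \<le> m" "m < n"
      then show "dist (N m x) (N n x) < e"
        using N_Cauchy[OF B, of m "n - m" x] n0[of m] by (auto simp: dist_real_def abs_minus_commute)
    qed
  qed
  then have lim: "(\<lambda>n. N n x) \<longlonglongrightarrow> lim (\<lambda>n. N n x)" for x
    by (simp add: convergent_LIMSEQ_iff Cauchy_convergent_iff)
  define h where "h x = lim (\<lambda>n. N n x)" for x
  have lim: "(\<lambda>n. N n x) \<longlonglongrightarrow> h x" for x
    using lim by (simp add: h_def)
  have mod: "\<bar>h x - h y\<bar> \<le> N_const * log_weight D \<alpha> (d x y)" for x y
    using N_modulus by (intro tendsto_upperbound[OF tendsto_rabs[OF tendsto_diff[OF lim lim]]]) auto
  have "h x \<le> E" for x
    using N_bounds by (intro tendsto_upperbound[OF lim]) auto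
  moreover have "1 \<le> E * h x" for x
    using N_bounds by (intro tendsto_lowerbound[OF tendsto_mult[OF tendsto_const lim]]) auto
  moreover have h1: "transfer 1 h = h"
  proof
    fix x
    \<comment> \<open>Pointwise convergence passes through the transfer operator because fibres are
      finite.\<close>
    have "(\<lambda>n. \<Sum>z\<in>T -` {x}. N n z / J z) \<longlonglongrightarrow> (\<Sum>z\<in>T -` {x}. h z / J z)"
      using lim J_pos by (intro tendsto_sum tendsto_divide tendsto_const) (auto simp: less_imp_neq[THEN not_sym])
    moreover have "(\<Sum>z\<in>T -` {x}. N n z / J z) = N (Suc n) x" for n
      using transfer_add[of 1 n "\<lambda>_. 1"] by (simp add: transfer_one[unfolded One_nat_def])
    ultimately have "(\<lambda>n. N (Suc n) x) \<longlonglongrightarrow> transfer 1 h x"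
      by (simp only: transfer_one)
    then show "transfer 1 h x = h x"
      using LIMSEQ_Suc[OF lim[of x]] LIMSEQ_unique by blast
  qed
  moreover have "transfer n h = h" for n
  proof (induction n)
    case (Suc n)
    then show ?case using transfer_add[of 1 n h] h1 by simp
  qed simp
  moreover have "(\<integral>x. h x \<partial>M) = V"
  proof -
    have "(\<lambda>n. \<integral>x. N n x \<partial>M) \<longlonglongrightarrow> (\<integral>x. h x \<partial>M)"
      using N_measurable lim N_bounds(1) N_pos modulus_measurable[OF mod]
      by (intro integral_dominated_convergence[where w = "\<lambda>_. E"]) (auto simp: abs_of_pos)
    then show ?thesis by (simp add: integral_N LIMSEQ_const_iff)
  qed
  ultimately show thesis using that mod by blast
qed

text \<open>Subtracting the multiple of \<rho> with the same integral leaves a function of mean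
  zero, for which \<open>mean_bound\<close> gives uniform smallness of the transferred function. The
  lower bound on \<rho> then converts the integral of |g| over M into one over the invariant
  measure.\<close>

theorem invariant_density_with_decay:
  obtains \<rho> H C where "\<And>x y. \<bar>\<rho> x - \<rho> y\<bar> \<le> H * log_weight D \<alpha> (d x y)" "0 \<le> H" "\<And>x. 0 < \<rho> x"
    and "emeasure (density M (\<lambda>x. ennreal (\<rho> x))) UNIV = 1"
    and "distr (density M (\<lambda>x. ennreal (\<rho> x))) (density M (\<lambda>x. ennreal (\<rho> x))) T = density M (\<lambda>x. ennreal (\<rho> x))"
    and "\<And>f H g t. (\<And>x y. \<bar>f x - f y\<bar> \<le> H * log_weight D \<alpha> (d x y)) \<Longrightarrow> 0 \<le> H \<Longrightarrow>
      integrable (density M (\<lambda>x. ennreal (\<rho> x))) g \<Longrightarrow> 1 \<le> t \<Longrightarrow>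
      \<bar>(\<integral>x. f x * g ((T ^^ t) x) \<partial>density M (\<lambda>x. ennreal (\<rho> x)))
        - (\<integral>x. f x \<partial>density M (\<lambda>x. ennreal (\<rho> x))) * (\<integral>x. g x \<partial>density M (\<lambda>x. ennreal (\<rho> x)))\<bar>
      \<le> C * H * (\<integral>x. \<bar>g x\<bar> \<partial>density M (\<lambda>x. ennreal (\<rho> x))) * real t powr (- \<alpha>)"
proof -
  obtain B where "0 < B" and B0: "\<forall>f H n x y. (\<forall>x y. \<bar>f x - f y\<bar> \<le> H * log_weight D \<alpha> (d x y)) \<longrightarrow> 0 \<le> H \<longrightarrow> 1 \<le> n \<longrightarrow>
      \<bar>ratio n f x - ratio n f y\<bar> \<le> B * H * real n powr (- \<alpha>)"
    using ratio_decay by (elim exE conjE)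
  from B0 have "\<bar>ratio n f x - ratio n f y\<bar> \<le> B * H * real n powr (- \<alpha>)"
    if "\<And>x y. \<bar>f x - f y\<bar> \<le> H * log_weight D \<alpha> (d x y)" "0 \<le> H" "1 \<le> n" for f H n x y
    using that by blast
  note B = \<open>0 < B\<close> this
  obtain h where h_mod: "\<And>x y. \<bar>h x - h y\<bar> \<le> N_const * log_weight D \<alpha> (d x y)"
    and h_le: "\<And>x. h x \<le> E" and h_ge: "\<And>x. 1 \<le> E * h x"
    and h_inv: "\<And>n. transfer n h = h" and h_int: "(\<integral>x. h x \<partial>M) = V"
    by (rule invariant_function) blast
  define \<rho> where "\<rho> x = h x / V" for x
  have h_pos: "0 < h x" for x
  proof -
    have "0 < E * h x" using h_ge[of x] by linarith
    then show ?thesis using E_ge by (simp add: zero_less_mult_iff)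
  qed
  have \<rho>_pos: "0 < \<rho> x" for x
    using h_pos M_pos by (simp add: \<rho>_def)
  have \<rho>_mod: "\<bar>\<rho> x - \<rho> y\<bar> \<le> N_const / V * log_weight D \<alpha> (d x y)" for x y
    using h_mod[of x y] M_pos by (simp add: \<rho>_def divide_right_mono flip: diff_divide_distrib)
  have \<rho>_meas [measurable]: "\<rho> \<in> borel_measurable M"
    using \<rho>_mod by (rule modulus_measurable)
  have \<rho>_le: "\<rho> x \<le> E / V" and \<rho>_ge: "1 \<le> E * V * \<rho> x" for x
    using h_le h_ge M_pos by (auto simp: \<rho>_def divide_right_mono)
  have \<rho>_inv: "transfer n \<rho> = \<rho>" for n
  proof
    have "\<rho> = (\<lambda>z. 1 / V * h z)" by (simp add: \<rho>_def fun_eq_iff)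
    then show "transfer n \<rho> x = \<rho> x" for x
      using transfer_cmult[of n "1 / V" h x] by (simp add: h_inv)
  qed
  have \<rho>_intble: "integrable M \<rho>"
    using \<rho>_le \<rho>_pos by (intro integrable_bounded[of _ "E / V"]) (auto simp: abs_of_pos)
  have \<rho>_int: "(\<integral>x. \<rho> x \<partial>M) = 1"
    using h_int M_pos by (simp add: \<rho>_def)
  define \<mu> where "\<mu> = density M (\<lambda>x. ennreal (\<rho> x))"
  have sets_\<mu> [measurable_cong]: "sets \<mu> = sets M" by (simp add: \<mu>_def)
  have int_\<mu>: "(\<integral>x. f x \<partial>\<mu>) = (\<integral>x. \<rho> x * f x \<partial>M)" if "f \<in> borel_measurable M" for f :: "'a \<Rightarrow> real"
    unfolding \<mu>_def using that \<rho>_pos by (subst integral_density) (auto intro: less_imp_le)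
  have intble_\<mu>: "integrable \<mu> f \<longleftrightarrow> integrable M (\<lambda>x. \<rho> x * f x)" if "f \<in> borel_measurable M" for f :: "'a \<Rightarrow> real"
    unfolding \<mu>_def using that \<rho>_pos by (subst integrable_density) (auto intro: less_imp_le)
  have "emeasure \<mu> UNIV = 1"
    unfolding \<mu>_def using \<rho>_intble \<rho>_int \<rho>_pos sets.top[of M]
    by (simp add: emeasure_density space_M nn_integral_eq_integral less_imp_le)
  moreover have distr_pow: "distr \<mu> M (T ^^ n) = \<mu>" for n
    unfolding \<mu>_def using transfer_measurable_and_duality[OF \<rho>_meas less_imp_le[OF \<rho>_pos], of n]
    by (simp add: \<rho>_inv)
  moreover have "distr \<mu> \<mu> T = \<mu>"
    using distr_pow[of 1] by (simp cong: distr_cong add: sets_\<mu>)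
  \<comment> \<open>The modulus of F' relative to H: E / V bounds \<rho>, and each of f0 and I is at
    most 2 * H in front of the modulus \<open>N_const / V\<close> of \<rho>.\<close>
  moreover define C3 where "C3 = (E + 4 * N_const) / V"
  moreover have "\<bar>(\<integral>x. f x * g ((T ^^ t) x) \<partial>\<mu>) - (\<integral>x. f x \<partial>\<mu>) * (\<integral>x. g x \<partial>\<mu>)\<bar>
      \<le> E * B * C3 * (E * V) * H * (\<integral>x. \<bar>g x\<bar> \<partial>\<mu>) * real t powr (- \<alpha>)"
    if f: "\<And>x y. \<bar>f x - f y\<bar> \<le> H * log_weight D \<alpha> (d x y)" and "0 \<le> H"
      and g: "integrable \<mu> g" and "1 \<le> t" for f H g and t :: nat
  proof -
    \<comment> \<open>Duality is available for nonnegative functions. Since |f - f undefined| \<le>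
      H, this shift has values in [0, 2 * H], and by invariance of the measure a constant does not
      change the correlation.\<close>
    define f0 where "f0 x = f x - f undefined + H" for x
    have f_meas [measurable]: "f \<in> borel_measurable M" using f by (rule modulus_measurable)
    have f0: "0 \<le> f0 x" "f0 x \<le> 2 * H" for x
      using lw_diff_le_const[OF f \<open>0 \<le> H\<close>, of x undefined] by (auto simp: f0_def)
    have f0_meas [measurable]: "f0 \<in> borel_measurable M" unfolding f0_def by measurable
    have g_meas [measurable]: "g \<in> borel_measurable M"
      using borel_measurable_integrable[OF g] by (simp cong: measurable_cong_sets add: sets_\<mu>)
    have gT: "integrable \<mu> (\<lambda>x. g ((T ^^ t) x))" "(\<integral>x. g ((T ^^ t) x) \<partial>\<mu>) = (\<integral>x. g x \<partial>\<mu>)"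
      using distr_pow[of t] g integrable_distr_eq[of "T ^^ t" \<mu> M g] integral_distr[of "T ^^ t" \<mu> M g]
      by (auto simp: measurable_cong_sets[OF sets_\<mu> refl])
    have gM: "integrable M (\<lambda>x. \<rho> x * g x)" using g by (simp add: intble_\<mu>)
    have g_int: "integrable M g"
    proof (rule Bochner_Integration.integrable_bound[OF integrable_mult_right[OF gM, of "E * V"]])
      have "\<bar>g x\<bar> \<le> \<bar>E * V * (\<rho> x * g x)\<bar>" for x
        using mult_right_mono[OF \<rho>_ge[of x], of "\<bar>g x\<bar>"] E_ge M_pos \<rho>_pos[of x] by (simp add: abs_mult mult.assoc)
      then show "AE x in M. norm (g x) \<le> norm (E * V * (\<rho> x * g x))" by simp
    qed simp
    define F where "F x = f0 x * \<rho> x" for x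
    have F_meas [measurable]: "F \<in> borel_measurable M" unfolding F_def by measurable
    have F_nonneg: "0 \<le> F x" for x using f0 \<rho>_pos[of x] by (simp add: F_def)
    have F_le: "F x \<le> 2 * H * \<rho> x" for x
      unfolding F_def using f0 \<rho>_pos[of x] by (intro mult_right_mono) auto
    have F_int: "integrable M F"
    proof (rule Bochner_Integration.integrable_bound[OF integrable_mult_right[OF \<rho>_intble, of "2 * H"]])
      have "norm (F x) \<le> norm (2 * H * \<rho> x)" for x
        using F_le[of x] F_nonneg[of x] by simp
      then show "AE x in M. norm (F x) \<le> norm (2 * H * \<rho> x)" by simp
    qed simp
    define I where "I = (\<integral>x. F x \<partial>M)"
    have "0 \<le> I" unfolding I_def using F_nonneg by (intro integral_nonneg_AE) auto
    have "I \<le> 2 * H"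
      unfolding I_def using integral_mono[OF F_int integrable_mult_right[OF \<rho>_intble, of "2 * H"]] F_le \<rho>_int by simp
    define F' where "F' x = F x - I * \<rho> x" for x
    have F'_mod: "\<bar>F' x - F' y\<bar> \<le> (C3 * H) * log_weight D \<alpha> (d x y)" for x y
    proof -
      define w where "w = log_weight D \<alpha> (d x y)"
      have "0 \<le> w" by (simp add: w_def)
      have "F' x - F' y = (f0 x - f0 y) * \<rho> x + f0 y * (\<rho> x - \<rho> y) - I * (\<rho> x - \<rho> y)"
        by (simp add: F'_def F_def algebra_simps)
      also have "\<bar>\<dots>\<bar> \<le> \<bar>f0 x - f0 y\<bar> * \<rho> x + f0 y * \<bar>\<rho> x - \<rho> y\<bar> + I * \<bar>\<rho> x - \<rho> y\<bar>"
      proof -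
        have "\<bar>a + b - c\<bar> \<le> \<bar>a\<bar> + \<bar>b\<bar> + \<bar>c\<bar>" for a b c :: real by simp
        moreover have "\<bar>(f0 x - f0 y) * \<rho> x\<bar> = \<bar>f0 x - f0 y\<bar> * \<rho> x"
          "\<bar>f0 y * (\<rho> x - \<rho> y)\<bar> = f0 y * \<bar>\<rho> x - \<rho> y\<bar>" "\<bar>I * (\<rho> x - \<rho> y)\<bar> = I * \<bar>\<rho> x - \<rho> y\<bar>"
          using f0(1)[of y] \<rho>_pos[of x] \<open>0 \<le> I\<close> by (simp_all add: abs_mult)
        ultimately show ?thesis by metis
      qed
      also have "\<dots> \<le> (H * w) * (E / V) + (2 * H) * (N_const / V * w) + (2 * H) * (N_const / V * w)"
        using f[of x y] f0 \<rho>_pos[of x] \<rho>_le \<rho>_mod[of x y] \<open>0 \<le> I\<close> \<open>I \<le> 2 * H\<close> \<open>0 \<le> H\<close> \<open>0 \<le> w\<close>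
        by (intro add_mono mult_mono) (auto simp: f0_def w_def)
      also have "\<dots> = (C3 * H) * w" by (simp add: C3_def add_divide_distrib algebra_simps)
      finally show ?thesis by (simp add: w_def)
    qed
    have "0 \<le> C3 * H"
      using E_ge N_const_nonneg M_pos \<open>0 \<le> H\<close> by (simp add: C3_def)
    have trF': "transfer t F' x = transfer t F x - I * \<rho> x" for x
      unfolding F'_def by (simp add: transfer_diff transfer_cmult \<rho>_inv)
    have trF_meas [measurable]: "transfer t F \<in> borel_measurable M"
      using F_meas F_nonneg by (rule transfer_measurable)
    have trF_nonneg: "0 \<le> transfer t F x" for x using F_nonneg by (rule transfer_nonneg)
    \<comment> \<open>The transfer operator is positive and fixes \<rho>, so the bound F \<le> 2 * H
      * \<rho> is inherited.\<close>
    have trF_le: "transfer t F x \<le> 2 * H * \<rho> x" for x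
      using transfer_nonneg[of "\<lambda>x. 2 * H * \<rho> x - F x" t x] F_le by (simp add: transfer_diff transfer_cmult \<rho>_inv)
    have trF_int: "integrable M (transfer t F)"
    proof (rule Bochner_Integration.integrable_bound[OF integrable_mult_right[OF \<rho>_intble, of "2 * H"]])
      have "norm (transfer t F x) \<le> norm (2 * H * \<rho> x)" for x
        using trF_le[of x] trF_nonneg[of x] by simp
      then show "AE x in M. norm (transfer t F x) \<le> norm (2 * H * \<rho> x)" by simp
    qed simp
    have trF_I: "(\<integral>x. transfer t F x \<partial>M) = I"
      using integral_transfer[OF F_meas F_nonneg, of "\<lambda>_. 1" t] by (simp add: I_def)
    define \<epsilon> where "\<epsilon> = B * (C3 * H) * real t powr (- \<alpha>)"
    have "0 \<le> \<epsilon>" using \<open>0 \<le> C3 * H\<close> B(1) by (simp add: \<epsilon>_def)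
    have small: "\<bar>transfer t F x - I * \<rho> x\<bar> \<le> E * \<epsilon>" for x
    proof -
      have N0: "N t y \<noteq> 0" for y using N_pos[of t y] by simp
      \<comment> \<open>Here the mean vanishes by the choice of I, so the bound on the oscillation
        becomes a bound on the values.\<close>
      have "\<bar>ratio t F' x * V - (\<integral>y. transfer t F' y \<partial>M)\<bar> \<le> \<epsilon> * V"
      proof (rule mean_bound[where n = t])
        show "\<bar>ratio t F' x - ratio t F' y\<bar> \<le> \<epsilon>" for x y
          unfolding \<epsilon>_def using F'_mod \<open>0 \<le> C3 * H\<close> \<open>1 \<le> t\<close> by (rule B(2))
        show "integrable M (transfer t F')"
          unfolding trF'[abs_def] using trF_int \<rho>_intble by simp
      qed (simp add: ratio_def N0)
      moreover have "(\<integral>y. transfer t F' y \<partial>M) = 0"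
        unfolding trF' using trF_int \<rho>_intble by (simp add: trF_I \<rho>_int)
      ultimately have "\<bar>ratio t F' x\<bar> * V \<le> \<epsilon> * V"
        using M_pos by (simp add: abs_mult)
      then have "\<bar>ratio t F' x\<bar> \<le> \<epsilon>" using M_pos by simp
      then have "\<bar>ratio t F' x\<bar> * N t x \<le> \<epsilon> * E"
        using N_bounds(1)[of t x] N_pos[of t x] by (intro mult_mono) auto
      moreover have "\<bar>ratio t F' x\<bar> * N t x = \<bar>transfer t F' x\<bar>"
        using N_pos[of t x] by (simp add: ratio_def abs_divide)
      ultimately show ?thesis by (simp add: trF' mult.commute)
    qed
    have f0gT: "integrable \<mu> (\<lambda>x. f0 x * g ((T ^^ t) x))"
    proof (rule Bochner_Integration.integrable_bound[OF integrable_mult_right[OF gT(1), of "2 * H"]])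
      show "AE x in \<mu>. norm (f0 x * g ((T ^^ t) x)) \<le> norm (2 * H * g ((T ^^ t) x))"
        using f0 \<open>0 \<le> H\<close> by (intro AE_I2) (auto simp: abs_mult intro!: mult_right_mono)
    qed measurable
    have f0_int: "integrable \<mu> f0" "integrable \<mu> (\<lambda>_. 1 :: real)"
      using F_int \<rho>_intble by (simp_all add: intble_\<mu> F_def[abs_def] mult.commute)
    have one: "(\<integral>x. 1 \<partial>\<mu>) = (1 :: real)" using \<rho>_int by (subst int_\<mu>) auto
    have f_eq: "f x = f0 x + (f undefined - H)" for x by (simp add: f0_def)
    have "(\<integral>x. f x * g ((T ^^ t) x) \<partial>\<mu>)
        = (\<integral>x. f0 x * g ((T ^^ t) x) + (f undefined - H) * g ((T ^^ t) x) \<partial>\<mu>)"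
      by (intro Bochner_Integration.integral_cong refl) (simp add: f0_def algebra_simps)
    also have "\<dots> = (\<integral>x. f0 x * g ((T ^^ t) x) \<partial>\<mu>) + (f undefined - H) * (\<integral>x. g x \<partial>\<mu>)"
      using f0gT gT by simp
    finally have 1: "(\<integral>x. f x * g ((T ^^ t) x) \<partial>\<mu>)
        = (\<integral>x. f0 x * g ((T ^^ t) x) \<partial>\<mu>) + (f undefined - H) * (\<integral>x. g x \<partial>\<mu>)" .
    have "(\<integral>x. f x \<partial>\<mu>) = (\<integral>x. f0 x + (f undefined - H) * 1 \<partial>\<mu>)"
      by (intro Bochner_Integration.integral_cong refl) (simp add: f0_def)
    also have "\<dots> = (\<integral>x. f0 x \<partial>\<mu>) + (f undefined - H) * (\<integral>x. 1 \<partial>\<mu>)"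
      using f0_int integrable_mult_right[OF f0_int(2), of "f undefined - H"] by (subst Bochner_Integration.integral_add) auto
    also have "(\<integral>x. f0 x \<partial>\<mu>) = I"
      by (simp add: int_\<mu> I_def F_def mult.commute)
    finally have 2: "(\<integral>x. f x \<partial>\<mu>) = I + (f undefined - H)" by (simp only: one mult_1_right)
    have "(\<integral>x. f0 x * g ((T ^^ t) x) \<partial>\<mu>) = (\<integral>x. F x * g ((T ^^ t) x) \<partial>M)"
      by (subst int_\<mu>) (auto simp: F_def mult_ac intro!: Bochner_Integration.integral_cong)
    also have "\<dots> = (\<integral>x. transfer t F x * g x \<partial>M)"
      using F_meas F_nonneg g_meas by (rule integral_transfer)
    finally have 3: "(\<integral>x. f0 x * g ((T ^^ t) x) \<partial>\<mu>) = (\<integral>x. transfer t F x * g x \<partial>M)" .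
    have 4: "(\<integral>x. g x \<partial>\<mu>) = (\<integral>x. \<rho> x * g x \<partial>M)" by (simp add: int_\<mu>)
    have trFg: "integrable M (\<lambda>x. transfer t F x * g x)"
    proof (rule Bochner_Integration.integrable_bound[OF integrable_mult_right[OF gM, of "2 * H"]])
      have "\<bar>transfer t F x * g x\<bar> \<le> \<bar>2 * H * (\<rho> x * g x)\<bar>" for x
        using mult_right_mono[OF trF_le[of x], of "\<bar>g x\<bar>"] trF_nonneg[of x] \<rho>_pos[of x] \<open>0 \<le> H\<close>
        by (simp add: abs_mult mult.assoc)
      then show "AE x in M. norm (transfer t F x * g x) \<le> norm (2 * H * (\<rho> x * g x))" by simp
    qed simp
    have "(\<integral>x. f x * g ((T ^^ t) x) \<partial>\<mu>) - (\<integral>x. f x \<partial>\<mu>) * (\<integral>x. g x \<partial>\<mu>)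
        = (\<integral>x. transfer t F x * g x \<partial>M) - I * (\<integral>x. \<rho> x * g x \<partial>M)"
      unfolding 1 2 3 by (simp add: 4 algebra_simps)
    also have "\<dots> = (\<integral>x. transfer t F x * g x - I * (\<rho> x * g x) \<partial>M)"
      using trFg gM by simp
    also have "\<bar>\<dots>\<bar> \<le> (\<integral>x. \<bar>transfer t F x * g x - I * (\<rho> x * g x)\<bar> \<partial>M)"
      by (rule integral_abs_bound)
    \<comment> \<open>The first factor is uniformly at most E * \<epsilon>, and
      \<open>1 \<le> E * V * \<rho> x\<close> supplies the density under the remaining integral of
      |g|.\<close>
    also have "\<dots> \<le> (\<integral>x. E * \<epsilon> * (E * V) * (\<rho> x * \<bar>g x\<bar>) \<partial>M)"
    proof (rule integral_mono)
      have "integrable M (\<lambda>x. \<rho> x * \<bar>g x\<bar>)"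
        using integrable_abs[OF gM] \<rho>_pos by (simp add: abs_mult abs_of_pos)
      then show "integrable M (\<lambda>x. E * \<epsilon> * (E * V) * (\<rho> x * \<bar>g x\<bar>))" by simp
      fix x
      have "\<bar>transfer t F x * g x - I * (\<rho> x * g x)\<bar> = \<bar>transfer t F x - I * \<rho> x\<bar> * \<bar>g x\<bar>"
        by (simp add: left_diff_distrib mult.assoc flip: abs_mult)
      also have "\<dots> \<le> E * \<epsilon> * (\<bar>g x\<bar> * (E * V * \<rho> x))"
      proof (intro mult_mono small)
        show "\<bar>g x\<bar> \<le> \<bar>g x\<bar> * (E * V * \<rho> x)" using mult_left_mono[OF \<rho>_ge[of x], of "\<bar>g x\<bar>"] by simp
      qed (use E_ge \<open>0 \<le> \<epsilon>\<close> in auto)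
      finally show "\<bar>transfer t F x * g x - I * (\<rho> x * g x)\<bar> \<le> E * \<epsilon> * (E * V) * (\<rho> x * \<bar>g x\<bar>)"
        by (simp add: mult_ac)
    qed (use trFg gM in simp)
    also have "\<dots> = E * \<epsilon> * (E * V) * (\<integral>x. \<bar>g x\<bar> \<partial>\<mu>)"
      by (subst int_\<mu>) auto
    finally show ?thesis by (simp add: \<epsilon>_def mult_ac)
  qed
  ultimately show thesis
    using that[of \<rho> "N_const / V" "E * B * C3 * (E * V)"] \<rho>_mod \<rho>_pos N_const_nonneg M_pos
    by (simp add: \<mu>_def)
qed

end

section \<open>Change of variables in coordinate spaces\<close>

text \<open>The library proves the change of variables formula for well-ordered index types only; a
  well-ordered copy of the index type transports it to every finite index type.\<close>

typedef 'n::finite ordered_index = "{..<CARD('n)}"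
  by (intro exI[of _ 0]) simp

instantiation ordered_index :: (finite) wellorder
begin

definition less_eq_ordered_index :: "'a ordered_index \<Rightarrow> 'a ordered_index \<Rightarrow> bool" where
  "i \<le> j \<longleftrightarrow> Rep_ordered_index i \<le> Rep_ordered_index j"

definition less_ordered_index :: "'a ordered_index \<Rightarrow> 'a ordered_index \<Rightarrow> bool" where
  "i < j \<longleftrightarrow> Rep_ordered_index i < Rep_ordered_index j"

instance
proof
  fix P :: "'a ordered_index \<Rightarrow> bool" and i
  assume step: "\<And>i. (\<And>j. j < i \<Longrightarrow> P j) \<Longrightarrow> P i"
  show "P i"
  proof (induction i rule: measure_induct_rule[of Rep_ordered_index])
    case (less i)
    show ?case by (rule step, rule less, simp add: less_ordered_index_def)
  qed
qed (auto simp: less_eq_ordered_index_def less_ordered_index_def Rep_ordered_index_inject)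

end

lemma card_UNIV_ordered_index: "card (UNIV :: 'n::finite ordered_index set) = CARD('n)"
  using type_definition.card[OF type_definition_ordered_index] by simp

instance ordered_index :: (finite) finite
proof
  show "finite (UNIV :: 'a ordered_index set)"
    using card_UNIV_ordered_index[where 'n = 'a] by (intro card_ge_0_finite) simp
qed

text \<open>Conjugation with h is a sign-preserving bijection between the permutations of the two
  index types, so the Leibniz sums agree term by term.\<close>

lemma det_reindex:
  fixes A :: "real ^ 'n ^ 'n" and h :: "'m::finite \<Rightarrow> 'n::finite"
  assumes "bij h"
  shows "det (\<chi> i j. A $ h i $ h j) = det A"
proof -
  have inj: "inj h" using assms by (rule bij_is_inj)
  have "det (\<chi> i j. A $ h i $ h j)
      = (\<Sum>p | p permutes UNIV. of_int (sign p) * (\<Prod>i\<in>UNIV. A $ h i $ h (p i)))"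
    by (simp add: det_def)
  also have "\<dots> = (\<Sum>p | p permutes UNIV. of_int (sign (map_permutation UNIV h p)) *
      (\<Prod>i\<in>UNIV. A $ i $ map_permutation UNIV h p i))"
  proof (intro sum.cong refl)
    fix p :: "'m \<Rightarrow> 'm" assume p: "p \<in> {p. p permutes UNIV}"
    have "(\<Prod>i\<in>UNIV. A $ i $ map_permutation UNIV h p i)
        = (\<Prod>i\<in>UNIV. A $ h i $ map_permutation UNIV h p (h i))"
      using prod.reindex_bij_betw[OF assms, of "\<lambda>i. A $ i $ map_permutation UNIV h p i"] by simp
    moreover have "sign (map_permutation UNIV h p) = sign p"
      using inj p by (intro sign_map_permutation) auto
    moreover have "map_permutation UNIV h p (h i) = h (p i)" for i
      using inj by (intro map_permutation_apply) auto
    ultimately show "of_int (sign p) * (\<Prod>i\<in>UNIV. A $ h i $ h (p i)) = of_int (sign (map_permutation UNIV h p)) *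
      (\<Prod>i\<in>UNIV. A $ i $ map_permutation UNIV h p i)"
      by (simp only:)
  qed
  also have "\<dots> = det A"
  proof -
    have "map_permutation UNIV h = (\<lambda>p x. if x \<in> UNIV then h (p (inv_into UNIV h x)) else x)"
      unfolding map_permutation_def restrict_id_def bij_is_surj[OF assms] by (simp add: fun_eq_iff)
    then have "bij_betw (map_permutation UNIV h) {p. p permutes UNIV} {p. p permutes UNIV}"
      using bij_betw_permutations[OF assms] by simp
    then show ?thesis
      unfolding det_def by (rule sum.reindex_bij_betw)
  qed
  finally show ?thesis .
qed

definition reindex :: "('m \<Rightarrow> 'n) \<Rightarrow> real ^ 'n \<Rightarrow> real ^ 'm" where
  "reindex h x = (\<chi> i. x $ h i)"

lemma reindex_reindex:
  assumes "bij h"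
  shows "reindex (inv h) (reindex h x) = x" "reindex h (reindex (inv h) y) = y"
  using assms by (simp_all add: reindex_def vec_eq_iff bij_is_inj bij_is_surj surj_f_inv_f)

lemma bounded_linear_reindex: "bounded_linear (reindex h :: real ^ 'n::finite \<Rightarrow> real ^ 'm::finite)"
  unfolding reindex_def
  by (intro linear_conv_bounded_linear[THEN iffD1] linearI) (simp_all add: vec_eq_iff)

lemma borel_measurable_reindex [measurable]:
  "(reindex h :: real ^ 'n::finite \<Rightarrow> real ^ 'm::finite) \<in> borel_measurable borel"
  by (intro borel_measurable_continuous_onI linear_continuous_on bounded_linear_reindex)

text \<open>Boxes determine Lebesgue measure, and permuting coordinates turns a box into one with
  the same side lengths.\<close>

lemma lborel_distr_reindex:
  assumes "bij (h :: 'm::finite \<Rightarrow> 'n::finite)"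
  shows "distr lborel borel (reindex h) = (lborel :: (real ^ 'm) measure)"
proof (rule lborel_eqI[symmetric])
  fix l u :: "real ^ 'm"
  assume lu: "\<And>b. b \<in> Basis \<Longrightarrow> l \<bullet> b \<le> u \<bullet> b"
  let ?r = "reindex (inv h)"
  have hinv: "h (inv h j) = j" "inv h (h i) = i" for i j
    using assms by (simp_all add: bij_is_inj bij_is_surj surj_f_inv_f)
  have lu': "l $ i \<le> u $ i" for i using lu[of "axis i 1"] by (auto simp: inner_axis Basis_vec_def)
  have box: "x \<in> box a b \<longleftrightarrow> (\<forall>i. a $ i < x $ i \<and> x $ i < b $ i)" for x a b :: "real ^ 'k::finite"
    by (auto simp: mem_box_cart)
  have vim: "reindex h -` box l u = box (?r l) (?r u)"
  proof (intro set_eqI)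
    fix x :: "real ^ 'n"
    have "(\<forall>i. l $ i < x $ h i \<and> x $ h i < u $ i) \<longleftrightarrow> (\<forall>j. l $ inv h j < x $ j \<and> x $ j < u $ inv h j)"
      using hinv by metis
    then show "x \<in> reindex h -` box l u \<longleftrightarrow> x \<in> box (?r l) (?r u)"
      by (simp add: box reindex_def)
  qed
  have prod: "(\<Prod>b\<in>Basis. (b' - a) \<bullet> b) = (\<Prod>i\<in>UNIV. b' $ i - a $ i)" for a b' :: "real ^ 'k::finite"
  proof -
    have "(\<Prod>b\<in>Basis. (b' - a) \<bullet> b) = (\<Prod>b\<in>(\<lambda>i. axis i 1) ` UNIV. (b' - a) \<bullet> b)"
      by (intro prod.cong) (auto simp: Basis_vec_def)
    also have "\<dots> = (\<Prod>i\<in>UNIV. b' $ i - a $ i)"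
      by (subst prod.reindex) (auto simp: inj_on_def axis_eq_axis inner_axis)
    finally show ?thesis .
  qed
  have "emeasure (distr lborel borel (reindex h)) (box l u) = emeasure lborel (box (?r l) (?r u))"
    by (subst emeasure_distr) (simp_all add: vim)
  also have "\<dots> = (\<Prod>b\<in>Basis. (?r u - ?r l) \<bullet> b)"
    using lu' by (subst emeasure_lborel_box) (auto simp: Basis_vec_def inner_axis reindex_def)
  also have "(\<Prod>b\<in>Basis. (?r u - ?r l) \<bullet> b) = (\<Prod>j\<in>UNIV. u $ inv h j - l $ inv h j)"
    by (simp add: prod reindex_def)
  also have "\<dots> = (\<Prod>i\<in>UNIV. u $ i - l $ i)"
    using prod.reindex_bij_betw[OF bij_imp_bij_inv[OF assms], of "\<lambda>i. u $ i - l $ i"] by simp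
  also have "\<dots> = (\<Prod>b\<in>Basis. (u - l) \<bullet> b)" by (simp add: prod)
  finally show "emeasure (distr lborel borel (reindex h)) (box l u) = (\<Prod>b\<in>Basis. (u - l) \<bullet> b)" .
qed simp

text \<open>\<open>has_measure_differentiable_image\<close> relates finite measure of the image to
  integrability of the determinant. Being an equivalence, it also settles the infinite case: if one
  side is infinite, so is the other.\<close>

lemma emeasure_differentiable_image_wellorder:
  fixes f :: "real ^ 'n::{finite,wellorder} \<Rightarrow> real ^ 'n::_"
  assumes S: "S \<in> sets borel" and fS: "f ` S \<in> sets borel"
    and der: "\<And>x. x \<in> S \<Longrightarrow> (f has_derivative f' x) (at x)" and inj: "inj_on f S"
    and meas: "(\<lambda>x. indicator S x * \<bar>det (matrix (f' x))\<bar>) \<in> borel_measurable borel"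
  shows "emeasure lborel (f ` S) = (\<integral>\<^sup>+x. ennreal (indicator S x * \<bar>det (matrix (f' x))\<bar>) \<partial>lborel)"
proof -
  define D where "D x = \<bar>det (matrix (f' x))\<bar>" for x
  have iff: "f ` S \<in> lmeasurable \<and> measure lebesgue (f ` S) = m \<longleftrightarrow> (D has_integral m) S" for m
    unfolding D_def using S inj der
    by (intro has_measure_differentiable_image) (auto intro: has_derivative_at_withinI)
  have em: "emeasure lebesgue (f ` S) = emeasure lborel (f ` S)" using fS by simp
  have nn: "(\<integral>\<^sup>+x. ennreal (indicator S x * D x) \<partial>lborel) = ennreal m" if "(D has_integral m) S" for m
    using nn_integral_has_integral_lebesgue[OF _ that] by (simp add: D_def)
  show ?thesis
  proof (cases "(\<integral>\<^sup>+x. ennreal (indicator S x * D x) \<partial>lborel) = \<infinity>")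
    case True
    have "f ` S \<notin> lmeasurable"
    proof
      assume "f ` S \<in> lmeasurable"
      then have "(D has_integral measure lebesgue (f ` S)) S" using iff by blast
      from nn[OF this] True show False by simp
    qed
    then have "emeasure lebesgue (f ` S) = \<infinity>"
    proof -
      have "\<not> emeasure lebesgue (f ` S) < top"
        using \<open>f ` S \<notin> lmeasurable\<close> fS by (auto simp: fmeasurable_def)
      then show ?thesis by (simp add: not_less top_unique)
    qed
    then show ?thesis using True by (simp add: em D_def)
  next
    case False
    then obtain m where m: "(\<integral>\<^sup>+x. ennreal (indicator S x * D x) \<partial>lborel) = ennreal m" "0 \<le> m"
      by (cases "\<integral>\<^sup>+x. ennreal (indicator S x * D x) \<partial>lborel" rule: ennreal_cases) auto
    have "((\<lambda>x. indicator S x * D x) has_integral m) UNIV"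
      using meas m by (intro nn_integral_has_integral) (auto simp: D_def)
    then have "((\<lambda>x. if x \<in> S then D x else 0) has_integral m) UNIV"
      by (rule has_integral_eq[rotated]) (auto simp: indicator_def)
    then have "(D has_integral m) S" by (simp add: has_integral_restrict_UNIV)
    then have "f ` S \<in> lmeasurable" "measure lebesgue (f ` S) = m" using iff by blast+
    then have "emeasure lebesgue (f ` S) = ennreal m"
      by (simp add: fmeasurable_def emeasure_eq_ennreal_measure less_top)
    then show ?thesis using m by (simp add: em D_def)
  qed
qed

text \<open>Conjugating f with a renaming of coordinates onto the ordered index type changes neither
  Lebesgue measure nor the determinant of the derivative.\<close>

lemma emeasure_differentiable_image:
  fixes f :: "real ^ 'n::finite \<Rightarrow> real ^ 'n"
  assumes S: "S \<in> sets borel" and fS: "f ` S \<in> sets borel"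
    and der: "\<And>x. x \<in> S \<Longrightarrow> (f has_derivative f' x) (at x)" and inj: "inj_on f S"
    and meas: "(\<lambda>x. indicator S x * \<bar>det (matrix (f' x))\<bar>) \<in> borel_measurable borel"
  shows "emeasure lborel (f ` S) = (\<integral>\<^sup>+x. ennreal (indicator S x * \<bar>det (matrix (f' x))\<bar>) \<partial>lborel)"
proof -
  obtain h :: "'n ordered_index \<Rightarrow> 'n" where h: "bij h"
    using finite_same_card_bij[of "UNIV :: 'n ordered_index set" "UNIV :: 'n set"]
    by (auto simp: card_UNIV_ordered_index)
  let ?r = "reindex h" and ?s = "reindex (inv h)"
  have rs: "?s (?r x) = x" "?r (?s y) = y" for x y using reindex_reindex[OF h] by auto
  have hinv: "h (inv h j) = j" "inv h (h i) = i" for i j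
    using h by (simp_all add: bij_is_inj bij_is_surj surj_f_inv_f)
  have image: "?r ` X = ?s -` X" for X
  proof (intro set_eqI iffI)
    fix y assume "y \<in> ?s -` X"
    then show "y \<in> ?r ` X" using rs(2)[of y] by (intro image_eqI[of _ _ "?s y"]) auto
  qed (auto simp: rs)
  have borel: "?r ` X \<in> sets borel" if "X \<in> sets borel" for X
    unfolding image using measurable_sets[OF borel_measurable_reindex[of "inv h"] that] by simp
  define F where "F = ?r \<circ> f \<circ> ?s"
  define F' where "F' y = ?r \<circ> f' (?s y) \<circ> ?s" for y
  have FrS: "F ` ?r ` S = ?r ` f ` S" by (auto simp: F_def rs image_comp)
  have emb: "emeasure lborel (?r ` X) = emeasure lborel X" if "X \<in> sets borel" for X
  proof -
    have "inj ?r" using rs(1) by (rule inj_on_inverseI)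
    then have "?r -` ?r ` X = X" by (rule inj_vimage_image_eq)
    then show ?thesis
      using borel[OF that] by (subst lborel_distr_reindex[OF h, symmetric], subst emeasure_distr) auto
  qed
  have lin: "linear (f' x)" if "x \<in> S" for x using der[OF that] by (rule has_derivative_linear)
  have det: "det (matrix (F' y)) = det (matrix (f' (?s y)))" for y
  proof -
    have ax: "?s (axis j 1) = axis (h j) 1" for j
      using hinv by (auto simp: reindex_def vec_eq_iff axis_def)
    have "matrix (F' y) = (\<chi> i j. matrix (f' (?s y)) $ h i $ h j)"
      by (simp add: matrix_def F'_def ax) (simp add: reindex_def)
    then show ?thesis by (simp add: det_reindex[OF h])
  qed
  have ind: "indicator (?r ` S) y = (indicator S (?s y) :: real)" for y
    unfolding image by (simp add: indicator_def)
  have "emeasure lborel (f ` S) = emeasure lborel (F ` ?r ` S)"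
    using emb[OF fS] by (simp add: FrS)
  also have "\<dots> = (\<integral>\<^sup>+y. ennreal (indicator (?r ` S) y * \<bar>det (matrix (F' y))\<bar>) \<partial>lborel)"
  proof (rule emeasure_differentiable_image_wellorder)
    show "?r ` S \<in> sets borel" "F ` ?r ` S \<in> sets borel" using borel S fS by (auto simp: FrS)
    fix y assume y: "y \<in> ?r ` S"
    have "(f has_derivative f' (?s y)) (at (?s y))" using y by (intro der) (auto simp: rs)
    then show "(F has_derivative F' y) (at y)"
      unfolding F_def F'_def comp_def
      using has_derivative_compose[OF has_derivative_compose[OF
          bounded_linear_imp_has_derivative[OF bounded_linear_reindex]]
          bounded_linear_imp_has_derivative[OF bounded_linear_reindex]] by blast
  next
    show "inj_on F (?r ` S)"
    proof (rule inj_onI)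
      fix y y' assume "y \<in> ?r ` S" "y' \<in> ?r ` S" and eq: "F y = F y'"
      then obtain x x' where x: "x \<in> S" "y = ?r x" "x' \<in> S" "y' = ?r x'" by blast
      have "?s (F y) = ?s (F y')" using eq by simp
      then have "f x = f x'" by (simp add: F_def rs x)
      then show "y = y'" using inj x by (auto dest: inj_onD)
    qed
    have "(\<lambda>y. indicator S (?s y) * \<bar>det (matrix (f' (?s y)))\<bar>) \<in> borel_measurable borel"
      using measurable_compose[OF borel_measurable_reindex meas] .
    then show "(\<lambda>y. indicator (?r ` S) y * \<bar>det (matrix (F' y))\<bar>) \<in> borel_measurable borel"
      by (simp add: ind det)
  qed
  also have "\<dots> = (\<integral>\<^sup>+y. ennreal (indicator S (?s y) * \<bar>det (matrix (f' (?s y)))\<bar>) \<partial>distr lborel borel ?r)"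
    by (simp add: ind det lborel_distr_reindex[OF h])
  also have "\<dots> = (\<integral>\<^sup>+x. ennreal (indicator S (?s (?r x)) * \<bar>det (matrix (f' (?s (?r x))))\<bar>) \<partial>lborel)"
    using measurable_compose[OF borel_measurable_reindex meas] by (subst nn_integral_distr) auto
  finally show ?thesis by (simp add: rs)
qed

text \<open>The image under f of the measure with density |det f'| on S is Lebesgue measure on f(S),
  by the formula for sets; integrating H against both measures gives the claim.\<close>

lemma nn_integral_change_of_variables:
  fixes f :: "real ^ 'n::finite \<Rightarrow> real ^ 'n" and H :: "real ^ 'n \<Rightarrow> ennreal"
  assumes S: "S \<in> sets borel" and borel_image: "\<And>X. X \<in> sets borel \<Longrightarrow> X \<subseteq> S \<Longrightarrow> f ` X \<in> sets borel"
    and der: "\<And>x. x \<in> S \<Longrightarrow> (f has_derivative f' x) (at x)" and inj: "inj_on f S"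
    and meas: "(\<lambda>x. indicator S x * \<bar>det (matrix (f' x))\<bar>) \<in> borel_measurable borel"
    and H: "H \<in> borel_measurable borel"
  shows "(\<integral>\<^sup>+y. H y * indicator (f ` S) y \<partial>lborel)
    = (\<integral>\<^sup>+x. H (f x) * ennreal \<bar>det (matrix (f' x))\<bar> * indicator S x \<partial>lborel)"
proof -
  \<comment> \<open>The extension by 0 is Borel on the whole space, and the density D vanishes
    wherever F differs from f.\<close>
  define F where "F x = (if x \<in> S then f x else 0)" for x
  define D where "D x = indicator S x * \<bar>det (matrix (f' x))\<bar>" for x
  have contf: "continuous_on S f"
    using der by (meson continuous_at_imp_continuous_on has_derivative_continuous)
  have F [measurable]: "F \<in> borel_measurable borel"
    unfolding F_def using borel_measurable_continuous_on_indicator[OF S contf]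
    by (rule measurable_cong[THEN iffD1, rotated]) (auto simp: indicator_def)
  have D [measurable]: "D \<in> borel_measurable borel" using meas by (simp add: D_def[abs_def])
  have "distr (density lborel (\<lambda>x. ennreal (D x))) borel F = density lborel (indicator (f ` S))"
  proof (rule measure_eqI)
    fix B assume "B \<in> sets (distr (density lborel (\<lambda>x. ennreal (D x))) borel F)"
    then have B [measurable]: "B \<in> sets borel" by simp
    have SB: "S \<inter> F -` B \<in> sets borel" using measurable_sets[OF F B] S by auto
    have fSB: "f ` (S \<inter> F -` B) = f ` S \<inter> B" by (auto simp: F_def)
    have "emeasure (distr (density lborel (\<lambda>x. ennreal (D x))) borel F) B
        = (\<integral>\<^sup>+x. ennreal (D x) * indicator (F -` B) x \<partial>lborel)"
      using measurable_sets[OF F B] by (simp add: emeasure_distr emeasure_density)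
    also have "\<dots> = (\<integral>\<^sup>+x. ennreal (indicator (S \<inter> F -` B) x * \<bar>det (matrix (f' x))\<bar>) \<partial>lborel)"
      by (intro nn_integral_cong) (auto simp: D_def indicator_def)
    also have "\<dots> = emeasure lborel (f ` (S \<inter> F -` B))"
    proof (rule emeasure_differentiable_image[symmetric])
      have "(\<lambda>x. indicator (S \<inter> F -` B) x * D x) \<in> borel_measurable borel"
        using SB by measurable
      then show "(\<lambda>x. indicator (S \<inter> F -` B) x * \<bar>det (matrix (f' x))\<bar>) \<in> borel_measurable borel"
        by (rule measurable_cong[THEN iffD1, rotated]) (auto simp: D_def indicator_def)
    qed (use SB borel_image der inj in \<open>auto intro: inj_on_subset\<close>)
    also have "\<dots> = emeasure (density lborel (indicator (f ` S))) B"
      unfolding fSB using borel_image[OF S]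
      by (subst emeasure_density) (auto simp: indicator_inter_arith[symmetric] emeasure_restrict_space)
    finally show "emeasure (distr (density lborel (\<lambda>x. ennreal (D x))) borel F) B
        = emeasure (density lborel (indicator (f ` S))) B" .
  qed simp
  then have "(\<integral>\<^sup>+y. H y \<partial>density lborel (indicator (f ` S))) = (\<integral>\<^sup>+y. H y \<partial>distr (density lborel (\<lambda>x. ennreal (D x))) borel F)"
    by simp
  moreover have "(\<integral>\<^sup>+y. H y \<partial>density lborel (indicator (f ` S))) = (\<integral>\<^sup>+y. H y * indicator (f ` S) y \<partial>lborel)"
    using H borel_image[OF S] by (subst nn_integral_density) (auto simp: mult.commute)
  moreover have "(\<integral>\<^sup>+y. H y \<partial>distr (density lborel (\<lambda>x. ennreal (D x))) borel F) = (\<integral>\<^sup>+x. ennreal (D x) * H (F x) \<partial>lborel)"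
    using H by (subst nn_integral_distr) (auto simp: nn_integral_density)
  moreover have "\<dots> = (\<integral>\<^sup>+x. H (f x) * ennreal \<bar>det (matrix (f' x))\<bar> * indicator S x \<partial>lborel)"
    by (intro nn_integral_cong) (auto simp: D_def F_def indicator_def mult.commute)
  ultimately show ?thesis by simp
qed

section \<open>Charts, curves and the Riemannian distance\<close>

lemma Ck_on_has_derivative_jacobian:
  fixes f :: "real ^ 'm::finite \<Rightarrow> real ^ 'k::finite"
  assumes "Ck_on (Suc 0) S f" "open S" "x \<in> S"
  shows "(f has_derivative (\<lambda>v. jacobian f (at x) *v v)) (at x)"
proof -
  have "f differentiable (at x)"
  proof -
    have "f differentiable_on S" using assms(1) by simp
    then show ?thesis
      using assms(2,3) by (metis at_within_open differentiable_on_def)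
  qed
  then show ?thesis by (rule jacobian_works[THEN iffD1])
qed

lemma Ck_on_continuous_jacobian:
  fixes f :: "real ^ 'm::finite \<Rightarrow> real ^ 'k::finite"
  assumes "Ck_on (Suc 0) S f"
  shows "continuous_on S (\<lambda>x. jacobian f (at x))"
  unfolding jacobian_def matrix_def
proof (intro continuous_on_vec_lambda continuous_on_component)
  show "continuous_on S (\<lambda>x. frechet_derivative f (at x) (axis j 1))" for j
    using assms by simp
qed

lemma continuous_on_det:
  fixes M :: "'b::topological_space \<Rightarrow> real ^ 'm::finite ^ 'm"
  assumes "continuous_on S M"
  shows "continuous_on S (\<lambda>x. det (M x))"
  unfolding det_def
  by (intro continuous_on_sum continuous_on_mult continuous_on_const continuous_on_prod continuous_on_component assms)

lemma continuous_on_matrix_vector_mult: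
  fixes M :: "'b::topological_space \<Rightarrow> real ^ 'm::finite ^ 'k::finite"
  assumes "continuous_on S M" "continuous_on S w"
  shows "continuous_on S (\<lambda>x. M x *v w x)"
  unfolding matrix_vector_mult_def
  by (intro continuous_on_vec_lambda continuous_on_sum continuous_on_mult continuous_on_component assms)

text \<open>Every matrix on the segment from the identity to G has a positive quadratic form and so
  a trivial kernel; the determinant cannot vanish along the segment and keeps the sign it has at the
  identity.\<close>

lemma det_pos_if_positive_definite:
  fixes G :: "real ^ 'm::finite ^ 'm"
  assumes pos: "\<And>v. v \<noteq> 0 \<Longrightarrow> 0 < v \<bullet> (G *v v)"
  shows "0 < det G"
proof (rule ccontr)
  assume "\<not> 0 < det G"
  define M where "M t = t *\<^sub>R G + (1 - t) *\<^sub>R mat 1" for t :: real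
  have Mv: "M t *v v = t *\<^sub>R (G *v v) + (1 - t) *\<^sub>R v" for t v
    by (simp add: M_def matrix_vector_mult_add_rdistrib scaleR_matrix_vector_assoc[symmetric])
  have "continuous_on {0..1} (\<lambda>t. det (M t))"
    unfolding M_def by (intro continuous_on_det continuous_intros)
  moreover have "det (M 0) = 1" "det (M 1) = det G" by (simp_all add: M_def)
  ultimately obtain t where t: "0 \<le> t" "t \<le> 1" "det (M t) = 0"
    using IVT2'[of "\<lambda>t. det (M t)" 1 0 0] \<open>\<not> 0 < det G\<close> by auto
  then have "\<not> invertible (M t)" by (simp add: invertible_det_nz)
  then obtain v where v: "M t *v v = 0" "v \<noteq> 0"
    unfolding invertible_left_inverse matrix_left_invertible_ker by blast
  have "0 < v \<bullet> (M t *v v)"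
  proof (cases "t = 0")
    case False
    then have "0 < t * (v \<bullet> (G *v v))" using pos[OF v(2)] t by simp
    moreover have "0 \<le> (1 - t) * (v \<bullet> v)" using t by simp
    ultimately show ?thesis by (simp add: Mv inner_add_right)
  qed (use v in \<open>simp add: Mv\<close>)
  then show False using v by simp
qed

locale riemannian =
  fixes A :: "('a::{second_countable_topology,t2_space}, 'n::finite) chart set"
    and g :: "('a, 'n) metric_tensor"
  assumes manifold: "riemannian_manifold A g"
begin

section \<open>Charts, transition maps and Gram matrices\<close>

lemma is_chart: "c \<in> A \<Longrightarrow> is_chart c"
  using manifold unfolding riemannian_manifold_def smooth_atlas_def by blast

lemma
  assumes "c \<in> A"
  shows open_chart_dom: "open (chart_dom c)"
    and open_chart_image: "open (chart_map c ` chart_dom c)"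
    and continuous_chart_map: "continuous_on (chart_dom c) (chart_map c)"
    and continuous_chart_inv: "continuous_on (chart_map c ` chart_dom c) (chart_inv c)"
    and chart_inv_map: "x \<in> chart_dom c \<Longrightarrow> chart_inv c (chart_map c x) = x"
    and chart_map_inv: "u \<in> chart_map c ` chart_dom c \<Longrightarrow> chart_map c (chart_inv c u) = u"
    and chart_inv_in: "u \<in> chart_map c ` chart_dom c \<Longrightarrow> chart_inv c u \<in> chart_dom c"
  using is_chart[OF assms] by (auto simp: is_chart_def homeomorphism_def)

lemma chart_at: "chart_at A x \<in> A" "x \<in> chart_dom (chart_at A x)"
proof -
  have "\<exists>c. c \<in> A \<and> x \<in> chart_dom c"
  proof -
    have "x \<in> (\<Union>c\<in>A. chart_dom c)"
      using manifold by (simp add: riemannian_manifold_def smooth_atlas_def)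
    then show ?thesis by blast
  qed
  then show "chart_at A x \<in> A" "x \<in> chart_dom (chart_at A x)"
    unfolding chart_at_def using someI_ex[of "\<lambda>c. c \<in> A \<and> x \<in> chart_dom c"] by blast+
qed

lemma local_dom_eq:
  assumes "c \<in> A"
  shows "local_dom c d F = {u \<in> chart_map c ` chart_dom c. F (chart_inv c u) \<in> chart_dom d}"
  using chart_inv_map[OF assms] by (auto simp: local_dom_def)

lemma open_local_dom:
  assumes "c \<in> A" "d \<in> A" "continuous_on UNIV F"
  shows "open (local_dom c d F)"
proof -
  have "continuous_on (chart_map c ` chart_dom c) (\<lambda>u. F (chart_inv c u))"
    using continuous_chart_inv[OF assms(1)] assms(3)
    by (intro continuous_on_compose2[OF assms(3)]) auto
  then have "open (chart_map c ` chart_dom c \<inter> (\<lambda>u. F (chart_inv c u)) -` chart_dom d)"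
    by (intro continuous_open_preimage open_chart_image open_chart_dom assms)
  then show ?thesis
    by (simp add: local_dom_eq[OF assms(1)] Int_def vimage_def)
qed

lemma open_transition_dom: "c \<in> A \<Longrightarrow> d \<in> A \<Longrightarrow> open (local_dom c d id)"
  by (intro open_local_dom) auto

lemma local_rep_chart_map: "c \<in> A \<Longrightarrow> x \<in> chart_dom c \<Longrightarrow> local_rep c d F (chart_map c x) = chart_map d (F x)"
  by (simp add: local_rep_def chart_inv_map)

lemma chart_map_in_local_dom: "x \<in> chart_dom c \<Longrightarrow> F x \<in> chart_dom d \<Longrightarrow> chart_map c x \<in> local_dom c d F"
  by (auto simp: local_dom_def)

lemma Ck_transition: "c \<in> A \<Longrightarrow> d \<in> A \<Longrightarrow> Ck_on (Suc 0) (local_dom c d id) (local_rep c d id)"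
  using manifold by (simp add: riemannian_manifold_def smooth_atlas_def smooth_on_def del: Ck_on.simps)

lemma has_derivative_transition:
  assumes "c \<in> A" "d \<in> A" "u \<in> local_dom c d id"
  shows "(local_rep c d id has_derivative (\<lambda>v. jacobian (local_rep c d id) (at u) *v v)) (at u)"
  by (intro Ck_on_has_derivative_jacobian[OF Ck_transition open_transition_dom] assms)

lemma metric: "riemannian_metric A g"
  using manifold by (simp add: riemannian_manifold_def)

lemma continuous_metric:
  assumes "c \<in> A"
  shows "continuous_on (chart_map c ` chart_dom c) (g c)"
proof -
  have "smooth_on (chart_map c ` chart_dom c) (g c)"
    using metric assms unfolding riemannian_metric_def by blast
  then have "Ck_on 0 (chart_map c ` chart_dom c) (g c)"
    unfolding smooth_on_def by blast
  then show ?thesis by simp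
qed

lemma metric_pos: "c \<in> A \<Longrightarrow> u \<in> chart_map c ` chart_dom c \<Longrightarrow> v \<noteq> 0 \<Longrightarrow> 0 < v \<bullet> (g c u *v v)"
  using metric unfolding riemannian_metric_def by blast

lemma det_metric_pos: "c \<in> A \<Longrightarrow> u \<in> chart_map c ` chart_dom c \<Longrightarrow> 0 < det (g c u)"
  by (intro det_pos_if_positive_definite metric_pos)

lemma metric_transition:
  assumes "c \<in> A" "d \<in> A" "u \<in> local_dom c d id"
  shows "g c u = transpose (jacobian (local_rep c d id) (at u)) ** g d (local_rep c d id u)
                ** jacobian (local_rep c d id) (at u)"
  using metric assms unfolding riemannian_metric_def by blast

section \<open>Norms of tangent vectors and speed of curves\<close>

definition tnorm :: "('a, 'n) chart \<Rightarrow> real ^ 'n \<Rightarrow> real ^ 'n \<Rightarrow> real" where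
  "tnorm c u v = sqrt (v \<bullet> (g c u *v v))"

lemma tnorm_transition:
  assumes "c \<in> A" "d \<in> A" "u \<in> local_dom c d id"
  shows "tnorm c u v = tnorm d (local_rep c d id u) (jacobian (local_rep c d id) (at u) *v v)"
proof -
  let ?J = "jacobian (local_rep c d id) (at u)"
  let ?G = "g d (local_rep c d id u)"
  have "v \<bullet> (g c u *v v) = v \<bullet> ((transpose ?J ** ?G ** ?J) *v v)"
    by (rule arg_cong[OF metric_transition[OF assms]])
  also have "\<dots> = v \<bullet> (transpose ?J *v (?G *v (?J *v v)))"
    by (simp only: matrix_vector_mul_assoc matrix_mul_assoc)
  also have "\<dots> = (?J *v v) \<bullet> (?G *v (?J *v v))"
    by (metis dot_lmul_matrix inner_commute transpose_matrix_vector)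
  finally show ?thesis by (simp only: tnorm_def)
qed

lemma tnorm_scaleR: "tnorm c u (a *\<^sub>R v) = \<bar>a\<bar> * tnorm c u v"
proof -
  have "(a *\<^sub>R v) \<bullet> (g c u *v (a *\<^sub>R v)) = a\<^sup>2 * (v \<bullet> (g c u *v v))"
    by (simp add: power2_eq_square matrix_vector_mult_scaleR)
  then show ?thesis by (simp add: tnorm_def real_sqrt_mult)
qed

text \<open>The norm attains a positive minimum and a maximum on K times the Euclidean unit sphere;
  homogeneity extends the comparison to all vectors.\<close>

lemma tnorm_bounds:
  assumes "c \<in> A" "compact K" "K \<subseteq> chart_map c ` chart_dom c"
  obtains m C where "0 < m" "0 < C" "\<And>u v. u \<in> K \<Longrightarrow> m * norm v \<le> tnorm c u v"
    "\<And>u v. u \<in> K \<Longrightarrow> tnorm c u v \<le> C * norm v"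
proof (cases "K = {}")
  case True
  then show thesis using that[of 1 1] by simp
next
  case False
  define X where "X = K \<times> sphere (0 :: real ^ 'n) 1"
  have "compact X" using assms by (auto simp: X_def intro: compact_Times)
  moreover have "X \<noteq> {}"
  proof -
    have "axis undefined 1 \<in> sphere (0 :: real ^ 'n) 1" by (simp add: norm_axis_1)
    then show ?thesis using False by (auto simp: X_def)
  qed
  moreover have cont: "continuous_on X (\<lambda>(u, v). tnorm c u v)"
    unfolding tnorm_def split_def X_def using assms
    by (intro continuous_intros continuous_on_matrix_vector_mult continuous_on_compose2[OF continuous_metric[OF assms(1)]]) auto
  ultimately obtain p q where p: "p \<in> X" "\<And>z. z \<in> X \<Longrightarrow> (case p of (u, v) \<Rightarrow> tnorm c u v) \<le> (case z of (u, v) \<Rightarrow> tnorm c u v)"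
    and q: "q \<in> X" "\<And>z. z \<in> X \<Longrightarrow> (case z of (u, v) \<Rightarrow> tnorm c u v) \<le> (case q of (u, v) \<Rightarrow> tnorm c u v)"
    using continuous_attains_inf[of X "\<lambda>(u, v). tnorm c u v"] continuous_attains_sup[of X "\<lambda>(u, v). tnorm c u v"]
    by blast
  have pos: "0 < (case z of (u, v) \<Rightarrow> tnorm c u v)" if "z \<in> X" for z
  proof -
    obtain u v where z: "z = (u, v)" by (cases z)
    then have uv: "u \<in> K" "norm v = 1" using that by (auto simp: X_def)
    then have "v \<noteq> 0" by auto
    then show ?thesis using metric_pos[OF assms(1), of u v] assms(3) z uv by (auto simp: tnorm_def)
  qed
  define m where "m = (case p of (u, v) \<Rightarrow> tnorm c u v)"
  define C where "C = (case q of (u, v) \<Rightarrow> tnorm c u v)"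
  have bd: "m * norm v \<le> tnorm c u v \<and> tnorm c u v \<le> C * norm v" if "u \<in> K" for u v
  proof (cases "v = 0")
    case False
    have X: "(u, (1 / norm v) *\<^sub>R v) \<in> X" using that False by (simp add: X_def)
    have "m \<le> tnorm c u ((1 / norm v) *\<^sub>R v)" "tnorm c u ((1 / norm v) *\<^sub>R v) \<le> C"
      using p(2)[OF X] q(2)[OF X] by (simp_all add: m_def C_def)
    then show ?thesis using False by (simp add: tnorm_scaleR field_simps)
  qed (simp add: tnorm_def)
  show thesis
    using that[of m C] pos[OF p(1)] pos[OF q(1)] bd by (simp add: m_def C_def)
qed

lemma has_vector_derivative_chart_change:
  assumes "c \<in> A" "d \<in> A" and I: "open I" "t \<in> I" "\<And>s. s \<in> I \<Longrightarrow> \<gamma> s \<in> chart_dom c"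
    and "\<gamma> t \<in> chart_dom d"
    and v: "((chart_map c \<circ> \<gamma>) has_vector_derivative v) (at t)"
  shows "((chart_map d \<circ> \<gamma>) has_vector_derivative
    jacobian (local_rep c d id) (at (chart_map c (\<gamma> t))) *v v) (at t)"
proof -
  let ?h = "local_rep c d id" and ?u = "chart_map c (\<gamma> t)"
  have u: "?u \<in> local_dom c d id"
    using assms by (intro chart_map_in_local_dom) auto
  have "((?h \<circ> (chart_map c \<circ> \<gamma>)) has_derivative (\<lambda>w. jacobian ?h (at ?u) *v w) \<circ> (\<lambda>x. x *\<^sub>R v)) (at t)"
    using v has_derivative_transition[OF assms(1,2) u]
    by (intro diff_chain_at) (auto simp: has_vector_derivative_def)
  then have "((?h \<circ> (chart_map c \<circ> \<gamma>)) has_vector_derivative jacobian ?h (at ?u) *v v) (at t)"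
    by (simp add: has_vector_derivative_def comp_def matrix_vector_mult_scaleR)
  then show ?thesis
    by (rule has_vector_derivative_transform_within_open[OF _ I(1,2)])
      (simp add: local_rep_chart_map[OF assms(1) I(3)])
qed

text \<open>The definition of \<open>speed\<close> uses the arbitrary chart picked by
  \<open>chart_at\<close>; invariance of the norm under transitions lets any chart along the curve
  compute it.\<close>

lemma speed_eq:
  assumes "c \<in> A" and I: "open I" "t \<in> I" "\<And>s. s \<in> I \<Longrightarrow> \<gamma> s \<in> chart_dom c"
    and v: "((chart_map c \<circ> \<gamma>) has_vector_derivative v) (at t)"
  shows "speed A g \<gamma> t = tnorm c (chart_map c (\<gamma> t)) v"
proof -
  let ?d = "chart_at A (\<gamma> t)" and ?u = "chart_map c (\<gamma> t)"
  have u: "?u \<in> local_dom c ?d id"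
    using I chart_at by (intro chart_map_in_local_dom) auto
  have "vector_derivative (chart_map ?d \<circ> \<gamma>) (at t) = jacobian (local_rep c ?d id) (at ?u) *v v"
    by (intro vector_derivative_at has_vector_derivative_chart_change[OF assms(1) chart_at(1) I chart_at(2) v])
  then have "speed A g \<gamma> t = tnorm ?d (chart_map ?d (\<gamma> t)) (jacobian (local_rep c ?d id) (at ?u) *v v)"
    by (simp add: speed_def tnorm_def Let_def)
  also have "chart_map ?d (\<gamma> t) = local_rep c ?d id ?u"
    using I by (simp add: local_rep_chart_map[OF assms(1)])
  finally show ?thesis
    using tnorm_transition[OF assms(1) chart_at(1) u, of v] by (simp only:)
qed

text \<open>Used for upper bounds of the distance in place of "length at most B". A speed bound off
  a finite set is easily checked on segments and concatenations, and it bounds the length by B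
  because the parameter interval has length 1.\<close>

definition reach :: "real \<Rightarrow> 'a \<Rightarrow> 'a \<Rightarrow> bool" where
  "reach B x y \<longleftrightarrow> (\<exists>\<gamma> S. piecewise_C1_curve A \<gamma> \<and> pathstart \<gamma> = x \<and> pathfinish \<gamma> = y \<and>
     finite S \<and> (\<forall>t\<in>{0..1} - S. speed A g \<gamma> t \<le> B))"

lemma riem_dist_nonneg: "0 \<le> riem_dist A g x y"
  by (simp add: riem_dist_def)

lemma curve_length_le_if_reach:
  assumes "reach B x y"
  shows "\<exists>\<gamma>. piecewise_C1_curve A \<gamma> \<and> pathstart \<gamma> = x \<and> pathfinish \<gamma> = y \<and> curve_length A g \<gamma> \<le> ennreal B"
proof -
  obtain \<gamma> S where \<gamma>: "piecewise_C1_curve A \<gamma>" "pathstart \<gamma> = x" "pathfinish \<gamma> = y"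
    and S: "finite S" "\<And>t. t \<in> {0..1} - S \<Longrightarrow> speed A g \<gamma> t \<le> B"
    using assms unfolding reach_def by blast
  have "curve_length A g \<gamma> \<le> (\<integral>\<^sup>+t\<in>{0..1::real}. ennreal B \<partial>lborel)"
    unfolding curve_length_def
  proof (rule nn_integral_mono_AE)
    have "AE t in lborel. t \<notin> S"
      using S(1) by (intro AE_not_in finite_imp_null_set_lborel)
    then show "AE t in lborel. ennreal (speed A g \<gamma> t) * indicator {0..1} t \<le> ennreal B * indicator {0..1} t"
      by eventually_elim (use S(2) in \<open>auto simp: indicator_def intro: ennreal_leI\<close>)
  qed
  also have "\<dots> = ennreal B" by (simp add: nn_integral_cmult_indicator)
  finally show ?thesis using \<gamma> by blast
qed

lemma riem_dist_le_if_reach: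
  assumes "reach B x y" "0 \<le> B"
  shows "riem_dist A g x y \<le> B"
proof -
  obtain \<gamma> where "piecewise_C1_curve A \<gamma>" "pathstart \<gamma> = x" "pathfinish \<gamma> = y" "curve_length A g \<gamma> \<le> ennreal B"
    using curve_length_le_if_reach[OF assms(1)] by blast
  then have "(INF \<gamma> \<in> {\<gamma>. piecewise_C1_curve A \<gamma> \<and> pathstart \<gamma> = x \<and> pathfinish \<gamma> = y}. curve_length A g \<gamma>) \<le> ennreal B"
    by (intro INF_lower2[of \<gamma>]) auto
  then show ?thesis
    unfolding riem_dist_def using assms(2) by (metis enn2real_ennreal enn2real_mono ennreal_less_top)
qed

lemma reach_mono:
  assumes "reach B x y" "B \<le> B'"
  shows "reach B' x y"
proof -
  obtain \<gamma> S where \<gamma>: "piecewise_C1_curve A \<gamma>" "pathstart \<gamma> = x" "pathfinish \<gamma> = y" "finite S"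
    and "\<forall>t\<in>{0..1} - S. speed A g \<gamma> t \<le> B"
    using assms(1) unfolding reach_def by blast
  then have "\<forall>t\<in>{0..1} - S. speed A g \<gamma> t \<le> B'"
    using assms(2) by force
  then show ?thesis unfolding reach_def using \<gamma> by blast
qed

text \<open>The connecting curve is the straight segment in the coordinates of c, which stays in X
  by convexity and has constant coordinate velocity.\<close>

lemma reach_segment:
  assumes c: "c \<in> A" and X: "convex X" "open X" "X \<subseteq> chart_map c ` chart_dom c"
    and C: "\<And>u v. u \<in> X \<Longrightarrow> tnorm c u v \<le> C * norm v"
    and y: "y \<in> chart_dom c" "chart_map c y \<in> X" and y': "y' \<in> chart_dom c" "chart_map c y' \<in> X"
  shows "reach (C * norm (chart_map c y - chart_map c y')) y y'"
proof -
  define u where "u = chart_map c y"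
  define w where "w = chart_map c y' - chart_map c y"
  define l where "l t = u + t *\<^sub>R w" for t :: real
  define \<gamma> where "\<gamma> = chart_inv c \<circ> l"
  \<comment> \<open>An open set of parameters containing [0, 1]: two-sided derivatives thus exist at
    the end points as well.\<close>
  define I where "I = l -` X"
  have contl: "continuous_on UNIV l" unfolding l_def by (intro continuous_intros)
  have I: "open I" unfolding I_def using X(2) contl by (intro open_vimage) auto
  have seg: "{0..1} \<subseteq> I"
  proof
    fix t :: real assume t: "t \<in> {0..1}"
    have "l t = (1 - t) *\<^sub>R chart_map c y + t *\<^sub>R chart_map c y'"
      by (simp add: l_def u_def w_def algebra_simps)
    then show "t \<in> I" using convexD_alt[OF X(1) y(2) y'(2), of t] t by (simp add: I_def)
  qed
  have lX: "l s \<in> chart_map c ` chart_dom c" if "s \<in> I" for s using that X by (auto simp: I_def)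
  have \<gamma>_dom: "\<gamma> s \<in> chart_dom c" and map_\<gamma>: "chart_map c (\<gamma> s) = l s" if "s \<in> I" for s
    using lX[OF that] chart_inv_in[OF c] chart_map_inv[OF c] by (auto simp: \<gamma>_def)
  have l_vd: "(l has_vector_derivative w) (at t)" for t
    unfolding l_def by (auto intro!: derivative_eq_intros)
  have vd: "((chart_map c \<circ> \<gamma>) has_vector_derivative w) (at t)" if "t \<in> I" for t
    by (rule has_vector_derivative_transform_within_open[OF l_vd I that]) (simp add: map_\<gamma>)
  have path: "path \<gamma>"
    unfolding path_def \<gamma>_def using seg lX
    by (intro continuous_on_compose continuous_on_subset[OF contl] continuous_on_subset[OF continuous_chart_inv[OF c]]) auto
  have "piecewise_C1_curve A \<gamma>"
    unfolding piecewise_C1_curve_def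
  proof (intro conjI path exI[of _ "{}"] ballI)
    fix d assume d: "d \<in> A"
    let ?T = "({0..1} - {}) \<inter> \<gamma> -` chart_dom d"
    have T: "t \<in> I" "\<gamma> t \<in> chart_dom c" "\<gamma> t \<in> chart_dom d" "l t \<in> local_dom c d id" if "t \<in> ?T" for t
    proof -
      show "t \<in> I" "\<gamma> t \<in> chart_dom c" "\<gamma> t \<in> chart_dom d" using that seg \<gamma>_dom by auto
      then show "l t \<in> local_dom c d id" using chart_map_in_local_dom[of "\<gamma> t" c id d] by (simp add: map_\<gamma>)
    qed
    have vd': "((chart_map d \<circ> \<gamma>) has_vector_derivative jacobian (local_rep c d id) (at (l t)) *v w) (at t)" if "t \<in> ?T" for t
      using has_vector_derivative_chart_change[OF c d I T(1)[OF that] \<gamma>_dom T(3)[OF that] vd[OF T(1)[OF that]]]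
      by (simp add: map_\<gamma>[OF T(1)[OF that]])
    have cont': "continuous_on ?T (\<lambda>t. jacobian (local_rep c d id) (at (l t)) *v w)"
    proof (rule continuous_on_matrix_vector_mult[OF _ continuous_on_const])
      have "l ` ?T \<subseteq> local_dom c d id" using T(4) by blast
      then show "continuous_on ?T (\<lambda>t. jacobian (local_rep c d id) (at (l t)))"
        by (rule continuous_on_compose2[OF Ck_on_continuous_jacobian[OF Ck_transition[OF c d]]
              continuous_on_subset[OF contl subset_UNIV]])
    qed
    show "(chart_map d \<circ> \<gamma>) C1_differentiable_on ?T"
      unfolding C1_differentiable_on_def by (intro exI[of _ "\<lambda>t. jacobian (local_rep c d id) (at (l t)) *v w"] conjI ballI vd' cont')
  qed auto
  moreover have "pathstart \<gamma> = y" "pathfinish \<gamma> = y'"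
    using chart_inv_map[OF c y(1)] chart_inv_map[OF c y'(1)]
    by (simp_all add: pathstart_def pathfinish_def \<gamma>_def l_def u_def w_def)
  moreover have "speed A g \<gamma> t \<le> C * norm (chart_map c y - chart_map c y')" if "t \<in> {0..1} - {}" for t
  proof -
    have t: "t \<in> I" using that seg by auto
    have "speed A g \<gamma> t = tnorm c (l t) w"
      using speed_eq[OF c I t \<gamma>_dom vd[OF t]] by (simp add: map_\<gamma>[OF t])
    also have "\<dots> \<le> C * norm w" using C t by (simp add: I_def)
    finally show ?thesis by (simp add: w_def norm_minus_commute)
  qed
  ultimately show ?thesis
    unfolding reach_def by blast
qed

end

section \<open>Upper bounds for the Riemannian distance\<close>

context riemannian
begin

text \<open>The ball is closed so that it is compact and \<open>tnorm_bounds\<close> applies to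
  it.\<close>

lemma chart_ball:
  assumes "c \<in> A" "x \<in> chart_dom c" "open N" "x \<in> N"
  shows "\<exists>r>0. cball (chart_map c x) r \<subseteq> chart_map c ` chart_dom c \<and>
    (\<forall>y\<in>chart_dom c. chart_map c y \<in> cball (chart_map c x) r \<longrightarrow> y \<in> N)"
proof -
  let ?U = "chart_map c ` chart_dom c"
  have "open (?U \<inter> chart_inv c -` N)"
    using assms by (intro continuous_open_preimage continuous_chart_inv open_chart_image)
  moreover have "chart_map c x \<in> ?U \<inter> chart_inv c -` N"
    using assms by (simp add: chart_inv_map)
  ultimately obtain r where r: "0 < r" "cball (chart_map c x) r \<subseteq> ?U \<inter> chart_inv c -` N"
    by (meson open_contains_cball)
  show ?thesis
  proof (intro exI[of _ r] conjI ballI impI r(1))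
    show "cball (chart_map c x) r \<subseteq> ?U" using r(2) by blast
    fix y assume y: "y \<in> chart_dom c" "chart_map c y \<in> cball (chart_map c x) r"
    then have "chart_inv c (chart_map c y) \<in> N" using r(2) by blast
    then show "y \<in> N" using y by (simp add: chart_inv_map[OF assms(1)])
  qed
qed

lemma open_chart_preimage:
  assumes "c \<in> A" "open X"
  shows "open {y \<in> chart_dom c. chart_map c y \<in> X}"
proof -
  have "open (chart_dom c \<inter> chart_map c -` X)"
    using assms by (intro continuous_open_preimage continuous_chart_map open_chart_dom)
  then show ?thesis by (simp add: Int_def vimage_def)
qed

lemma reach_local:
  assumes "c \<in> A" "0 < r" "cball u r \<subseteq> chart_map c ` chart_dom c"
  shows "\<exists>C>0. \<forall>y\<in>chart_dom c. \<forall>y'\<in>chart_dom c. chart_map c y \<in> ball u r \<longrightarrow>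
    chart_map c y' \<in> ball u r \<longrightarrow> reach (C * norm (chart_map c y - chart_map c y')) y y'"
proof -
  obtain m C where C: "0 < C" "\<And>w v. w \<in> cball u r \<Longrightarrow> tnorm c w v \<le> C * norm v"
    using tnorm_bounds[OF assms(1) compact_cball assms(3)] by metis
  show ?thesis
  proof (intro exI[of _ C] conjI ballI impI C(1))
    fix y y' assume y: "y \<in> chart_dom c" "y' \<in> chart_dom c" "chart_map c y \<in> ball u r" "chart_map c y' \<in> ball u r"
    have "ball u r \<subseteq> chart_map c ` chart_dom c" using assms(3) by auto
    then show "reach (C * norm (chart_map c y - chart_map c y')) y y'"
      using y by (intro reach_segment[OF assms(1) convex_ball[of u r] open_ball] C(2)) auto
  qed
qed

text \<open>Short coordinate segments connect x to all points near it. Together with the converse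
  \<open>riem_dist_less_imp_mem\<close> this ties small distance to nearness in the manifold
  topology.\<close>

lemma riem_dist_small:
  assumes "0 < e"
  shows "\<exists>N. open N \<and> x \<in> N \<and> (\<forall>y\<in>N. riem_dist A g x y < e \<and> riem_dist A g y x < e)"
proof -
  define c where "c = chart_at A x"
  have c: "c \<in> A" "x \<in> chart_dom c" using chart_at by (auto simp: c_def)
  obtain r where r: "0 < r" "cball (chart_map c x) r \<subseteq> chart_map c ` chart_dom c"
    using chart_ball[OF c open_UNIV UNIV_I] by blast
  obtain C where C: "0 < C" and R0: "\<forall>y\<in>chart_dom c. \<forall>y'\<in>chart_dom c. chart_map c y \<in> ball (chart_map c x) r \<longrightarrow>
    chart_map c y' \<in> ball (chart_map c x) r \<longrightarrow> reach (C * norm (chart_map c y - chart_map c y')) y y'"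
    using reach_local[OF c(1) r] by (elim exE conjE)
  note R = R0[rule_format]
  define s where "s = min r (e / C)"
  have "0 < s" using r assms C by (simp add: s_def)
  define N where "N = {y \<in> chart_dom c. chart_map c y \<in> ball (chart_map c x) s}"
  have N: "riem_dist A g x y < e \<and> riem_dist A g y x < e" if "y \<in> N" for y
  proof -
    have y: "y \<in> chart_dom c" "norm (chart_map c x - chart_map c y) < s"
      using that by (auto simp: N_def dist_norm)
    then have ball: "chart_map c y \<in> ball (chart_map c x) r" "chart_map c x \<in> ball (chart_map c x) r"
      using r by (simp_all add: s_def dist_norm)
    have "riem_dist A g x y \<le> C * norm (chart_map c x - chart_map c y)"
      "riem_dist A g y x \<le> C * norm (chart_map c y - chart_map c x)"
      using C by (intro riem_dist_le_if_reach R c(2) y(1) ball; simp)+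
    moreover have "C * norm (chart_map c x - chart_map c y) < e"
    proof -
      have "norm (chart_map c x - chart_map c y) < e / C" using y(2) by (simp add: s_def)
      then show ?thesis using C by (simp add: field_simps)
    qed
    ultimately show ?thesis by (simp add: norm_minus_commute)
  qed
  show ?thesis
  proof (intro exI[of _ N] conjI ballI)
    show "open N" unfolding N_def by (rule open_chart_preimage[OF c(1) open_ball])
    show "x \<in> N" using c \<open>0 < s\<close> by (simp add: N_def)
  qed (simp_all add: N)
qed

text \<open>Adding 0 and 1 to the exceptional set reduces everything to the open parameter interval,
  where preimages of chart domains are open and two-sided derivatives can be compared between
  charts.\<close>

lemma piecewise_C1_curve_interior:
  assumes "piecewise_C1_curve A \<gamma>"
  shows "\<exists>S. finite S \<and> {0, 1} \<subseteq> S \<and>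
    (\<forall>c\<in>A. (chart_map c \<circ> \<gamma>) C1_differentiable_on (({0..1} - S) \<inter> \<gamma> -` chart_dom c) \<and>
       open ({0<..<1} \<inter> \<gamma> -` chart_dom c))"
proof -
  obtain S where S: "finite S"
    "\<And>c. c \<in> A \<Longrightarrow> (chart_map c \<circ> \<gamma>) C1_differentiable_on (({0..1} - S) \<inter> \<gamma> -` chart_dom c)"
    using assms unfolding piecewise_C1_curve_def by blast
  have "continuous_on {0..1} \<gamma>"
    using assms unfolding piecewise_C1_curve_def path_def by blast
  then have cont: "continuous_on {0<..<1} \<gamma>" by (rule continuous_on_subset) auto
  show ?thesis
  proof (intro exI[of _ "insert 0 (insert 1 S)"] conjI ballI)
    show "(chart_map c \<circ> \<gamma>) C1_differentiable_on (({0..1} - insert 0 (insert 1 S)) \<inter> \<gamma> -` chart_dom c)"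
      if "c \<in> A" for c
      by (rule C1_differentiable_on_subset[OF S(2)[OF that]]) auto
    show "open ({0<..<1} \<inter> \<gamma> -` chart_dom c)" if "c \<in> A" for c
      by (intro continuous_open_preimage cont open_chart_dom that open_greaterThanLessThan)
  qed (use S(1) in simp_all)
qed

lemma has_vector_derivative_double:
  "((\<lambda>t. 2 * t) has_vector_derivative 2) (at (t :: real))"
  "((\<lambda>t. 2 * t - 1) has_vector_derivative 2) (at (t :: real))"
  by (auto intro!: derivative_eq_intros)

text \<open>X avoids 1 / 2 and so splits into two relatively open halves; the derivatives of the two
  pieces need not agree at the joint.\<close>

lemma C1_joinpaths:
  assumes f1: "f1 C1_differentiable_on S1" and f2: "f2 C1_differentiable_on S2"
    and X: "\<And>t. t \<in> X \<Longrightarrow> t < 1 / 2 \<Longrightarrow> 2 * t \<in> S1" "\<And>t. t \<in> X \<Longrightarrow> \<not> t < 1 / 2 \<Longrightarrow> 1 / 2 < t \<and> 2 * t - 1 \<in> S2"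
    and h: "\<And>t. t < 1 / 2 \<Longrightarrow> h t = f1 (2 * t)" "\<And>t. 1 / 2 < t \<Longrightarrow> h t = f2 (2 * t - 1)"
  shows "(h :: real \<Rightarrow> 'b::real_normed_vector) C1_differentiable_on X"
proof -
  obtain D1 where D1: "\<And>t. t \<in> S1 \<Longrightarrow> (f1 has_vector_derivative D1 t) (at t)" "continuous_on S1 D1"
    using f1 unfolding C1_differentiable_on_def by blast
  obtain D2 where D2: "\<And>t. t \<in> S2 \<Longrightarrow> (f2 has_vector_derivative D2 t) (at t)" "continuous_on S2 D2"
    using f2 unfolding C1_differentiable_on_def by blast
  define D where "D t = (if t < 1 / 2 then 2 *\<^sub>R D1 (2 * t) else 2 *\<^sub>R D2 (2 * t - 1))" for t
  have vd: "(h has_vector_derivative D t) (at t)" if t: "t \<in> X" for t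
  proof (cases "t < 1 / 2")
    case True
    have "((f1 \<circ> (\<lambda>t. 2 * t)) has_vector_derivative 2 *\<^sub>R D1 (2 * t)) (at t)"
      by (rule vector_diff_chain_at[OF has_vector_derivative_double(1) D1(1)[OF X(1)[OF t True]]])
    then have "(h has_vector_derivative 2 *\<^sub>R D1 (2 * t)) (at t)"
      by (rule has_vector_derivative_transform_within_open[where S = "{..<1/2}"]) (use True in \<open>auto simp: h\<close>)
    then show ?thesis using True by (simp add: D_def)
  next
    case False
    then have *: "1 / 2 < t" "2 * t - 1 \<in> S2" using X(2)[OF t] by auto
    have "((f2 \<circ> (\<lambda>t. 2 * t - 1)) has_vector_derivative 2 *\<^sub>R D2 (2 * t - 1)) (at t)"
      by (rule vector_diff_chain_at[OF has_vector_derivative_double(2) D2(1)[OF *(2)]])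
    then have "(h has_vector_derivative 2 *\<^sub>R D2 (2 * t - 1)) (at t)"
      by (rule has_vector_derivative_transform_within_open[where S = "{1/2<..}"]) (use * in \<open>auto simp: h\<close>)
    then show ?thesis using False by (simp add: D_def)
  qed
  have "continuous_on (X \<inter> {..<1/2} \<union> X \<inter> {1/2<..}) D"
  proof (rule continuous_on_Un_local_open)
    have X': "X \<inter> {..<1/2} \<union> X \<inter> {1/2<..} = X" using X(2) by force
    show "openin (top_of_set (X \<inter> {..<1/2} \<union> X \<inter> {1/2<..})) (X \<inter> {..<1/2})"
      "openin (top_of_set (X \<inter> {..<1/2} \<union> X \<inter> {1/2<..})) (X \<inter> {1/2<..})"
      unfolding X' by (auto intro!: openin_open_Int)
    have "continuous_on (X \<inter> {..<1/2}) (\<lambda>t. 2 *\<^sub>R D1 (2 * t))"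
      using X(1) by (intro continuous_on_scaleR continuous_on_const continuous_on_compose2[OF D1(2)] continuous_on_mult continuous_on_id) auto
    then show "continuous_on (X \<inter> {..<1/2}) D"
      by (rule continuous_on_eq) (simp add: D_def)
    have "continuous_on (X \<inter> {1/2<..}) (\<lambda>t. 2 *\<^sub>R D2 (2 * t - 1))"
      using X(2) by (intro continuous_on_scaleR continuous_on_const continuous_on_compose2[OF D2(2)] continuous_on_mult continuous_on_diff continuous_on_id) auto
    then show "continuous_on (X \<inter> {1/2<..}) D"
      by (rule continuous_on_eq) (simp add: D_def)
  qed
  moreover have "X \<inter> {..<1/2} \<union> X \<inter> {1/2<..} = X" using X(2) by force
  ultimately have contD: "continuous_on X D" by (simp only:)
  show ?thesis
    unfolding C1_differentiable_on_def by (intro exI[of _ D] conjI ballI vd contD)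
qed

text \<open>Concatenation runs through each curve at twice its speed, whence the factor 2.\<close>

lemma reach_trans:
  assumes "reach B1 x y" "reach B2 y z"
  shows "reach (2 * max B1 B2) x z"
proof -
  obtain p1 R1 where p1: "piecewise_C1_curve A p1" "pathstart p1 = x" "pathfinish p1 = y" "finite R1"
    and B1: "\<forall>t\<in>{0..1} - R1. speed A g p1 t \<le> B1"
    using assms(1) unfolding reach_def by blast
  obtain p2 R2 where p2: "piecewise_C1_curve A p2" "pathstart p2 = y" "pathfinish p2 = z" "finite R2"
    and B2: "\<forall>t\<in>{0..1} - R2. speed A g p2 t \<le> B2"
    using assms(2) unfolding reach_def by blast
  obtain S1 where S1: "finite S1" "{0, 1} \<subseteq> S1"
    and C10: "\<forall>c\<in>A. (chart_map c \<circ> p1) C1_differentiable_on (({0..1} - S1) \<inter> p1 -` chart_dom c) \<and>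
       open ({0<..<1} \<inter> p1 -` chart_dom c)"
    using piecewise_C1_curve_interior[OF p1(1)] by (elim exE conjE)
  have C1: "(chart_map c \<circ> p1) C1_differentiable_on (({0..1} - S1) \<inter> p1 -` chart_dom c)" if "c \<in> A" for c
    using C10 that by blast
  obtain S2 where S2: "finite S2" "{0, 1} \<subseteq> S2"
    and C20: "\<forall>c\<in>A. (chart_map c \<circ> p2) C1_differentiable_on (({0..1} - S2) \<inter> p2 -` chart_dom c) \<and>
       open ({0<..<1} \<inter> p2 -` chart_dom c)"
    using piecewise_C1_curve_interior[OF p2(1)] by (elim exE conjE)
  have C2: "(chart_map c \<circ> p2) C1_differentiable_on (({0..1} - S2) \<inter> p2 -` chart_dom c)" if "c \<in> A" for c
    using C20 that by blast
  define p where "p = p1 +++ p2"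
  \<comment> \<open>Both exceptional sets rescaled to the two halves. The joint 1 / 2 belongs to it
    because 1 lies in S1.\<close>
  define S where "S = (\<lambda>t. t / 2) ` (S1 \<union> R1) \<union> (\<lambda>t. (t + 1) / 2) ` (S2 \<union> R2)"
  have "finite S" using S1 S2 p1 p2 by (simp add: S_def)
  have pl: "p t = p1 (2 * t)" if "t < 1 / 2" for t using that by (simp add: p_def joinpaths_def)
  have pr: "p t = p2 (2 * t - 1)" if "1 / 2 < t" for t using that by (simp add: p_def joinpaths_def)
  have not_half: "t \<noteq> 1 / 2" if "t \<notin> S" for t
  proof
    assume "t = 1 / 2"
    then have "t \<in> (\<lambda>t. t / 2) ` (S1 \<union> R1)" using S1 by (intro image_eqI[of _ _ 1]) auto
    then show False using that by (simp add: S_def)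
  qed
  have left: "2 * t \<in> {0..1} - (S1 \<union> R1)" if "t \<in> {0..1} - S" "t < 1 / 2" for t
  proof -
    have "t \<in> (\<lambda>t. t / 2) ` (S1 \<union> R1)" if "2 * t \<in> S1 \<union> R1"
      using that by (intro image_eqI[of _ _ "2 * t"]) auto
    then show ?thesis using that by (auto simp: S_def)
  qed
  have right: "1 / 2 < t \<and> 2 * t - 1 \<in> {0..1} - (S2 \<union> R2)" if "t \<in> {0..1} - S" "\<not> t < 1 / 2" for t
  proof -
    have "t \<in> (\<lambda>t. (t + 1) / 2) ` (S2 \<union> R2)" if "2 * t - 1 \<in> S2 \<union> R2"
      using that by (intro image_eqI[of _ _ "2 * t - 1"]) auto
    then show ?thesis using that not_half[of t] by (auto simp: S_def)
  qed
  have "piecewise_C1_curve A p"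
    unfolding piecewise_C1_curve_def
  proof (intro conjI exI[of _ S] ballI \<open>finite S\<close>)
    show "path p"
      using p1 p2 by (simp add: p_def piecewise_C1_curve_def)
    fix c assume c: "c \<in> A"
    show "(chart_map c \<circ> p) C1_differentiable_on (({0..1} - S) \<inter> p -` chart_dom c)"
    proof (rule C1_joinpaths[OF C1[OF c] C2[OF c]])
      fix t assume t: "t \<in> ({0..1} - S) \<inter> p -` chart_dom c"
      show "2 * t \<in> ({0..1} - S1) \<inter> p1 -` chart_dom c" if "t < 1 / 2"
        using left[of t] pl[of t] t that by auto
      show "1 / 2 < t \<and> 2 * t - 1 \<in> ({0..1} - S2) \<inter> p2 -` chart_dom c" if "\<not> t < 1 / 2"
        using right[of t] pr[of t] t that by auto
    qed (simp_all add: pl pr)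
  qed
  moreover have "pathstart p = x" "pathfinish p = z" using p1 p2 by (simp_all add: p_def)
  moreover have "speed A g p t \<le> 2 * max B1 B2" if t: "t \<in> {0..1} - S" for t
  proof (cases "t < 1 / 2")
    case True
    let ?c = "chart_at A (p t)"
    have s: "2 * t \<in> {0..1} - (S1 \<union> R1)" using left t True by blast
    have dom: "p1 (2 * t) \<in> chart_dom ?c" using chart_at(2)[of "p t"] by (simp add: pl[OF True])
    then obtain v where v: "((chart_map ?c \<circ> p1) has_vector_derivative v) (at (2 * t))"
      using C1[OF chart_at(1)] s unfolding C1_differentiable_on_def by blast
    have "((chart_map ?c \<circ> p1 \<circ> (\<lambda>t. 2 * t)) has_vector_derivative 2 *\<^sub>R v) (at t)"
      by (rule vector_diff_chain_at[OF has_vector_derivative_double(1) v])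
    then have v2: "((chart_map ?c \<circ> p) has_vector_derivative 2 *\<^sub>R v) (at t)"
      by (rule has_vector_derivative_transform_within_open[where S = "{..<1/2}"]) (use True in \<open>auto simp: pl\<close>)
    have "speed A g p t = 2 * speed A g p1 (2 * t)"
      using tnorm_scaleR[of ?c "chart_map ?c (p t)" 2 v]
      unfolding speed_def Let_def tnorm_def vector_derivative_at[OF v2] pl[OF True, symmetric] vector_derivative_at[OF v]
      by simp
    also have "\<dots> \<le> 2 * B1" using B1 s by auto
    finally show ?thesis by simp
  next
    case False
    let ?c = "chart_at A (p t)"
    have r: "1 / 2 < t" and s: "2 * t - 1 \<in> {0..1} - (S2 \<union> R2)" using right t False by blast+
    have dom: "p2 (2 * t - 1) \<in> chart_dom ?c" using chart_at(2)[of "p t"] by (simp add: pr[OF r])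
    then obtain v where v: "((chart_map ?c \<circ> p2) has_vector_derivative v) (at (2 * t - 1))"
      using C2[OF chart_at(1)] s unfolding C1_differentiable_on_def by blast
    have "((chart_map ?c \<circ> p2 \<circ> (\<lambda>t. 2 * t - 1)) has_vector_derivative 2 *\<^sub>R v) (at t)"
      by (rule vector_diff_chain_at[OF has_vector_derivative_double(2) v])
    then have v2: "((chart_map ?c \<circ> p) has_vector_derivative 2 *\<^sub>R v) (at t)"
      by (rule has_vector_derivative_transform_within_open[where S = "{1/2<..}"]) (use r in \<open>auto simp: pr\<close>)
    have "speed A g p t = 2 * speed A g p2 (2 * t - 1)"
      using tnorm_scaleR[of ?c "chart_map ?c (p t)" 2 v]
      unfolding speed_def Let_def tnorm_def vector_derivative_at[OF v2] pr[OF r, symmetric] vector_derivative_at[OF v]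
      by simp
    also have "\<dots> \<le> 2 * B2" using B2 s by auto
    finally show ?thesis by simp
  qed
  ultimately show ?thesis
    unfolding reach_def using \<open>finite S\<close> by blast
qed

lemma reach_nbhd:
  "\<exists>N C. open N \<and> x \<in> N \<and> 0 < C \<and> (\<forall>y\<in>N. \<forall>y'\<in>N. reach C y y')"
proof -
  define c where "c = chart_at A x"
  have c: "c \<in> A" "x \<in> chart_dom c" using chart_at by (auto simp: c_def)
  obtain r where r: "0 < r" "cball (chart_map c x) r \<subseteq> chart_map c ` chart_dom c"
    using chart_ball[OF c open_UNIV UNIV_I] by blast
  obtain C where C: "0 < C" and R0: "\<forall>y\<in>chart_dom c. \<forall>y'\<in>chart_dom c. chart_map c y \<in> ball (chart_map c x) r \<longrightarrow>
    chart_map c y' \<in> ball (chart_map c x) r \<longrightarrow> reach (C * norm (chart_map c y - chart_map c y')) y y'"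
    using reach_local[OF c(1) r] by (elim exE conjE)
  note R = R0[rule_format]
  define N where "N = {y \<in> chart_dom c. chart_map c y \<in> ball (chart_map c x) r}"
  show ?thesis
  proof (intro exI[of _ N] exI[of _ "C * (2 * r)"] conjI ballI)
    show "open N" unfolding N_def by (rule open_chart_preimage[OF c(1) open_ball])
    show "x \<in> N" using c r by (simp add: N_def)
    show "0 < C * (2 * r)" using C r by simp
    fix y y' assume "y \<in> N" "y' \<in> N"
    then have y: "y \<in> chart_dom c" "chart_map c y \<in> ball (chart_map c x) r"
      and y': "y' \<in> chart_dom c" "chart_map c y' \<in> ball (chart_map c x) r"
      by (simp_all add: N_def)
    have "dist (chart_map c y) (chart_map c y') \<le> dist (chart_map c x) (chart_map c y) + dist (chart_map c x) (chart_map c y')"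
      by (rule dist_triangle3)
    also have "\<dots> \<le> 2 * r" using y(2) y'(2) by simp
    finally have "C * norm (chart_map c y - chart_map c y') \<le> C * (2 * r)"
      using C by (simp add: dist_norm)
    then show "reach (C * (2 * r)) y y'"
      by (rule reach_mono[OF R[OF y(1) y'(1) y(2) y'(2)]])
  qed
qed

text \<open>Equivalence classes are open by \<open>reach_nbhd\<close>, so connectedness leaves only
  one. Asking for curves in both directions makes the relation symmetric by its form.\<close>

lemma reach_connected:
  assumes "connected (UNIV :: 'a set)"
  shows "\<exists>B. reach B x y \<and> reach B y x"
proof (rule connected_equivalence_relation[OF assms(1), where R = "\<lambda>x y. \<exists>B. reach B x y \<and> reach B y x"])
  fix x y z assume "\<exists>B. reach B x y \<and> reach B y x" "\<exists>B. reach B y z \<and> reach B z y"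
  then obtain B B' where "reach B x y" "reach B y x" "reach B' y z" "reach B' z y" by blast
  then have "reach (2 * max B B') x z" "reach (2 * max B' B) z x" by (auto intro: reach_trans)
  then show "\<exists>B. reach B x z \<and> reach B z x" by (metis max.commute)
next
  fix a
  obtain N C where N: "open N" "a \<in> N" and R: "\<forall>y\<in>N. \<forall>y'\<in>N. reach C y y'"
    using reach_nbhd[of a] by blast
  show "\<exists>T. openin (top_of_set UNIV) T \<and> a \<in> T \<and> (\<forall>x\<in>T. \<exists>B. reach B a x \<and> reach B x a)"
  proof (intro exI[of _ N] conjI ballI)
    show "\<exists>B. reach B a x \<and> reach B x a" if "x \<in> N" for x
      using R N(2) that by blast
  qed (use N in auto)
qed auto

text \<open>Finitely many neighbourhoods from \<open>reach_nbhd\<close> cover the manifold; any two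
  points are joined through the centres of the neighbourhoods that contain them.\<close>

lemma riem_dist_bounded:
  assumes "compact (UNIV :: 'a set)" "connected (UNIV :: 'a set)"
  obtains D where "0 < D" "\<And>x y. riem_dist A g x y \<le> D"
proof -
  obtain N C where N: "\<And>x. open (N x)" "\<And>x. x \<in> N x" and C: "\<And>x. (0::real) < C x"
    and R: "\<And>x y y'. y \<in> N x \<Longrightarrow> y' \<in> N x \<Longrightarrow> reach (C x) y y'"
    using reach_nbhd by metis
  obtain F where "finite F" "UNIV \<subseteq> (\<Union>x\<in>F. N x)"
    by (rule compactE_image[OF assms(1), of UNIV N]) (use N in auto)
  then have F: "finite F" "(\<Union>x\<in>F. N x) = UNIV" by auto
  obtain B where B: "\<And>x y. reach (B x y) x y"
    using reach_connected[OF assms(2)] by metis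
  \<comment> \<open>The sum over all pairs dominates each pair, the factor 4 accounts for two
    concatenations, and the summand 1 ensures positivity.\<close>
  define D where "D = 1 + (\<Sum>x\<in>F. \<Sum>y\<in>F. 4 * (C x + \<bar>B x y\<bar> + C y))"
  have nonneg: "0 \<le> 4 * (C x + \<bar>B x y\<bar> + C y)" for x y
    using C[of x] C[of y] by simp
  have "riem_dist A g y y' \<le> D" for y y'
  proof -
    obtain x x' where x: "x \<in> F" "y \<in> N x" "x' \<in> F" "y' \<in> N x'" using F by blast
    have "reach (2 * max (C x) (2 * max (B x x') (C x'))) y y'"
      using R[OF x(2) N(2)] B[of x x'] R[OF N(2) x(4)] by (blast intro: reach_trans)
    then have "riem_dist A g y y' \<le> 2 * max (C x) (2 * max (B x x') (C x'))"
      using C[of x] by (intro riem_dist_le_if_reach) auto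
    also have "\<dots> \<le> 4 * (C x + \<bar>B x x'\<bar> + C x')" using C[of x] C[of x'] by (simp add: max_def)
    also have "\<dots> \<le> (\<Sum>y\<in>F. 4 * (C x + \<bar>B x y\<bar> + C y))"
      by (rule member_le_sum[of x' F "\<lambda>y. 4 * (C x + \<bar>B x y\<bar> + C y)", OF x(3) nonneg F(1)])
    also have "\<dots> \<le> (\<Sum>x\<in>F. \<Sum>y\<in>F. 4 * (C x + \<bar>B x y\<bar> + C y))"
      by (rule member_le_sum[of x F "\<lambda>x. \<Sum>y\<in>F. 4 * (C x + \<bar>B x y\<bar> + C y)", OF x(1) sum_nonneg[OF nonneg] F(1)])
    finally show ?thesis by (simp add: D_def)
  qed
  moreover have "0 < D"
  proof -
    have "0 \<le> (\<Sum>x\<in>F. \<Sum>y\<in>F. 4 * (C x + \<bar>B x y\<bar> + C y))"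
      by (intro sum_nonneg nonneg)
    then show ?thesis unfolding D_def by linarith
  qed
  ultimately show thesis by (intro that)
qed

end

text \<open>Bridges the gauge integral of the fundamental theorem of calculus and the nonnegative
  integral that defines length. If the right side is finite, f is Lebesgue integrable and the
  integrals agree; otherwise the bound is trivial.\<close>

lemma norm_has_integral_le_nn_integral:
  fixes f :: "real \<Rightarrow> 'b::euclidean_space"
  assumes I: "(f has_integral I) {a..b}" and f: "f \<in> borel_measurable borel"
    and zero: "\<And>t. t \<notin> {a..b} \<Longrightarrow> f t = 0"
  shows "ennreal (norm I) \<le> (\<integral>\<^sup>+t. ennreal (norm (f t)) \<partial>lborel)"
proof (cases "(\<integral>\<^sup>+t. ennreal (norm (f t)) \<partial>lborel) = \<infinity>")
  case False
  then have int: "integrable lborel f"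
    using f by (intro integrableI_bounded) (auto simp: less_top)
  have "(f has_integral (\<integral>t. f t \<partial>lborel)) UNIV"
    using int by (rule has_integral_integral_lborel)
  moreover have "(f has_integral I) UNIV"
    using has_integral_on_superset[OF I _ subset_UNIV] zero by blast
  ultimately have "I = (\<integral>t. f t \<partial>lborel)" by (metis has_integral_unique)
  then show ?thesis using integral_norm_bound_ennreal[OF int] by simp
qed simp

section \<open>Lower bounds for lengths and for the Riemannian distance\<close>

context riemannian
begin

text \<open>As long as the curve stays in the chart, its coordinate displacement is the integral of
  the coordinate velocity, and m compares the Euclidean norm of that velocity with the Riemannian
  speed.\<close>

lemma curve_length_ge:
  assumes \<gamma>: "piecewise_C1_curve A \<gamma>" and c: "c \<in> A" and t1: "0 \<le> t1" "t1 \<le> 1" and "0 < m"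
    and dom: "\<And>t. t \<in> {0..t1} \<Longrightarrow> \<gamma> t \<in> chart_dom c"
    and m: "\<And>t v. t \<in> {0..t1} \<Longrightarrow> m * norm v \<le> tnorm c (chart_map c (\<gamma> t)) v"
  shows "ennreal (m * norm (chart_map c (\<gamma> t1) - chart_map c (\<gamma> 0))) \<le> curve_length A g \<gamma>"
proof -
  obtain S where S: "finite S" and S0: "\<forall>c\<in>A. (chart_map c \<circ> \<gamma>) C1_differentiable_on (({0..1} - S) \<inter> \<gamma> -` chart_dom c) \<and>
       open ({0<..<1} \<inter> \<gamma> -` chart_dom c)"
    using piecewise_C1_curve_interior[OF \<gamma>] by (elim exE conjE)
  have "(chart_map c \<circ> \<gamma>) C1_differentiable_on (({0..1} - S) \<inter> \<gamma> -` chart_dom c)"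
    and op: "open ({0<..<1} \<inter> \<gamma> -` chart_dom c)" using S0 c by blast+
  then obtain D where D: "\<And>t. t \<in> ({0..1} - S) \<inter> \<gamma> -` chart_dom c \<Longrightarrow> ((chart_map c \<circ> \<gamma>) has_vector_derivative D t) (at t)"
    and contD: "continuous_on (({0..1} - S) \<inter> \<gamma> -` chart_dom c) D"
    unfolding C1_differentiable_on_def by blast
  define J where "J = {0<..<t1} - S"
  have J: "J \<subseteq> ({0..1} - S) \<inter> \<gamma> -` chart_dom c" "J \<subseteq> {0<..<1} \<inter> \<gamma> -` chart_dom c"
    using t1 dom by (auto simp: J_def)
  have "open J" unfolding J_def using S by (intro open_Diff open_greaterThanLessThan finite_imp_closed)
  \<comment> \<open>The velocity is cut off to an open set on which it is continuous, which makes it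
    Borel measurable; only finitely many points of (0, t1) are lost.\<close>
  define f where "f t = indicator J t *\<^sub>R D t" for t
  have f_meas: "f \<in> borel_measurable borel"
    unfolding f_def using \<open>open J\<close> continuous_on_subset[OF contD J(1)]
    by (intro borel_measurable_continuous_on_indicator) auto
  have vd: "((chart_map c \<circ> \<gamma>) has_vector_derivative f t) (at t)" if "t \<in> {0<..<t1} - S" for t
  proof -
    have "t \<in> J" using that by (simp add: J_def)
    then show ?thesis using D[OF subsetD[OF J(1)]] by (simp add: f_def)
  qed
  have cont: "continuous_on {0..t1} (chart_map c \<circ> \<gamma>)"
  proof (rule continuous_on_compose)
    have "continuous_on {0..1} \<gamma>"
      using \<gamma> unfolding piecewise_C1_curve_def path_def by blast
    then show "continuous_on {0..t1} \<gamma>" by (rule continuous_on_subset) (use t1 in auto)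
    show "continuous_on (\<gamma> ` {0..t1}) (chart_map c)"
      by (rule continuous_on_subset[OF continuous_chart_map[OF c]]) (use dom in blast)
  qed
  have "(f has_integral (chart_map c \<circ> \<gamma>) t1 - (chart_map c \<circ> \<gamma>) 0) {0..t1}"
    by (rule fundamental_theorem_of_calculus_interior_strong[OF S t1(1) vd cont])
  then have "ennreal (norm ((chart_map c \<circ> \<gamma>) t1 - (chart_map c \<circ> \<gamma>) 0)) \<le> (\<integral>\<^sup>+t. ennreal (norm (f t)) \<partial>lborel)"
    using f_meas by (rule norm_has_integral_le_nn_integral) (auto simp: f_def J_def)
  then have "ennreal m * ennreal (norm (chart_map c (\<gamma> t1) - chart_map c (\<gamma> 0)))
      \<le> ennreal m * (\<integral>\<^sup>+t. ennreal (norm (f t)) \<partial>lborel)"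
    by (simp add: mult_left_mono)
  also have "\<dots> = (\<integral>\<^sup>+t. ennreal m * ennreal (norm (f t)) \<partial>lborel)"
    using f_meas by (intro nn_integral_cmult[symmetric]) auto
  also have "\<dots> \<le> curve_length A g \<gamma>"
    unfolding curve_length_def
  proof (rule nn_integral_mono)
    fix t
    show "ennreal m * ennreal (norm (f t)) \<le> ennreal (speed A g \<gamma> t) * indicator {0..1} t"
    proof (cases "t \<in> J")
      case True
      have "speed A g \<gamma> t = tnorm c (chart_map c (\<gamma> t)) (D t)"
        by (rule speed_eq[OF c op subsetD[OF J(2) True] _ D[OF subsetD[OF J(1) True]]]) simp
      moreover have "t \<in> {0..t1}" "t \<in> {0..1}" using True t1 by (auto simp: J_def)
      ultimately show ?thesis
        using m[of t "D t"] \<open>0 < m\<close> True by (simp add: f_def ennreal_mult[symmetric] ennreal_leI)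
    qed (simp add: f_def)
  qed
  finally show ?thesis using \<open>0 < m\<close> by (simp add: ennreal_mult)
qed

text \<open>A curve that stays in the coordinate ball pays for its whole displacement; one that
  leaves it pays at least r up to the first exit.\<close>

lemma curve_length_ge_exit:
  assumes \<gamma>: "piecewise_C1_curve A \<gamma>" and c: "c \<in> A" and x: "pathstart \<gamma> = x" "x \<in> chart_dom c"
    and r: "0 < r" "cball (chart_map c x) r \<subseteq> chart_map c ` chart_dom c" and "0 < m"
    and m: "\<And>u v. u \<in> cball (chart_map c x) r \<Longrightarrow> m * norm v \<le> tnorm c u v"
    and y: "pathfinish \<gamma> = y"
  shows "ennreal (m * (if y \<in> chart_dom c \<and> chart_map c y \<in> ball (chart_map c x) r
      then norm (chart_map c y - chart_map c x) else r)) \<le> curve_length A g \<gamma>"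
proof -
  define V where "V = {y \<in> chart_dom c. chart_map c y \<in> ball (chart_map c x) r}"
  \<comment> \<open>Compact, hence closed in the Hausdorff space: it therefore still contains the
    exit point, which keeps that point inside the chart.\<close>
  define W where "W = chart_inv c ` cball (chart_map c x) r"
  have \<gamma>01: "\<gamma> 0 = x" "\<gamma> 1 = y" using x y by (auto simp: pathstart_def pathfinish_def)
  have cont: "continuous_on {0..1} \<gamma>"
    using \<gamma> unfolding piecewise_C1_curve_def path_def by blast
  have "open V" unfolding V_def by (rule open_chart_preimage[OF c open_ball])
  have W: "z \<in> chart_dom c \<and> chart_map c z \<in> cball (chart_map c x) r" if "z \<in> W" for z
    using that r(2) chart_inv_in[OF c] chart_map_inv[OF c] by (force simp: W_def)
  have VW: "V \<subseteq> W"
  proof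
    fix z assume "z \<in> V"
    then show "z \<in> W" unfolding W_def using chart_inv_map[OF c, of z]
      by (intro image_eqI[of _ _ "chart_map c z"]) (auto simp: V_def)
  qed
  have "compact W"
    unfolding W_def by (intro compact_continuous_image continuous_on_subset[OF continuous_chart_inv[OF c] r(2)] compact_cball)
  then have "closed W" by (rule compact_imp_closed)
  have bound: "ennreal (m * norm (chart_map c (\<gamma> t1) - chart_map c x)) \<le> curve_length A g \<gamma>"
    if "0 \<le> t1" "t1 \<le> 1" "\<And>t. t \<in> {0..t1} \<Longrightarrow> \<gamma> t \<in> W" for t1
    using curve_length_ge[OF \<gamma> c that(1,2) \<open>0 < m\<close>] W[OF that(3)] m by (simp add: \<gamma>01)
  show ?thesis
  proof (cases "\<forall>t\<in>{0..1}. \<gamma> t \<in> V")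
    case True
    then have "y \<in> V" using \<gamma>01 by force
    have "\<gamma> t \<in> W" if "t \<in> {0..1}" for t using True VW that by blast
    then have "ennreal (m * norm (chart_map c y - chart_map c x)) \<le> curve_length A g \<gamma>"
      using bound[of 1] by (simp add: \<gamma>01)
    then show ?thesis using \<open>y \<in> V\<close> by (simp add: V_def)
  next
    case False
    define Z where "Z = {0..1} \<inter> \<gamma> -` (- V)"
    have "closed Z" unfolding Z_def using \<open>open V\<close> by (intro continuous_closed_preimage cont) auto
    have "Z \<noteq> {}" using False by (auto simp: Z_def)
    have "bdd_below Z" by (auto simp: Z_def intro: bdd_belowI[of _ 0])
    \<comment> \<open>The first exit time from V. It belongs to Z because Z is closed, and all
      earlier points of the curve lie in V.\<close>
    define t1 where "t1 = Inf Z"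
    have "t1 \<in> Z" unfolding t1_def by (rule closed_contains_Inf[OF \<open>Z \<noteq> {}\<close> \<open>bdd_below Z\<close> \<open>closed Z\<close>])
    then have t1: "0 \<le> t1" "t1 \<le> 1" "\<gamma> t1 \<notin> V" by (auto simp: Z_def)
    have "x \<in> V" using x r by (simp add: V_def)
    then have "t1 \<noteq> 0" using t1 \<gamma>01 by auto
    then have "0 < t1" using t1 by simp
    have before: "\<gamma> t \<in> V" if "t \<in> {0..<t1}" for t
    proof (rule ccontr)
      assume "\<gamma> t \<notin> V"
      then have "t \<in> Z" using that t1 by (auto simp: Z_def)
      then have "t1 \<le> t" unfolding t1_def by (rule cInf_lower[OF _ \<open>bdd_below Z\<close>])
      then show False using that by simp
    qed
    have "closed ({0..1} \<inter> \<gamma> -` W)" using \<open>closed W\<close> by (intro continuous_closed_preimage cont) auto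
    moreover have "{0..<t1} \<subseteq> {0..1} \<inter> \<gamma> -` W"
    proof
      fix t assume t: "t \<in> {0..<t1}"
      then have "\<gamma> t \<in> W" using before VW by blast
      then show "t \<in> {0..1} \<inter> \<gamma> -` W" using t t1 by simp
    qed
    ultimately have "closure {0..<t1} \<subseteq> {0..1} \<inter> \<gamma> -` W" by (rule closure_minimal[rotated])
    then have inW: "\<gamma> t \<in> W" if "t \<in> {0..t1}" for t
      using that closure_atLeastLessThan[OF \<open>0 < t1\<close>] by auto
    have "\<gamma> t1 \<in> W" using inW t1 by simp
    then have "r \<le> norm (chart_map c (\<gamma> t1) - chart_map c x)"
      using W[of "\<gamma> t1"] t1(3) by (auto simp: V_def dist_norm norm_minus_commute)
    moreover have "(if y \<in> chart_dom c \<and> chart_map c y \<in> ball (chart_map c x) r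
      then norm (chart_map c y - chart_map c x) else r) \<le> r"
      by (auto simp: dist_norm norm_minus_commute)
    ultimately have "m * (if y \<in> chart_dom c \<and> chart_map c y \<in> ball (chart_map c x) r
      then norm (chart_map c y - chart_map c x) else r) \<le> m * norm (chart_map c (\<gamma> t1) - chart_map c x)"
      using \<open>0 < m\<close> by (intro mult_left_mono) linarith+
    then show ?thesis
      using bound[OF t1(1,2) inW] by (meson ennreal_leI order_trans)
  qed
qed

text \<open>The bound holds for every connecting curve and so for the infimum. It survives the
  conversion to \<open>real\<close> because connectedness makes the infimum finite.\<close>

lemma riem_dist_ge:
  assumes conn: "connected (UNIV :: 'a set)" and c: "c \<in> A" and x: "x \<in> chart_dom c"
    and r: "0 < r" "cball (chart_map c x) r \<subseteq> chart_map c ` chart_dom c"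
  shows "\<exists>m>0. \<forall>y. m * (if y \<in> chart_dom c \<and> chart_map c y \<in> ball (chart_map c x) r
      then norm (chart_map c y - chart_map c x) else r) \<le> riem_dist A g x y"
proof -
  obtain m C where "0 < m" and m: "\<And>u v. u \<in> cball (chart_map c x) r \<Longrightarrow> m * norm v \<le> tnorm c u v"
    using tnorm_bounds[OF c compact_cball r(2)] by metis
  show ?thesis
  proof (intro exI[of _ m] conjI allI \<open>0 < m\<close>)
    fix y
    let ?L = "m * (if y \<in> chart_dom c \<and> chart_map c y \<in> ball (chart_map c x) r
      then norm (chart_map c y - chart_map c x) else r)"
    let ?I = "INF \<gamma> \<in> {\<gamma>. piecewise_C1_curve A \<gamma> \<and> pathstart \<gamma> = x \<and> pathfinish \<gamma> = y}. curve_length A g \<gamma>"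
    have le: "ennreal ?L \<le> ?I"
    proof (rule INF_greatest)
      fix \<gamma> assume "\<gamma> \<in> {\<gamma>. piecewise_C1_curve A \<gamma> \<and> pathstart \<gamma> = x \<and> pathfinish \<gamma> = y}"
      then have \<gamma>: "piecewise_C1_curve A \<gamma>" "pathstart \<gamma> = x" "pathfinish \<gamma> = y" by simp_all
      show "ennreal ?L \<le> curve_length A g \<gamma>"
        by (rule curve_length_ge_exit[OF \<gamma>(1) c \<gamma>(2) x r \<open>0 < m\<close> m \<gamma>(3)])
    qed
    \<comment> \<open>The value of \<open>enn2real\<close> at infinity is 0, so monotonicity of the
      conversion requires finiteness.\<close>
    have fin: "?I < top"
    proof -
      obtain B where "reach B x y" using reach_connected[OF conn] by blast
      then have "reach (max B 0) x y" by (rule reach_mono) simp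
      then obtain \<gamma> where "piecewise_C1_curve A \<gamma>" "pathstart \<gamma> = x" "pathfinish \<gamma> = y"
        "curve_length A g \<gamma> \<le> ennreal (max B 0)"
        using curve_length_le_if_reach by blast
      then have "?I \<le> ennreal (max B 0)" by (intro INF_lower2[of \<gamma>]) auto
      then show ?thesis by (rule order_le_less_trans[OF _ ennreal_less_top])
    qed
    have "0 \<le> ?L" using \<open>0 < m\<close> r by simp
    then show "?L \<le> riem_dist A g x y"
      using enn2real_mono[OF le fin] unfolding riem_dist_def by (simp only: enn2real_ennreal)
  qed
qed

lemma riem_dist_less_imp_mem:
  assumes conn: "connected (UNIV :: 'a set)" and "open N" "x \<in> N"
  shows "\<exists>\<delta>>0. \<forall>y. riem_dist A g x y < \<delta> \<longrightarrow> y \<in> N"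
proof -
  define c where "c = chart_at A x"
  have c: "c \<in> A" "x \<in> chart_dom c" using chart_at by (auto simp: c_def)
  obtain r where r: "0 < r" "cball (chart_map c x) r \<subseteq> chart_map c ` chart_dom c"
    and N: "\<forall>y\<in>chart_dom c. chart_map c y \<in> cball (chart_map c x) r \<longrightarrow> y \<in> N"
    using chart_ball[OF c assms(2,3)] by blast
  obtain m where "0 < m" and m: "\<forall>y. m * (if y \<in> chart_dom c \<and> chart_map c y \<in> ball (chart_map c x) r
      then norm (chart_map c y - chart_map c x) else r) \<le> riem_dist A g x y"
    using riem_dist_ge[OF conn c r] by (elim exE conjE)
  show ?thesis
  proof (intro exI[of _ "m * r"] conjI allI impI)
    show "0 < m * r" using \<open>0 < m\<close> r by simp
    fix y assume y: "riem_dist A g x y < m * r"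
    have "y \<in> chart_dom c \<and> chart_map c y \<in> ball (chart_map c x) r"
    proof (rule ccontr)
      assume "\<not> ?thesis"
      then have "m * r \<le> riem_dist A g x y" using spec[OF m, of y] by (simp only: if_False)
      then show False using y by simp
    qed
    then show "y \<in> N" using N by auto
  qed
qed

end

section \<open>Expanding maps of a manifold\<close>

context riemannian
begin

lemma det_metric_transition:
  assumes "c \<in> A" "d \<in> A" "u \<in> local_dom c d id"
  shows "sqrt (det (g c u)) = \<bar>det (jacobian (local_rep c d id) (at u))\<bar> * sqrt (det (g d (local_rep c d id u)))"
proof -
  let ?J = "jacobian (local_rep c d id) (at u)" and ?G = "g d (local_rep c d id u)"
  have "det (g c u) = det (transpose ?J ** ?G ** ?J)"
    by (rule arg_cong[OF metric_transition[OF assms]])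
  also have "\<dots> = (det ?J)\<^sup>2 * det ?G"
    by (simp add: det_mul det_transpose power2_eq_square)
  finally show ?thesis by (simp add: real_sqrt_mult)
qed

lemma local_dom_inv:
  assumes "c \<in> A" "u \<in> local_dom c d F"
  shows "u \<in> chart_map c ` chart_dom c" "chart_inv c u \<in> chart_dom c" "F (chart_inv c u) \<in> chart_dom d"
    "chart_map c (chart_inv c u) = u"
  using assms(2) chart_inv_in[OF assms(1)] chart_map_inv[OF assms(1)] by (auto simp: local_dom_eq[OF assms(1)])

lemma jacobian_transition_invertible:
  assumes "c \<in> A" "d \<in> A" "u \<in> local_dom c d id"
  shows "det (jacobian (local_rep c d id) (at u)) \<noteq> 0"
proof
  assume "det (jacobian (local_rep c d id) (at u)) = 0"
  then have "sqrt (det (g c u)) = 0" using det_metric_transition[OF assms] by simp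
  then show False using det_metric_pos[OF assms(1) local_dom_inv(1)[OF assms(1,3)]] by simp
qed

end

section \<open>Local injectivity and nonvanishing Jacobian from the matching of fibres\<close>

locale expanding_map = riemannian A g
  for A :: "('a::{second_countable_topology,t2_space}, 'n::finite) chart set"
    and g :: "('a, 'n) metric_tensor" +
  fixes T :: "'a \<Rightarrow> 'a" and l :: real
  assumes compact_UNIV: "compact (UNIV :: 'a set)" and connected_UNIV: "connected (UNIV :: 'a set)"
    and C1_T: "C1_map A T"
    and l_gt_1: "1 < l"
    and finite_fibre: "finite (T -` {x})" and fibre_nonempty: "T -` {x} \<noteq> {}"
    and fibre_matching: "\<exists>b. bij_betw b (T -` {x}) (T -` {y}) \<and>
      (\<forall>z\<in>T -` {x}. riem_dist A g z (b z) \<le> riem_dist A g x y / l)"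
begin

abbreviation dst :: "'a \<Rightarrow> 'a \<Rightarrow> real" where
  "dst \<equiv> riem_dist A g"

lemma continuous_T: "continuous_on UNIV T"
  using C1_T unfolding C1_map_def by blast

lemma Ck_T: "c \<in> A \<Longrightarrow> d \<in> A \<Longrightarrow> Ck_on (Suc 0) (local_dom c d T) (local_rep c d T)"
  using C1_T unfolding C1_map_def One_nat_def by blast

lemma open_T_dom: "c \<in> A \<Longrightarrow> d \<in> A \<Longrightarrow> open (local_dom c d T)"
  by (rule open_local_dom[OF _ _ continuous_T])

lemma has_derivative_T:
  assumes "c \<in> A" "d \<in> A" "u \<in> local_dom c d T"
  shows "(local_rep c d T has_derivative (\<lambda>v. jacobian (local_rep c d T) (at u) *v v)) (at u)"
  by (rule Ck_on_has_derivative_jacobian[OF Ck_T open_T_dom]) fact+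

lemma open_vimage_T: "open V \<Longrightarrow> open (T -` V)"
  using continuous_T by (simp add: open_vimage)

text \<open>The other points of the fibre of \<open>T x\<close> are too far from \<open>x\<close> to be matched with a point near \<open>x\<close>.\<close>

lemma branch_through:
  "\<exists>N. open N \<and> x \<in> N \<and> (\<forall>u\<in>N. \<forall>b. bij_betw b (T -` {T x}) (T -` {T u}) \<longrightarrow>
     (\<forall>z\<in>T -` {T x}. dst z (b z) \<le> dst (T x) (T u) / l) \<longrightarrow> b x = u)"
proof -
  define P where "P = T -` {T x} - {x}"
  have "finite P" using finite_fibre by (simp add: P_def)
  have "\<forall>x'\<in>P. \<exists>N \<delta>. open N \<and> x \<in> N \<and> 0 < \<delta> \<and> (\<forall>u. dst x' u < \<delta> \<longrightarrow> u \<notin> N)"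
  proof
    fix x' assume "x' \<in> P"
    then have "x \<noteq> x'" by (auto simp: P_def)
    then obtain N N' where N: "open N" "open N'" "x \<in> N" "x' \<in> N'" "N \<inter> N' = {}"
      using hausdorff by metis
    obtain \<delta> where "0 < \<delta>" "\<forall>u. dst x' u < \<delta> \<longrightarrow> u \<in> N'"
      using riem_dist_less_imp_mem[OF connected_UNIV N(2,4)] by blast
    then show "\<exists>N \<delta>. open N \<and> x \<in> N \<and> 0 < \<delta> \<and> (\<forall>u. dst x' u < \<delta> \<longrightarrow> u \<notin> N)"
      using N by (intro exI[of _ N] exI[of _ \<delta>]) auto
  qed
  then obtain N \<delta> where N: "\<forall>x'\<in>P. open (N x') \<and> x \<in> N x' \<and> (0::real) < \<delta> x' \<and> (\<forall>u. dst x' u < \<delta> x' \<longrightarrow> u \<notin> N x')"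
    by metis
  have Psmall: "\<exists>e>0. \<forall>x'\<in>P. e \<le> \<delta> x'"
  proof (cases "P = {}")
    case False
    then show ?thesis
      using \<open>finite P\<close> N by (intro exI[of _ "Min (\<delta> ` P)"]) auto
  qed (auto intro: exI[of _ 1])
  then obtain e where e: "0 < e" "\<forall>x'\<in>P. e \<le> \<delta> x'" by blast
  obtain V where V: "open V" "T x \<in> V" "\<forall>y\<in>V. dst (T x) y < e"
    using riem_dist_small[OF e(1), of "T x"] by blast
  define M where "M = T -` V \<inter> (\<Inter>x'\<in>P. N x')"
  have "open M"
    unfolding M_def using N V(1) \<open>finite P\<close> by (intro open_Int open_vimage_T open_INT) auto
  moreover have "x \<in> M" using N V(2) by (simp add: M_def)
  moreover have "b x = u"
    if u: "u \<in> M" and b: "bij_betw b (T -` {T x}) (T -` {T u})"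
      and db: "\<forall>z\<in>T -` {T x}. dst z (b z) \<le> dst (T x) (T u) / l" for u b
  proof -
    have "u \<in> b ` (T -` {T x})" using bij_betw_imp_surj_on[OF b] by simp
    then obtain x' where x': "x' \<in> T -` {T x}" "u = b x'" by blast
    have "x' = x"
    proof (rule ccontr)
      assume "x' \<noteq> x"
      then have P: "x' \<in> P" using x' by (simp add: P_def)
      have "dst x' u \<le> dst (T x) (T u) / l" using db x' by simp
      also have "\<dots> \<le> dst (T x) (T u)"
        using l_gt_1 riem_dist_nonneg[of "T x" "T u"] by (simp add: divide_le_eq mult_le_cancel_left1)
      also have "\<dots> < e" using V(3) u by (simp add: M_def)
      also have "e \<le> \<delta> x'" using e(2) P by blast
      finally have "u \<notin> N x'" using N P by blast
      then show False using u P by (simp add: M_def)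
    qed
    then show ?thesis using x' by simp
  qed
  ultimately show ?thesis by blast
qed

text \<open>Any matching of the fibres of T x and T u sends x to u when u is near x, so its
  contraction estimate applies to the pair x, u.\<close>

lemma locally_expanding:
  "\<exists>N. open N \<and> x \<in> N \<and> (\<forall>u\<in>N. dst x u \<le> dst (T x) (T u) / l)"
proof -
  obtain N where N: "open N" "x \<in> N" and b: "\<forall>u\<in>N. \<forall>b. bij_betw b (T -` {T x}) (T -` {T u}) \<longrightarrow>
     (\<forall>z\<in>T -` {T x}. dst z (b z) \<le> dst (T x) (T u) / l) \<longrightarrow> b x = u"
    using branch_through[of x] by (elim exE conjE)
  have "dst x u \<le> dst (T x) (T u) / l" if u: "u \<in> N" for u
  proof -
    obtain b' where b': "bij_betw b' (T -` {T x}) (T -` {T u})"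
      "\<forall>z\<in>T -` {T x}. dst z (b' z) \<le> dst (T x) (T u) / l"
      using fibre_matching by blast
    then have "b' x = u" using b u by blast
    then show ?thesis using b'(2) by fastforce
  qed
  then show ?thesis using N by blast
qed

text \<open>If T u = T u', one and the same matching must send x both to u and to u'.\<close>

lemma locally_injective: "\<exists>N. open N \<and> x \<in> N \<and> inj_on T N"
proof -
  obtain N where N: "open N" "x \<in> N" and b: "\<forall>u\<in>N. \<forall>b. bij_betw b (T -` {T x}) (T -` {T u}) \<longrightarrow>
     (\<forall>z\<in>T -` {T x}. dst z (b z) \<le> dst (T x) (T u) / l) \<longrightarrow> b x = u"
    using branch_through[of x] by (elim exE conjE)
  have "inj_on T N"
  proof (rule inj_onI)
    fix u u' assume u: "u \<in> N" "u' \<in> N" "T u = T u'"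
    obtain b' where b': "bij_betw b' (T -` {T x}) (T -` {T u})"
      "\<forall>z\<in>T -` {T x}. dst z (b' z) \<le> dst (T x) (T u) / l"
      using fibre_matching by blast
    have "b' x = u" using b u(1) b' by blast
    moreover have "b' x = u'" using bspec[OF b u(2)] b' u(3) by simp
    ultimately show "u = u'" by simp
  qed
  then show ?thesis using N by blast
qed

text \<open>Along a kernel vector of the derivative the image moves by o(|w - u|) in coordinates,
  while the source distance is at least m * |w - u|. This contradicts
  \<open>locally_expanding\<close> for a sufficiently short step.\<close>

lemma jacobian_T_invertible:
  assumes c: "c \<in> A" and d: "d \<in> A" and x: "x \<in> chart_dom c" and Tx: "T x \<in> chart_dom d"
  shows "det (jacobian (local_rep c d T) (at (chart_map c x))) \<noteq> 0"
proof
  let ?u = "chart_map c x" and ?F = "local_rep c d T"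
  let ?B = "jacobian ?F (at ?u)"
  assume "det ?B = 0"
  then have "\<not> invertible ?B" by (simp add: invertible_det_nz)
  then obtain v where v: "?B *v v = 0" "v \<noteq> 0"
    unfolding invertible_left_inverse matrix_left_invertible_ker by blast
  obtain N1 where N1: "open N1" "x \<in> N1" and exp: "\<forall>u\<in>N1. dst x u \<le> dst (T x) (T u) / l"
    using locally_expanding[of x] by (elim exE conjE)
  obtain r' where r': "0 < r'" "cball (chart_map d (T x)) r' \<subseteq> chart_map d ` chart_dom d"
    using chart_ball[OF d Tx open_UNIV UNIV_I] by blast
  obtain C where C: "0 < C" and R: "\<forall>y\<in>chart_dom d. \<forall>y'\<in>chart_dom d. chart_map d y \<in> ball (chart_map d (T x)) r' \<longrightarrow>
    chart_map d y' \<in> ball (chart_map d (T x)) r' \<longrightarrow> reach (C * norm (chart_map d y - chart_map d y')) y y'"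
    using reach_local[OF d r'] by (elim exE conjE)
  define V where "V = {y \<in> chart_dom d. chart_map d y \<in> ball (chart_map d (T x)) r'}"
  have "open V" unfolding V_def by (rule open_chart_preimage[OF d open_ball])
  have "T x \<in> V" using Tx r' by (simp add: V_def)
  have "open (N1 \<inter> T -` V)" "x \<in> N1 \<inter> T -` V"
    using N1 \<open>open V\<close> \<open>T x \<in> V\<close> by (auto intro: open_vimage_T)
  then obtain r where r: "0 < r" "cball ?u r \<subseteq> chart_map c ` chart_dom c"
    and N: "\<forall>y\<in>chart_dom c. chart_map c y \<in> cball ?u r \<longrightarrow> y \<in> N1 \<inter> T -` V"
    using chart_ball[OF c x] by blast
  obtain m where "0 < m" and m: "\<forall>y. m * (if y \<in> chart_dom c \<and> chart_map c y \<in> ball ?u r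
      then norm (chart_map c y - ?u) else r) \<le> dst x y"
    using riem_dist_ge[OF connected_UNIV c x r] by (elim exE conjE)
  have u: "?u \<in> local_dom c d T" using chart_map_in_local_dom[where F = T, OF x Tx] .
  \<comment> \<open>With this tolerance for the first-order remainder the image distance is at most
    C * e = m / 2 times the coordinate displacement, below the lower bound m.\<close>
  define e where "e = m / (2 * C)"
  have "0 < e" using \<open>0 < m\<close> C by (simp add: e_def)
  then obtain \<delta> where \<delta>: "0 < \<delta>" "\<And>w. norm (w - ?u) < \<delta> \<Longrightarrow> norm (?F w - ?F ?u - ?B *v (w - ?u)) \<le> e * norm (w - ?u)"
    using has_derivative_T[OF c d u] unfolding has_derivative_at_alt by blast
  define s where "s = min r \<delta> / (2 * norm v)"
  have s: "0 < s" using r \<delta> v by (simp add: s_def)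
  define w where "w = ?u + s *\<^sub>R v"
  have wu: "w - ?u = s *\<^sub>R v" by (simp add: w_def)
  have "norm (w - ?u) = min r \<delta> / 2" using v r \<delta> by (simp add: wu s_def)
  then have nw: "norm (w - ?u) < r" "norm (w - ?u) < \<delta>" "0 < norm (w - ?u)" using r \<delta> by auto
  define y where "y = chart_inv c w"
  have w_ball: "w \<in> ball ?u r" using nw by (simp add: dist_norm norm_minus_commute)
  then have w_im: "w \<in> chart_map c ` chart_dom c" using r(2) by auto
  have y: "y \<in> chart_dom c" "chart_map c y = w"
    using chart_inv_in[OF c w_im] chart_map_inv[OF c w_im] by (simp_all add: y_def)
  have yN: "y \<in> N1" "T y \<in> V" using N y w_ball by auto
  have Fw: "?F w = chart_map d (T y)" "?F ?u = chart_map d (T x)"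
    using local_rep_chart_map[OF c y(1), of d T] local_rep_chart_map[OF c x, of d T] y(2) by simp_all
  have "?B *v (w - ?u) = 0" by (simp add: wu matrix_vector_mult_scaleR v)
  then have "norm (?F w - ?F ?u) \<le> e * norm (w - ?u)" using \<delta>(2)[OF nw(2)] by simp
  then have small: "norm (chart_map d (T x) - chart_map d (T y)) \<le> e * norm (w - ?u)"
    by (simp add: Fw norm_minus_commute)
  have "m * norm (w - ?u) \<le> dst x y" using spec[OF m, of y] y w_ball by simp
  also have "\<dots> \<le> dst (T x) (T y) / l" using exp yN by blast
  also have "\<dots> \<le> dst (T x) (T y)"
    using l_gt_1 riem_dist_nonneg[of "T x" "T y"] by (simp add: divide_le_eq mult_le_cancel_left1)
  also have "\<dots> \<le> C * norm (chart_map d (T x) - chart_map d (T y))"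
  proof (rule riem_dist_le_if_reach)
    show "reach (C * norm (chart_map d (T x) - chart_map d (T y))) (T x) (T y)"
      using R Tx yN(2) \<open>T x \<in> V\<close> by (simp add: V_def)
  qed (use C in simp)
  also have "\<dots> \<le> C * (e * norm (w - ?u))" using small C by simp
  also have "\<dots> = m / 2 * norm (w - ?u)" using C by (simp add: e_def)
  finally have "m * norm (w - ?u) \<le> m / 2 * norm (w - ?u)" .
  then show False using nw(3) \<open>0 < m\<close> by simp
qed

text \<open>The determinants of the two transition maps in the chain rule cancel against the factors
  by which the square roots of the Gram determinants transform.\<close>

lemma abs_det_D_chart:
  assumes c: "c \<in> A" and d: "d \<in> A" and x: "x \<in> chart_dom c" and Tx: "T x \<in> chart_dom d"
  shows "abs_det_D A g T x = \<bar>det (jacobian (local_rep c d T) (at (chart_map c x)))\<bar>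
      * sqrt (det (g d (chart_map d (T x)))) / sqrt (det (g c (chart_map c x)))"
proof -
  let ?c = "chart_at A x" and ?d = "chart_at A (T x)"
  let ?u = "chart_map c x" and ?F = "local_rep c d T"
  note c' = chart_at[of x] and d' = chart_at[of "T x"]
  let ?h = "local_rep c ?c id" and ?F' = "local_rep ?c ?d T" and ?k = "local_rep ?d d id"
  have u: "?u \<in> local_dom c ?c id" using chart_map_in_local_dom[of x c id ?c] x c' by simp
  have u': "chart_map ?c x \<in> local_dom ?c ?d T" using chart_map_in_local_dom[where F = T, OF c'(2) d'(2)] .
  have u'': "chart_map ?d (T x) \<in> local_dom ?d d id" using chart_map_in_local_dom[of "T x" ?d id d] Tx d' by simp
  have hu: "?h ?u = chart_map ?c x" using local_rep_chart_map[OF c x, of ?c id] by simp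
  have Fu: "?F' (chart_map ?c x) = chart_map ?d (T x)" using local_rep_chart_map[OF c'(1,2)] .
  have ku: "?k (chart_map ?d (T x)) = chart_map d (T x)" using local_rep_chart_map[OF d'(1,2), of d id] by simp
  let ?Jh = "jacobian ?h (at ?u)" and ?JF = "jacobian ?F' (at (chart_map ?c x))" and ?Jk = "jacobian ?k (at (chart_map ?d (T x)))"
  have "((?F' \<circ> ?h) has_derivative (\<lambda>v. ?JF *v v) \<circ> (\<lambda>v. ?Jh *v v)) (at ?u)"
    by (rule diff_chain_at[OF has_derivative_transition[OF c c'(1) u]])
      (simp only: hu has_derivative_T[OF c'(1) d'(1) u'])
  then have "((?k \<circ> (?F' \<circ> ?h)) has_derivative (\<lambda>v. ?Jk *v v) \<circ> ((\<lambda>v. ?JF *v v) \<circ> (\<lambda>v. ?Jh *v v))) (at ?u)"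
    by (rule diff_chain_at)
      (simp only: o_apply hu Fu has_derivative_transition[OF d'(1) d u''])
  then have der: "((?k \<circ> (?F' \<circ> ?h)) has_derivative (\<lambda>v. (?Jk ** ?JF ** ?Jh) *v v)) (at ?u)"
    by (simp only: comp_def matrix_vector_mul_assoc matrix_mul_assoc)
  \<comment> \<open>The neighbourhood of x on which the composite through the chosen charts and the
    direct coordinate expression of T are both meaningful and agree.\<close>
  define X where "X = {y \<in> chart_dom c. chart_map c y \<in> UNIV} \<inter> chart_dom ?c \<inter> T -` (chart_dom ?d \<inter> chart_dom d)"
  have "open X"
    unfolding X_def by (intro open_Int open_vimage_T open_chart_preimage[OF c] open_chart_dom c' d' d open_UNIV)
  moreover have "x \<in> X" using x Tx c' d' by (simp add: X_def)
  ultimately obtain r where r: "0 < r" "cball ?u r \<subseteq> chart_map c ` chart_dom c"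
    and N: "\<forall>y\<in>chart_dom c. chart_map c y \<in> cball ?u r \<longrightarrow> y \<in> X"
    using chart_ball[OF c x] by blast
  have eq: "(?k \<circ> (?F' \<circ> ?h)) w = ?F w" if "w \<in> ball ?u r" for w
  proof -
    have "w \<in> chart_map c ` chart_dom c" using r(2) that by auto
    then obtain y where y: "y \<in> chart_dom c" "w = chart_map c y" by blast
    then have "y \<in> X" using N that by auto
    then have "y \<in> chart_dom ?c" "T y \<in> chart_dom ?d" by (simp_all add: X_def)
    then show ?thesis
      using y local_rep_chart_map[OF c y(1)] local_rep_chart_map[OF c'(1)] local_rep_chart_map[OF d'(1)] by simp
  qed
  have "(?F has_derivative (\<lambda>v. (?Jk ** ?JF ** ?Jh) *v v)) (at ?u)"
    by (rule has_derivative_transform_within_open[OF der open_ball[of ?u r]]) (use r eq in auto)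
  moreover have "(?F has_derivative (\<lambda>v. jacobian ?F (at ?u) *v v)) (at ?u)"
    using has_derivative_T[OF c d chart_map_in_local_dom[where F = T, OF x Tx]] .
  ultimately have "(\<lambda>v. (?Jk ** ?JF ** ?Jh) *v v) = (\<lambda>v. jacobian ?F (at ?u) *v v)"
    by (rule has_derivative_unique)
  then have "jacobian ?F (at ?u) = ?Jk ** ?JF ** ?Jh"
    by (metis matrix_of_matrix_vector_mul)
  then have det: "\<bar>det (jacobian ?F (at ?u))\<bar> = \<bar>det ?Jk\<bar> * \<bar>det ?JF\<bar> * \<bar>det ?Jh\<bar>"
    by (simp add: det_mul abs_mult)
  have 1: "sqrt (det (g c ?u)) = \<bar>det ?Jh\<bar> * sqrt (det (g ?c (chart_map ?c x)))"
    using det_metric_transition[OF c c'(1) u] by (simp only: hu)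
  have 2: "sqrt (det (g ?d (chart_map ?d (T x)))) = \<bar>det ?Jk\<bar> * sqrt (det (g d (chart_map d (T x))))"
    using det_metric_transition[OF d'(1) d u''] by (simp only: ku)
  have "abs_det_D A g T x = \<bar>det ?JF\<bar> * sqrt (det (g ?d (chart_map ?d (T x)))) / sqrt (det (g ?c (chart_map ?c x)))"
    by (simp add: abs_det_D_def Let_def)
  then show ?thesis
    unfolding det 1 2 using jacobian_transition_invertible[OF c c'(1) u] by (simp add: field_simps)
qed

lemma abs_det_D_pos: "0 < abs_det_D A g T x"
proof -
  note c = chart_at[of x] and d = chart_at[of "T x"]
  have "0 < det (g (chart_at A x) (chart_map (chart_at A x) x))"
    "0 < det (g (chart_at A (T x)) (chart_map (chart_at A (T x)) (T x)))"
    using c d by (auto intro: det_metric_pos)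
  then show ?thesis
    unfolding abs_det_D_chart[OF c(1) d(1) c(2) d(2)]
    using jacobian_T_invertible[OF c(1) d(1) c(2) d(2)] by simp
qed

end

section \<open>The Riemannian volume and duality\<close>

lemma compact_finite_borel_partition:
  assumes "compact (UNIV :: 'b::topological_space set)"
    and N: "\<And>x. open (N x)" "\<And>x. x \<in> (N x :: 'b set)"
  obtains n :: nat and xs P where "\<And>i. i < n \<Longrightarrow> P i \<in> sets borel" "\<And>i. i < n \<Longrightarrow> P i \<subseteq> N (xs i)"
    "disjoint_family_on P {..<n}" "(\<Union>i<n. P i) = UNIV"
proof -
  obtain F where F: "finite F" "UNIV \<subseteq> (\<Union>x\<in>F. N x)"
    by (rule compactE_image[OF assms(1), of UNIV N]) (use N in auto)
  obtain xs where xs: "bij_betw xs {0..<card F} F"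
    using ex_bij_betw_nat_finite[OF F(1)] by blast
  define P where "P i = N (xs i) - (\<Union>j<i. N (xs j))" for i
  show thesis
  proof (rule that)
    show "P i \<in> sets borel" for i
      unfolding P_def using N(1) by (intro sets.Diff sets.finite_UN borel_open) auto
    show "P i \<subseteq> N (xs i)" for i by (auto simp: P_def)
    have "P i \<inter> P j = {}" if "i < j" for i j using that by (auto simp: P_def)
    then show "disjoint_family_on P {..<card F}"
      unfolding disjoint_family_on_def by (metis inf_commute linorder_neqE_nat)
    show "(\<Union>i<card F. P i) = UNIV"
    proof (intro equalityI subset_UNIV subsetI)
      fix x :: 'b
      obtain y where "y \<in> F" "x \<in> N y" using F(2) by blast
      then have "\<exists>i. i < card F \<and> x \<in> N (xs i)"
        using bij_betw_imp_surj_on[OF xs] by force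
      then have i: "(LEAST i. i < card F \<and> x \<in> N (xs i)) < card F \<and> x \<in> N (xs (LEAST i. i < card F \<and> x \<in> N (xs i)))"
        (is "?i < _ \<and> _")
        by (rule LeastI_ex)
      moreover have "x \<notin> N (xs j)" if "j < ?i" for j
        using not_less_Least[OF that] that i by simp
      ultimately show "x \<in> (\<Union>i<card F. P i)" unfolding P_def by blast
    qed
  qed
qed

lemma finite_sum_of_measures:
  assumes "\<And>i. i < n \<Longrightarrow> sets (N i) = sets (borel :: 'b::topological_space measure)"
  shows "\<exists>M. sets M = sets (borel :: 'b measure) \<and>
    (\<forall>B\<in>sets borel. emeasure M B = (\<Sum>i<n. emeasure (N i) B))"
proof -
  define M where "M = measure_of (UNIV :: 'b set) (sets borel) (\<lambda>B. \<Sum>i<n. emeasure (N i) B)"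
  have alg: "sigma_algebra (UNIV :: 'b set) (sets borel)"
    using sets.sigma_algebra_axioms[of "borel :: 'b measure"] by simp
  have sets_M: "sets M = sets borel"
    unfolding M_def using sets.sigma_sets_eq[of "borel :: 'b measure"] by (subst sets_measure_of) auto
  have "emeasure M B = (\<Sum>i<n. emeasure (N i) B)" if B: "B \<in> sets borel" for B
    unfolding M_def
  proof (rule emeasure_measure_of_sigma[OF alg])
    show "B \<in> sets borel" by (rule B)
    show "positive (sets borel) (\<lambda>B. \<Sum>i<n. emeasure (N i) B)"
      by (simp add: positive_def)
    show "countably_additive (sets borel) (\<lambda>B. \<Sum>i<n. emeasure (N i) B)"
    proof (rule countably_additiveI)
      fix X :: "nat \<Rightarrow> 'b set" assume X: "range X \<subseteq> sets borel" "disjoint_family X" "(\<Union>i. X i) \<in> sets borel"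
      have "(\<Sum>j. \<Sum>i<n. emeasure (N i) (X j)) = (\<Sum>i<n. \<Sum>j. emeasure (N i) (X j))"
        by (rule suminf_sum) simp
      also have "\<dots> = (\<Sum>i<n. emeasure (N i) (\<Union>j. X j))"
        using X assms by (intro sum.cong refl suminf_emeasure) auto
      finally show "(\<Sum>j. \<Sum>i<n. emeasure (N i) (X j)) = (\<Sum>i<n. emeasure (N i) (\<Union>j. X j))" .
    qed
  qed
  then show ?thesis using sets_M by blast
qed

section \<open>Coordinate measures and their gluing to the volume\<close>

context riemannian
begin

text \<open>Outside the image of the chart, where \<open>chart_inv\<close> is arbitrary, it is made constant in order to be
  Borel measurable.\<close>

definition param :: "('a, 'n) chart \<Rightarrow> real ^ 'n \<Rightarrow> 'a" where
  "param c u = (if u \<in> chart_map c ` chart_dom c then chart_inv c u else undefined)"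

definition vol_density :: "('a, 'n) chart \<Rightarrow> real ^ 'n \<Rightarrow> real" where
  "vol_density c u = indicator (chart_map c ` chart_dom c) u * sqrt (det (g c u))"

lemma param_chart_map: "c \<in> A \<Longrightarrow> x \<in> chart_dom c \<Longrightarrow> param c (chart_map c x) = x"
  by (simp add: param_def chart_inv_map)

lemma param_measurable: "c \<in> A \<Longrightarrow> param c \<in> borel_measurable borel"
  unfolding param_def
  by (intro borel_measurable_continuous_on_if borel_open open_chart_image continuous_chart_inv continuous_on_const)

lemma vol_density_measurable:
  assumes c: "c \<in> A"
  shows "vol_density c \<in> borel_measurable borel"
  unfolding vol_density_def
  using borel_measurable_continuous_on_indicator[OF borel_open[OF open_chart_image[OF c]]
    continuous_on_real_sqrt[OF continuous_on_det[OF continuous_metric[OF c]]]] by simp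

lemma vol_density_pos: "c \<in> A \<Longrightarrow> u \<in> chart_map c ` chart_dom c \<Longrightarrow> 0 < vol_density c u"
  by (simp only: vol_density_def indicator_simps mult_1 real_sqrt_gt_zero det_metric_pos)

lemma vol_density_nonneg: "c \<in> A \<Longrightarrow> 0 \<le> vol_density c u"
  using vol_density_pos[of c u] by (cases "u \<in> chart_map c ` chart_dom c") (auto simp: vol_density_def)

lemma chart_image_eq:
  assumes c: "c \<in> A" and B: "B \<subseteq> chart_dom c"
  shows "chart_map c ` B = chart_map c ` chart_dom c \<inter> param c -` B"
proof (intro equalityI subsetI)
  fix u assume "u \<in> chart_map c ` B"
  then show "u \<in> chart_map c ` chart_dom c \<inter> param c -` B"
    using B param_chart_map[OF c] by auto
next
  fix u assume "u \<in> chart_map c ` chart_dom c \<inter> param c -` B"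
  then show "u \<in> chart_map c ` B"
    using param_chart_map[OF c] by auto
qed

lemma borel_chart_image:
  assumes c: "c \<in> A" and B: "B \<in> sets borel" "B \<subseteq> chart_dom c"
  shows "chart_map c ` B \<in> sets borel"
  unfolding chart_image_eq[OF c B(2)]
  using measurable_sets[OF param_measurable[OF c] B(1)] borel_open[OF open_chart_image[OF c]] by auto

lemma borel_chart_vimage:
  assumes c: "c \<in> A" and X: "X \<in> sets borel"
  shows "{x \<in> chart_dom c. chart_map c x \<in> X} \<in> sets borel"
proof -
  have "(\<lambda>x. if x \<in> chart_dom c then chart_map c x else 0) \<in> borel_measurable borel"
    by (intro borel_measurable_continuous_on_if borel_open open_chart_dom continuous_chart_map continuous_on_const c)
  from measurable_sets[OF this X]
  have "chart_dom c \<inter> (\<lambda>x. if x \<in> chart_dom c then chart_map c x else 0) -` X \<in> sets borel"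
    using borel_open[OF open_chart_dom[OF c]] by auto
  moreover have "chart_dom c \<inter> (\<lambda>x. if x \<in> chart_dom c then chart_map c x else 0) -` X
      = {x \<in> chart_dom c. chart_map c x \<in> X}" by auto
  ultimately show ?thesis by simp
qed

text \<open>On a compact manifold this is the volume restricted to the chart domain, as
  \<open>density_volume_chart\<close> shows.\<close>

definition chart_measure :: "('a, 'n) chart \<Rightarrow> 'a measure" where
  "chart_measure c = distr (density lborel (\<lambda>u. ennreal (vol_density c u))) borel (param c)"

lemma sets_chart_measure: "sets (chart_measure c) = sets borel"
  by (simp add: chart_measure_def)

lemma nn_integral_chart_measure:
  assumes c: "c \<in> A" and H: "H \<in> borel_measurable borel"
  shows "(\<integral>\<^sup>+x. H x \<partial>chart_measure c) = (\<integral>\<^sup>+u. ennreal (vol_density c u) * H (param c u) \<partial>lborel)"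
proof -
  have "(\<lambda>u. H (param c u)) \<in> borel_measurable borel"
    using measurable_compose[OF param_measurable[OF c] H] .
  then show ?thesis
    unfolding chart_measure_def using param_measurable[OF c] H vol_density_measurable[OF c]
    by (subst nn_integral_distr) (simp_all add: nn_integral_density)
qed

lemma nn_integral_chart_measure_indicator:
  assumes c: "c \<in> A" and H: "H \<in> borel_measurable borel" and B: "B \<in> sets borel" "B \<subseteq> chart_dom c"
  shows "(\<integral>\<^sup>+x. H x * indicator B x \<partial>chart_measure c)
    = (\<integral>\<^sup>+u. ennreal (vol_density c u) * H (param c u) * indicator (chart_map c ` B) u \<partial>lborel)"
proof -
  have "(\<lambda>x. H x * indicator B x) \<in> borel_measurable borel" using H B by measurable
  then have "(\<integral>\<^sup>+x. H x * indicator B x \<partial>chart_measure c)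
      = (\<integral>\<^sup>+u. ennreal (vol_density c u) * (H (param c u) * indicator B (param c u)) \<partial>lborel)"
    by (rule nn_integral_chart_measure[OF c])
  also have "\<dots> = (\<integral>\<^sup>+u. ennreal (vol_density c u) * H (param c u) * indicator (chart_map c ` B) u \<partial>lborel)"
  proof (intro nn_integral_cong)
    fix u
    have "ennreal (vol_density c u) * indicator B (param c u) = ennreal (vol_density c u) * indicator (chart_map c ` B) u"
      unfolding chart_image_eq[OF c B(2)] by (auto simp: vol_density_def indicator_def)
    then show "ennreal (vol_density c u) * (H (param c u) * indicator B (param c u))
        = ennreal (vol_density c u) * H (param c u) * indicator (chart_map c ` B) u"
      by (simp only: mult_ac)
  qed
  finally show ?thesis .
qed

lemma emeasure_chart_measure:
  assumes c: "c \<in> A" and B: "B \<in> sets borel" "B \<subseteq> chart_dom c"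
  shows "emeasure (chart_measure c) B = (\<integral>\<^sup>+u\<in>chart_map c ` B. ennreal (sqrt (det (g c u))) \<partial>lborel)"
proof -
  have "emeasure (chart_measure c) B = (\<integral>\<^sup>+x. 1 * indicator B x \<partial>chart_measure c)"
    using B(1) by (simp add: sets_chart_measure)
  also have "\<dots> = (\<integral>\<^sup>+u. ennreal (vol_density c u) * 1 * indicator (chart_map c ` B) u \<partial>lborel)"
    by (rule nn_integral_chart_measure_indicator[OF c _ B]) simp
  also have "\<dots> = (\<integral>\<^sup>+u\<in>chart_map c ` B. ennreal (sqrt (det (g c u))) \<partial>lborel)"
    using B(2) by (intro nn_integral_cong) (auto simp: vol_density_def indicator_def)
  finally show ?thesis .
qed

text \<open>Kept general in F: the identity yields agreement of the coordinate measures on overlaps,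
  and T yields the duality of the transfer operator on one branch.\<close>

lemma chart_change_of_variables:
  assumes c: "c \<in> A" and d: "d \<in> A" and F: "continuous_on UNIV F"
    and C1: "Ck_on (Suc 0) (local_dom c d F) (local_rep c d F)"
    and B: "B \<in> sets borel" "B \<subseteq> chart_dom c" "F ` B \<subseteq> chart_dom d" and inj: "inj_on F B"
    and borel_image: "\<And>X. X \<in> sets borel \<Longrightarrow> X \<subseteq> B \<Longrightarrow> F ` X \<in> sets borel"
    and H: "H \<in> borel_measurable borel"
  shows "(\<integral>\<^sup>+y. H y * indicator (F ` B) y \<partial>chart_measure d)
    = (\<integral>\<^sup>+u. H (F (param c u)) * ennreal (vol_density d (local_rep c d F u)
         * \<bar>det (jacobian (local_rep c d F) (at u))\<bar>) * indicator (chart_map c ` B) u \<partial>lborel)"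
proof -
  let ?f = "local_rep c d F" and ?S = "chart_map c ` B"
  have dom: "?S \<subseteq> local_dom c d F"
  proof
    fix u assume "u \<in> ?S"
    then obtain x where "x \<in> B" "u = chart_map c x" by blast
    moreover from this have "x \<in> chart_dom c" "F x \<in> chart_dom d" using B by auto
    ultimately show "u \<in> local_dom c d F" using chart_map_in_local_dom[where F = F] by simp
  qed
  have f: "?f (chart_map c x) = chart_map d (F x)" if "x \<in> B" for x
    using local_rep_chart_map[OF c, of x d F] B(2) that by blast
  have image: "?f ` chart_map c ` X = chart_map d ` F ` X" if "X \<subseteq> B" for X
    unfolding image_image using f that by (intro image_cong) auto
  have op: "open (local_dom c d F)" by (rule open_local_dom[OF c d F])
  have FB: "F ` B \<in> sets borel" using borel_image B(1) by blast
  have meas: "(\<lambda>v. ennreal (vol_density d v) * H (param d v)) \<in> borel_measurable borel"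
    using measurable_compose[OF param_measurable[OF d] H] vol_density_measurable[OF d] by measurable
  have "(\<integral>\<^sup>+y. H y * indicator (F ` B) y \<partial>chart_measure d)
      = (\<integral>\<^sup>+v. ennreal (vol_density d v) * H (param d v) * indicator (?f ` ?S) v \<partial>lborel)"
    using nn_integral_chart_measure_indicator[OF d H FB B(3)] by (simp only: image[OF subset_refl])
  also have "\<dots> = (\<integral>\<^sup>+u. ennreal (vol_density d (?f u)) * H (param d (?f u))
      * ennreal \<bar>det (matrix (\<lambda>v. jacobian ?f (at u) *v v))\<bar> * indicator ?S u \<partial>lborel)"
  proof (rule nn_integral_change_of_variables[OF _ _ _ _ _ meas])
    show "?S \<in> sets borel" by (rule borel_chart_image[OF c B(1,2)])
    show "?f ` X \<in> sets borel" if X: "X \<in> sets borel" "X \<subseteq> ?S" for X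
    proof -
      define X' where "X' = B \<inter> {x \<in> chart_dom c. chart_map c x \<in> X}"
      have "X' \<in> sets borel" unfolding X'_def by (intro sets.Int B(1) borel_chart_vimage[OF c X(1)])
      moreover have "X' \<subseteq> B" by (auto simp: X'_def)
      moreover have "X = chart_map c ` X'" using X(2) B(2) by (auto simp: X'_def)
      ultimately have "?f ` X = chart_map d ` F ` X'" "F ` X' \<in> sets borel"
        using image borel_image by simp_all
      moreover have "F ` X' \<subseteq> chart_dom d"
        using image_mono[OF \<open>X' \<subseteq> B\<close>] B(3) by (rule order_trans)
      ultimately show ?thesis using borel_chart_image[OF d] by simp
    qed
    show "(?f has_derivative (\<lambda>v. jacobian ?f (at u) *v v)) (at u)" if "u \<in> ?S" for u
      by (rule Ck_on_has_derivative_jacobian[OF C1 op]) (use dom that in blast)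
    show "inj_on ?f ?S"
    proof (rule inj_onI)
      fix u u' assume "u \<in> ?S" "u' \<in> ?S" and eq: "?f u = ?f u'"
      then obtain x x' where x: "x \<in> B" "u = chart_map c x" "x' \<in> B" "u' = chart_map c x'" by blast
      have "chart_map d (F x) = chart_map d (F x')" using eq f x by simp
      moreover have "F x \<in> chart_dom d" "F x' \<in> chart_dom d" using B(3) x by auto
      ultimately have "F x = F x'" using chart_inv_map[OF d] by metis
      then show "u = u'" using inj x by (auto dest: inj_onD)
    qed
    have "continuous_on ?S (\<lambda>u. \<bar>det (jacobian ?f (at u))\<bar>)"
      by (intro continuous_on_rabs continuous_on_det continuous_on_subset[OF Ck_on_continuous_jacobian[OF C1] dom])
    from borel_measurable_continuous_on_indicator[OF borel_chart_image[OF c B(1,2)] this]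
    show "(\<lambda>u. indicator ?S u * \<bar>det (matrix (\<lambda>v. jacobian ?f (at u) *v v))\<bar>) \<in> borel_measurable borel"
      by (simp add: matrix_of_matrix_vector_mul)
  qed
  also have "\<dots> = (\<integral>\<^sup>+u. H (F (param c u)) * ennreal (vol_density d (?f u)
         * \<bar>det (jacobian ?f (at u))\<bar>) * indicator ?S u \<partial>lborel)"
  proof (intro nn_integral_cong)
    fix u
    show "ennreal (vol_density d (?f u)) * H (param d (?f u))
      * ennreal \<bar>det (matrix (\<lambda>v. jacobian ?f (at u) *v v))\<bar> * indicator ?S u
      = H (F (param c u)) * ennreal (vol_density d (?f u) * \<bar>det (jacobian ?f (at u))\<bar>) * indicator ?S u"
    proof (cases "u \<in> ?S")
      case True
      then obtain x where x: "x \<in> B" "u = chart_map c x" by blast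
      then have "x \<in> chart_dom c" "F x \<in> chart_dom d" using B by auto
      then have "param d (?f u) = F (param c u)"
        using x f param_chart_map[OF c] param_chart_map[OF d] by simp
      then show ?thesis
        using vol_density_nonneg[OF d] by (simp add: matrix_of_matrix_vector_mul ennreal_mult mult_ac)
    qed simp
  qed
  finally show ?thesis .
qed

text \<open>Change of variables for the identity map: the determinant of the transition is exactly
  the factor relating the square roots of the Gram determinants.\<close>

lemma chart_measure_transition:
  assumes c: "c \<in> A" and d: "d \<in> A" and B: "B \<in> sets borel" "B \<subseteq> chart_dom c" "B \<subseteq> chart_dom d"
  shows "emeasure (chart_measure c) B = emeasure (chart_measure d) B"
proof -
  have "emeasure (chart_measure d) B = (\<integral>\<^sup>+y. 1 * indicator (id ` B) y \<partial>chart_measure d)"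
    using B(1) by (simp add: sets_chart_measure)
  also have "\<dots> = (\<integral>\<^sup>+u. 1 * ennreal (vol_density d (local_rep c d id u)
         * \<bar>det (jacobian (local_rep c d id) (at u))\<bar>) * indicator (chart_map c ` B) u \<partial>lborel)"
    by (rule chart_change_of_variables[OF c d _ Ck_transition[OF c d] B(1,2)]) (use B in auto)
  also have "\<dots> = (\<integral>\<^sup>+u\<in>chart_map c ` B. ennreal (sqrt (det (g c u))) \<partial>lborel)"
  proof (intro nn_integral_cong)
    fix u
    show "1 * ennreal (vol_density d (local_rep c d id u) * \<bar>det (jacobian (local_rep c d id) (at u))\<bar>) * indicator (chart_map c ` B) u
      = ennreal (sqrt (det (g c u))) * indicator (chart_map c ` B) u"
    proof (cases "u \<in> chart_map c ` B")
      case True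
      then obtain x where x: "x \<in> B" "u = chart_map c x" by blast
      then have xd: "x \<in> chart_dom c" "x \<in> chart_dom d" using B by auto
      then have u: "u \<in> local_dom c d id" using chart_map_in_local_dom[of x c id d] x by simp
      have "local_rep c d id u \<in> chart_map d ` chart_dom d"
        using local_rep_chart_map[OF c xd(1), of d id] xd x by simp
      then show ?thesis
        using True det_metric_transition[OF c d u] by (simp only: vol_density_def indicator_simps mult_1 mult.commute)
    qed simp
  qed
  finally show ?thesis using emeasure_chart_measure[OF c B(1,2)] by simp
qed

abbreviation volume_spec :: "'a measure \<Rightarrow> bool" where
  "volume_spec M \<equiv> sets M = sets borel \<and>
       (\<forall>c\<in>A. \<forall>B\<in>sets borel. B \<subseteq> chart_dom c \<longrightarrow>
          emeasure M B = (\<integral>\<^sup>+u\<in>chart_map c ` B. ennreal (sqrt (det (g c u))) \<partial>lborel))"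

text \<open>The volume is a definite description, so existence and uniqueness are both required. A
  finite Borel partition subordinate to charts serves for gluing the coordinate measures and for
  reducing uniqueness to single charts.\<close>

lemma volume_spec_ex1:
  assumes "compact (UNIV :: 'a set)"
  shows "\<exists>!M. volume_spec M"
proof -
  obtain n :: nat and xs P where P: "\<And>i. i < n \<Longrightarrow> P i \<in> sets borel"
    and P_sub: "\<And>i. i < n \<Longrightarrow> P i \<subseteq> chart_dom (chart_at A (xs i))"
    and disj: "disjoint_family_on P {..<n}" and UN: "(\<Union>i<n. P i) = UNIV"
    by (rule compact_finite_borel_partition[OF assms, of "\<lambda>x. chart_dom (chart_at A x)"])
      (auto intro: open_chart_dom chart_at)
  define c where "c i = chart_at A (xs i)" for i
  have c: "c i \<in> A" for i by (simp add: c_def chart_at)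
  have Pc: "P i \<subseteq> chart_dom (c i)" if "i < n" for i using P_sub[OF that] by (simp only: c_def)
  have sum: "emeasure M B = (\<Sum>i<n. emeasure M (B \<inter> P i))"
    if "sets M = sets borel" "B \<in> sets borel" for M :: "'a measure" and B
  proof -
    have "(\<Sum>i<n. emeasure M (B \<inter> P i)) = emeasure M (\<Union>i<n. B \<inter> P i)"
    proof (rule sum_emeasure)
      show "disjoint_family_on (\<lambda>i. B \<inter> P i) {..<n}"
        using disj by (auto simp: disjoint_family_on_def)
      show "(\<lambda>i. B \<inter> P i) ` {..<n} \<subseteq> sets M" using P that by auto
    qed simp
    also have "(\<Union>i<n. B \<inter> P i) = B" using UN by blast
    finally show ?thesis by simp
  qed
  obtain M where M: "sets M = sets borel"
    "\<forall>B\<in>sets borel. emeasure M B = (\<Sum>i<n. emeasure (density (chart_measure (c i)) (indicator (P i))) B)"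
    using finite_sum_of_measures[of n "\<lambda>i. density (chart_measure (c i)) (indicator (P i))"]
    unfolding sets_density sets_chart_measure by blast
  have em: "emeasure M B = (\<Sum>i<n. emeasure (chart_measure (c i)) (B \<inter> P i))" if B: "B \<in> sets borel" for B
  proof -
    have "emeasure (density (chart_measure (c i)) (indicator (P i))) B = emeasure (chart_measure (c i)) (B \<inter> P i)"
      if "i < n" for i
    proof -
      have "emeasure (density (chart_measure (c i)) (indicator (P i))) B
          = (\<integral>\<^sup>+x. indicator (P i) x * indicator B x \<partial>chart_measure (c i))"
        using B P[OF that] sets_chart_measure[of "c i"]
        by (intro emeasure_density) (simp_all cong: measurable_cong_sets)
      also have "\<dots> = (\<integral>\<^sup>+x. indicator (B \<inter> P i) x \<partial>chart_measure (c i))"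
        by (intro nn_integral_cong) (auto simp: indicator_def)
      also have "\<dots> = emeasure (chart_measure (c i)) (B \<inter> P i)"
        using B P[OF that] sets_chart_measure[of "c i"] by (intro nn_integral_indicator) auto
      finally show ?thesis .
    qed
    then show ?thesis using M(2) B by simp
  qed
  have spec: "volume_spec M"
  proof (intro conjI ballI impI M(1))
    fix d B assume d: "d \<in> A" and B: "B \<in> sets borel" "B \<subseteq> chart_dom d"
    \<comment> \<open>Each piece of B lies in the domains of \<open>c i\<close> and d, so its
      coordinate measure may be computed in d; the pieces then add up to B.\<close>
    have "emeasure M B = (\<Sum>i<n. emeasure (chart_measure d) (B \<inter> P i))"
      unfolding em[OF B(1)]
    proof (intro sum.cong refl chart_measure_transition c d)
      fix i assume "i \<in> {..<n}"
      then have i: "i < n" by simp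
      show "B \<inter> P i \<in> sets borel" by (rule sets.Int[OF B(1) P[OF i]])
      show "B \<inter> P i \<subseteq> chart_dom (c i)" "B \<inter> P i \<subseteq> chart_dom d"
        using B(2) Pc[OF i] by blast+
    qed
    also have "\<dots> = emeasure (chart_measure d) B"
      by (rule sum[OF sets_chart_measure B(1), symmetric])
    finally show "emeasure M B = (\<integral>\<^sup>+u\<in>chart_map d ` B. ennreal (sqrt (det (g d u))) \<partial>lborel)"
      by (simp only: emeasure_chart_measure[OF d B])
  qed
  have unique: "M1 = M2" if M1: "volume_spec M1" and M2: "volume_spec M2" for M1 M2
  proof (rule measure_eqI)
    show "sets M1 = sets M2" using conjunct1[OF M1] conjunct1[OF M2] by (simp only:)
    fix B assume "B \<in> sets M1"
    then have B: "B \<in> sets borel" using conjunct1[OF M1] by (simp only:)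
    have "emeasure M1 (B \<inter> P i) = emeasure M2 (B \<inter> P i)" if "i \<in> {..<n}" for i
    proof -
      have i: "i < n" using that by simp
      have X: "B \<inter> P i \<in> sets borel" "B \<inter> P i \<subseteq> chart_dom (c i)" using B P[OF i] Pc[OF i] by auto
      have "emeasure M1 (B \<inter> P i) = (\<integral>\<^sup>+u\<in>chart_map (c i) ` (B \<inter> P i). ennreal (sqrt (det (g (c i) u))) \<partial>lborel)"
        using conjunct2[OF M1] c[of i] X by blast
      moreover have "emeasure M2 (B \<inter> P i) = (\<integral>\<^sup>+u\<in>chart_map (c i) ` (B \<inter> P i). ennreal (sqrt (det (g (c i) u))) \<partial>lborel)"
        using conjunct2[OF M2] c[of i] X by blast
      ultimately show ?thesis by (simp only:)
    qed
    then have "(\<Sum>i<n. emeasure M1 (B \<inter> P i)) = (\<Sum>i<n. emeasure M2 (B \<inter> P i))"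
      by (rule sum.cong[OF refl])
    then show "emeasure M1 B = emeasure M2 B"
      using sum[OF conjunct1[OF M1] B] sum[OF conjunct1[OF M2] B] by (simp only:)
  qed
  show ?thesis
  proof (rule ex1I)
    show "volume_spec M" by (rule spec)
    show "M' = M" if "volume_spec M'" for M' by (rule unique[OF that spec])
  qed
qed

lemma volume_spec_riem_volume:
  assumes "compact (UNIV :: 'a set)"
  shows "volume_spec (riem_volume A g)"
  unfolding riem_volume_def by (rule theI'[OF volume_spec_ex1[OF assms]])

end

section \<open>Integration against the volume, its positivity and finiteness\<close>

context riemannian
begin

lemma density_volume_chart:
  assumes "compact (UNIV :: 'a set)" and c: "c \<in> A"
  shows "density (riem_volume A g) (indicator (chart_dom c)) = chart_measure c"
proof (rule measure_eqI)
  note spec = volume_spec_riem_volume[OF assms(1)]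
  show "sets (density (riem_volume A g) (indicator (chart_dom c))) = sets (chart_measure c)"
    using conjunct1[OF spec] by (simp only: sets_density sets_chart_measure)
  fix B assume "B \<in> sets (density (riem_volume A g) (indicator (chart_dom c)))"
  then have B: "B \<in> sets borel" using conjunct1[OF spec] by (simp only: sets_density)
  have dom: "chart_dom c \<in> sets borel" by (rule borel_open[OF open_chart_dom[OF c]])
  have Bd: "B \<inter> chart_dom c \<in> sets borel" "B \<inter> chart_dom c \<subseteq> chart_dom c" using B dom by auto
  have "emeasure (density (riem_volume A g) (indicator (chart_dom c))) B
      = (\<integral>\<^sup>+x. indicator (chart_dom c) x * indicator B x \<partial>riem_volume A g)"
    using B dom conjunct1[OF spec] by (intro emeasure_density) (simp_all cong: measurable_cong_sets)
  also have "\<dots> = (\<integral>\<^sup>+x. indicator (B \<inter> chart_dom c) x \<partial>riem_volume A g)"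
    by (intro nn_integral_cong) (auto simp: indicator_def)
  also have "\<dots> = emeasure (riem_volume A g) (B \<inter> chart_dom c)"
    using Bd conjunct1[OF spec] by (intro nn_integral_indicator) simp
  also have "\<dots> = (\<integral>\<^sup>+u\<in>chart_map c ` (B \<inter> chart_dom c). ennreal (sqrt (det (g c u))) \<partial>lborel)"
    using conjunct2[OF spec] c Bd by blast
  also have "\<dots> = emeasure (chart_measure c) (B \<inter> chart_dom c)"
    by (simp only: emeasure_chart_measure[OF c Bd])
  also have "\<dots> = emeasure (chart_measure c) B"
  proof -
    \<comment> \<open>The density vanishes outside the coordinate image, and inside it
      \<open>param\<close> takes values in the chart domain; hence no mass lies elsewhere.\<close>
    have emp: "emeasure (chart_measure c) (B - chart_dom c) = 0"
    proof -
      have BD: "B - chart_dom c \<in> sets borel" using B dom by auto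
      have "emeasure (chart_measure c) (B - chart_dom c) = (\<integral>\<^sup>+x. indicator (B - chart_dom c) x \<partial>chart_measure c)"
        using BD by (simp add: sets_chart_measure)
      also have "\<dots> = (\<integral>\<^sup>+u. ennreal (vol_density c u) * indicator (B - chart_dom c) (param c u) \<partial>lborel)"
        using BD by (intro nn_integral_chart_measure[OF c]) simp
      also have "\<dots> = (\<integral>\<^sup>+u. 0 \<partial>(lborel :: (real ^ 'n) measure))"
      proof (intro nn_integral_cong)
        fix u
        show "ennreal (vol_density c u) * indicator (B - chart_dom c) (param c u) = 0"
          using chart_inv_in[OF c, of u]
          by (cases "u \<in> chart_map c ` chart_dom c") (auto simp: vol_density_def param_def)
      qed
      finally show ?thesis by simp
    qed
    have "emeasure (chart_measure c) B = emeasure (chart_measure c) (B \<inter> chart_dom c) + emeasure (chart_measure c) (B - chart_dom c)"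
      using B dom by (subst plus_emeasure) (auto simp: sets_chart_measure Int_Diff_Un)
    then show ?thesis using emp by simp
  qed
  finally show "emeasure (density (riem_volume A g) (indicator (chart_dom c))) B = emeasure (chart_measure c) B" .
qed

lemma nn_integral_volume_chart:
  assumes "compact (UNIV :: 'a set)" and c: "c \<in> A" and H: "H \<in> borel_measurable borel"
    and B: "B \<in> sets borel" "B \<subseteq> chart_dom c"
  shows "(\<integral>\<^sup>+x. H x * indicator B x \<partial>riem_volume A g) = (\<integral>\<^sup>+x. H x * indicator B x \<partial>chart_measure c)"
proof -
  note spec = volume_spec_riem_volume[OF assms(1)]
  have dom: "chart_dom c \<in> sets borel" by (rule borel_open[OF open_chart_dom[OF c]])
  have HB: "(\<lambda>x. H x * indicator B x) \<in> borel_measurable borel" using H B by measurable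
  have "(\<integral>\<^sup>+x. H x * indicator B x \<partial>chart_measure c)
      = (\<integral>\<^sup>+x. indicator (chart_dom c) x * (H x * indicator B x) \<partial>riem_volume A g)"
    unfolding density_volume_chart[OF assms(1) c, symmetric]
    using HB dom conjunct1[OF spec] by (intro nn_integral_density) (simp_all cong: measurable_cong_sets)
  also have "\<dots> = (\<integral>\<^sup>+x. H x * indicator B x \<partial>riem_volume A g)"
    using B(2) by (intro nn_integral_cong) (auto simp: indicator_def)
  finally show ?thesis by simp
qed

text \<open>On a small coordinate ball the volume density is bounded by compactness and positive,
  and the ball has finite positive Lebesgue measure.\<close>

lemma emeasure_volume_nbhd:
  assumes "compact (UNIV :: 'a set)"
  shows "\<exists>N. open N \<and> x \<in> N \<and> 0 < emeasure (riem_volume A g) N \<and> emeasure (riem_volume A g) N < \<infinity>"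
proof -
  define c where "c = chart_at A x"
  have c: "c \<in> A" "x \<in> chart_dom c" using chart_at by (auto simp: c_def)
  obtain r where r: "0 < r" "cball (chart_map c x) r \<subseteq> chart_map c ` chart_dom c"
    using chart_ball[OF c open_UNIV UNIV_I] by blast
  define N where "N = {y \<in> chart_dom c. chart_map c y \<in> ball (chart_map c x) r}"
  have N: "open N" "x \<in> N" "N \<subseteq> chart_dom c"
    using open_chart_preimage[OF c(1) open_ball] c r by (auto simp: N_def)
  have img: "chart_map c ` N = ball (chart_map c x) r"
    using r(2) by (force simp: N_def)
  have vol: "emeasure (riem_volume A g) N = (\<integral>\<^sup>+u\<in>ball (chart_map c x) r. ennreal (sqrt (det (g c u))) \<partial>lborel)"
    using conjunct2[OF volume_spec_riem_volume[OF assms]] c(1) borel_open[OF N(1)] N(3) unfolding img[symmetric] by blast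
  have "continuous_on (cball (chart_map c x) r) (\<lambda>u. sqrt (det (g c u)))"
    by (intro continuous_on_real_sqrt continuous_on_det continuous_on_subset[OF continuous_metric[OF c(1)] r(2)])
  then have "bounded ((\<lambda>u. sqrt (det (g c u))) ` cball (chart_map c x) r)"
    by (intro compact_imp_bounded compact_continuous_image compact_cball)
  then obtain C where "\<forall>v\<in>(\<lambda>u. sqrt (det (g c u))) ` cball (chart_map c x) r. norm v \<le> C"
    unfolding bounded_iff by blast
  then have C: "\<bar>sqrt (det (g c u))\<bar> \<le> C" if "u \<in> cball (chart_map c x) r" for u
    using that by simp
  have "emeasure (riem_volume A g) N \<le> (\<integral>\<^sup>+u. ennreal C * indicator (ball (chart_map c x) r) u \<partial>lborel)"
    unfolding vol
  proof (intro nn_integral_mono)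
    fix u
    show "ennreal (sqrt (det (g c u))) * indicator (ball (chart_map c x) r) u \<le> ennreal C * indicator (ball (chart_map c x) r) u"
    proof (cases "u \<in> ball (chart_map c x) r")
      case True
      then have "\<bar>sqrt (det (g c u))\<bar> \<le> C" by (intro C) simp
      then have "sqrt (det (g c u)) \<le> C" by linarith
      then show ?thesis using True by (simp add: ennreal_leI)
    qed simp
  qed
  also have "\<dots> = ennreal C * emeasure lborel (ball (chart_map c x) r)"
    by (rule nn_integral_cmult_indicator) simp
  also have "\<dots> < \<infinity>"
    using emeasure_bounded_finite[OF bounded_ball[of "chart_map c x" r]] by (simp add: ennreal_mult_less_top)
  finally have fin: "emeasure (riem_volume A g) N < \<infinity>" .
  have vol': "emeasure (riem_volume A g) N = (\<integral>\<^sup>+u. ennreal (vol_density c u) * indicator (ball (chart_map c x) r) u \<partial>lborel)"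
    unfolding vol
  proof (intro nn_integral_cong)
    fix u
    show "ennreal (sqrt (det (g c u))) * indicator (ball (chart_map c x) r) u
      = ennreal (vol_density c u) * indicator (ball (chart_map c x) r) u"
      using subsetD[OF order_trans[OF ball_subset_cball r(2)], of u]
      by (cases "u \<in> ball (chart_map c x) r") (simp_all add: vol_density_def)
  qed
  have "(\<lambda>u. ennreal (vol_density c u) * indicator (ball (chart_map c x) r) u) \<in> borel_measurable borel"
    by (intro borel_measurable_times_ennreal measurable_compose[OF vol_density_measurable[OF c(1)] measurable_ennreal]
        borel_measurable_indicator borel_open open_ball)
  then have meas: "(\<lambda>u. ennreal (vol_density c u) * indicator (ball (chart_map c x) r) u) \<in> borel_measurable lborel"
    by simp
  have "emeasure (riem_volume A g) N \<noteq> 0"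
  proof
    assume "emeasure (riem_volume A g) N = 0"
    then have "AE u in lborel. ennreal (vol_density c u) * indicator (ball (chart_map c x) r) u = 0"
      unfolding vol' nn_integral_0_iff_AE[OF meas] .
    then have "AE u in lborel. u \<notin> ball (chart_map c x) r"
    proof eventually_elim
      case (elim u)
      show ?case
      proof
        assume u: "u \<in> ball (chart_map c x) r"
        then have "u \<in> chart_map c ` chart_dom c" using r(2) by auto
        then have "0 < vol_density c u" by (rule vol_density_pos[OF c(1)])
        then show False using elim u by (simp add: ennreal_eq_0_iff)
      qed
    qed
    then have "ball (chart_map c x) r \<in> null_sets lborel"
      by (subst (asm) AE_iff_null_sets[symmetric]) auto
    then have "emeasure lborel (ball (chart_map c x) r) = 0" by auto
    moreover have "0 < emeasure lborel (ball (chart_map c x) r)"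
      using r(1) by (simp add: emeasure_ball unit_ball_vol_pos)
    ultimately show False by simp
  qed
  then have "0 < emeasure (riem_volume A g) N" by (simp add: zero_less_iff_neq_zero)
  then show ?thesis using N fin by blast
qed

lemma volume_finite_pos:
  assumes "compact (UNIV :: 'a set)"
  shows "0 < emeasure (riem_volume A g) UNIV" "emeasure (riem_volume A g) UNIV < \<infinity>"
proof -
  let ?M = "riem_volume A g"
  note sets_M = conjunct1[OF volume_spec_riem_volume[OF assms]]
  obtain N where N: "\<And>x. open (N x)" "\<And>x. x \<in> N x" "\<And>x. 0 < emeasure ?M (N x)" "\<And>x. emeasure ?M (N x) < \<infinity>"
    using emeasure_volume_nbhd[OF assms] by metis
  have "emeasure ?M (N undefined) \<le> emeasure ?M UNIV"
    using sets_M by (intro emeasure_mono) auto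
  then show "0 < emeasure ?M UNIV" using N(3)[of undefined] by (rule order_less_le_trans[rotated])
  obtain F where F: "finite F" "UNIV \<subseteq> (\<Union>x\<in>F. N x)"
    by (rule compactE_image[OF assms(1), of UNIV N]) (use N in auto)
  have "emeasure ?M UNIV \<le> emeasure ?M (\<Union>x\<in>F. N x)"
    using F sets_M N(1) by (intro emeasure_mono) auto
  also have "\<dots> \<le> (\<Sum>x\<in>F. emeasure ?M (N x))"
    using F(1) sets_M N(1) by (intro emeasure_subadditive_finite) auto
  also have "\<dots> < \<infinity>" using N(4) F(1) by (simp add: less_top)
  finally show "emeasure ?M UNIV < \<infinity>" .
qed

end

section \<open>Duality of the transfer operator with the volume\<close>

context expanding_map
begin

abbreviation vol :: "'a measure" where "vol \<equiv> riem_volume A g"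
abbreviation J :: "'a \<Rightarrow> real" where "J \<equiv> abs_det_D A g T"

lemma sets_vol: "sets vol = sets borel"
  by (rule conjunct1[OF volume_spec_riem_volume[OF compact_UNIV]])

text \<open>Since \<open>K\<close> is compact, \<open>T\<close> is a homeomorphism of \<open>K\<close> onto its image, so that it maps Borel subsets of
  \<open>K\<close> to Borel sets.\<close>

lemma injectivity_nbhd:
  "\<exists>N K. open N \<and> x \<in> N \<and> N \<subseteq> K \<and> compact K \<and> inj_on T K \<and> K \<subseteq> chart_dom (chart_at A x)
     \<and> T ` K \<subseteq> chart_dom (chart_at A (T x))"
proof -
  define c where "c = chart_at A x"
  define d where "d = chart_at A (T x)"
  have c: "c \<in> A" "x \<in> chart_dom c" and d: "d \<in> A" "T x \<in> chart_dom d"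
    using chart_at by (auto simp: c_def d_def)
  obtain N0 where N0: "open N0" "x \<in> N0" "inj_on T N0" using locally_injective[of x] by blast
  have "open (N0 \<inter> T -` chart_dom d)" "x \<in> N0 \<inter> T -` chart_dom d"
    using N0 d open_vimage_T[OF open_chart_dom[OF d(1)]] by auto
  then obtain r where r: "0 < r" "cball (chart_map c x) r \<subseteq> chart_map c ` chart_dom c"
    and N: "\<forall>y\<in>chart_dom c. chart_map c y \<in> cball (chart_map c x) r \<longrightarrow> y \<in> N0 \<inter> T -` chart_dom d"
    using chart_ball[OF c] by blast
  define K where "K = chart_inv c ` cball (chart_map c x) r"
  define N where "N = {y \<in> chart_dom c. chart_map c y \<in> ball (chart_map c x) r}"
  have K: "y \<in> chart_dom c \<and> y \<in> N0 \<and> T y \<in> chart_dom d" if "y \<in> K" for y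
  proof -
    obtain u where u: "u \<in> cball (chart_map c x) r" "y = chart_inv c u" using \<open>y \<in> K\<close> unfolding K_def by blast
    then have "u \<in> chart_map c ` chart_dom c" using r(2) by blast
    then have "y \<in> chart_dom c" "chart_map c y = u" using u chart_inv_in[OF c(1)] chart_map_inv[OF c(1)] by simp_all
    then show ?thesis using \<open>\<forall>y\<in>chart_dom c. chart_map c y \<in> cball (chart_map c x) r \<longrightarrow> y \<in> N0 \<inter> T -` chart_dom d\<close> u(1)
      by simp
  qed
  show ?thesis
    unfolding c_def[symmetric] d_def[symmetric]
  proof (rule exI[of _ N], rule exI[of _ K], intro conjI)
    show "open N" unfolding N_def by (rule open_chart_preimage[OF c(1) open_ball])
    show "x \<in> N" using c r by (simp add: N_def)
    show "N \<subseteq> K"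
    proof
      fix y assume "y \<in> N"
      then show "y \<in> K" unfolding K_def using chart_inv_map[OF c(1), of y]
        by (intro image_eqI[of _ _ "chart_map c y"]) (simp_all add: N_def)
    qed
    show "compact K"
      unfolding K_def by (intro compact_continuous_image continuous_on_subset[OF continuous_chart_inv[OF c(1)] r(2)] compact_cball)
    show "inj_on T K" by (rule inj_on_subset[OF N0(3)]) (use K in blast)
    show "K \<subseteq> chart_dom c" "T ` K \<subseteq> chart_dom d" using K by blast+
  qed
qed

text \<open>Duality for a single inverse branch S of T. The functions F and G are quantified inside,
  so that S and the image of P are fixed before them and the branches can be summed.\<close>

lemma transfer_piece:
  assumes c: "c \<in> A" and d: "d \<in> A" and K: "compact K" "inj_on T K" "K \<subseteq> chart_dom c" "T ` K \<subseteq> chart_dom d"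
    and P: "P \<in> sets borel" "P \<subseteq> K" and J: "J \<in> borel_measurable borel"
  shows "\<exists>S. S \<in> borel_measurable borel \<and> (\<forall>z\<in>P. S (T z) = z) \<and> T ` P \<in> sets borel \<and>
    (\<forall>F G. F \<in> borel_measurable borel \<longrightarrow> (\<forall>x. (0::real) \<le> F x) \<longrightarrow> G \<in> borel_measurable borel \<longrightarrow>
      (\<integral>\<^sup>+x. ennreal (F x) * G (T x) * indicator P x \<partial>vol)
      = (\<integral>\<^sup>+y. ennreal (F (S y) / J (S y)) * G y * indicator (T ` P) y \<partial>vol))"
proof -
  obtain S0 where "homeomorphism K (T ` K) T S0"
    using homeomorphism_compact[OF K(1) continuous_on_subset[OF continuous_T subset_UNIV] refl K(2)] by blast
  then have S0: "continuous_on (T ` K) S0" "\<And>z. z \<in> K \<Longrightarrow> S0 (T z) = z"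
    by (auto simp: homeomorphism_def)
  \<comment> \<open>The continuous inverse on the compact image, extended by a constant to be Borel
    on the whole manifold.\<close>
  define S where "S y = (if y \<in> T ` K then S0 y else undefined)" for y
  have "compact (T ` K)" by (intro compact_continuous_image continuous_on_subset[OF continuous_T subset_UNIV] K(1))
  then have TK: "T ` K \<in> sets borel" by (intro borel_closed compact_imp_closed)
  have S_meas: "S \<in> borel_measurable borel"
    unfolding S_def by (rule borel_measurable_continuous_on_if[OF TK S0(1) continuous_on_const])
  have ST: "S (T z) = z" if "z \<in> K" for z using S0(2) that by (simp add: S_def)
  have image: "T ` X = T ` K \<inter> S -` X" if "X \<subseteq> K" for X
    using that ST by force
  have borel_image: "T ` X \<in> sets borel" if "X \<in> sets borel" "X \<subseteq> P" for X
  proof -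
    have "S -` X \<in> sets borel" using measurable_sets[OF S_meas that(1)] by simp
    then show ?thesis unfolding image[OF order_trans[OF that(2) P(2)]] using TK by auto
  qed
  have TP: "T ` P \<in> sets borel" by (rule borel_image[OF P(1) subset_refl])
  have P_c: "P \<subseteq> chart_dom c" and TP_d: "T ` P \<subseteq> chart_dom d" using P(2) K(3,4) by blast+
  have duality: "(\<integral>\<^sup>+x. ennreal (F x) * G (T x) * indicator P x \<partial>vol)
      = (\<integral>\<^sup>+y. ennreal (F (S y) / J (S y)) * G y * indicator (T ` P) y \<partial>vol)"
    if F: "F \<in> borel_measurable borel" "\<And>x. (0::real) \<le> F x" and G: "G \<in> borel_measurable borel" for F G
  proof -
    define H where "H y = ennreal (F (S y) / J (S y)) * G y" for y
    have T_meas: "T \<in> borel_measurable borel"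
      by (rule borel_measurable_continuous_onI[OF continuous_T])
    have "(\<lambda>y. F (S y) / J (S y)) \<in> borel_measurable borel"
      using measurable_compose[OF S_meas F(1)] measurable_compose[OF S_meas J] by (rule borel_measurable_divide)
    then have H: "H \<in> borel_measurable borel" unfolding H_def using G by measurable
    have FGT: "(\<lambda>x. ennreal (F x) * G (T x)) \<in> borel_measurable borel"
      using F(1) measurable_compose[OF T_meas G] by measurable
    have "(\<integral>\<^sup>+y. H y * indicator (T ` P) y \<partial>vol) = (\<integral>\<^sup>+y. H y * indicator (T ` P) y \<partial>chart_measure d)"
      by (rule nn_integral_volume_chart[OF compact_UNIV d H TP TP_d])
    also have "\<dots> = (\<integral>\<^sup>+u. H (T (param c u)) * ennreal (vol_density d (local_rep c d T u)
         * \<bar>det (jacobian (local_rep c d T) (at u))\<bar>) * indicator (chart_map c ` P) u \<partial>lborel)"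
      by (rule chart_change_of_variables[OF c d continuous_T Ck_T[OF c d] P(1) P_c TP_d
            inj_on_subset[OF K(2) P(2)] borel_image H])
    also have "\<dots> = (\<integral>\<^sup>+u. ennreal (vol_density c u) * (ennreal (F (param c u)) * G (T (param c u)))
        * indicator (chart_map c ` P) u \<partial>lborel)"
    proof (intro nn_integral_cong)
      fix u
      show "H (T (param c u)) * ennreal (vol_density d (local_rep c d T u)
         * \<bar>det (jacobian (local_rep c d T) (at u))\<bar>) * indicator (chart_map c ` P) u
         = ennreal (vol_density c u) * (ennreal (F (param c u)) * G (T (param c u))) * indicator (chart_map c ` P) u"
      proof (cases "u \<in> chart_map c ` P")
        case True
        then obtain z where z: "z \<in> P" "u = chart_map c z" by blast
        have zc: "z \<in> chart_dom c" "T z \<in> chart_dom d" "z \<in> K" using z(1) P_c TP_d P(2) by auto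
        have pz: "param c u = z" using param_chart_map[OF c zc(1)] z(2) by simp
        have rep: "local_rep c d T u = chart_map d (T z)" using local_rep_chart_map[OF c zc(1), of d T] z(2) by simp
        \<comment> \<open>The definition of the Riemannian Jacobian read in coordinates: it converts
          the volume density at z into the one at T z times the coordinate determinant.\<close>
        have w: "vol_density d (local_rep c d T u) * \<bar>det (jacobian (local_rep c d T) (at u))\<bar> = J z * vol_density c u"
        proof -
          have "vol_density c u = sqrt (det (g c (chart_map c z)))" "vol_density d (local_rep c d T u) = sqrt (det (g d (chart_map d (T z))))"
            unfolding rep using zc z(2) by (simp_all add: vol_density_def)
          moreover have "sqrt (det (g c (chart_map c z))) \<noteq> 0"
            using det_metric_pos[OF c, of "chart_map c z"] zc(1) by simp
          ultimately show ?thesis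
            using abs_det_D_chart[OF c d zc(1,2)] z(2) by simp
        qed
        have "H (T z) * ennreal (J z * vol_density c u)
            = ennreal (F z / J z * (J z * vol_density c u)) * G (T z)"
          using F(2)[of z] abs_det_D_pos[of z] vol_density_nonneg[OF c, of u]
          by (simp add: H_def ST[OF zc(3)] ennreal_mult[symmetric] mult_ac del: ennreal_mult'')
        also have "F z / J z * (J z * vol_density c u) = vol_density c u * F z"
          using abs_det_D_pos[of z] by simp
        also have "ennreal (vol_density c u * F z) * G (T z) = ennreal (vol_density c u) * (ennreal (F z) * G (T z))"
          using F(2)[of z] vol_density_nonneg[OF c, of u] by (simp add: ennreal_mult mult.assoc)
        finally show ?thesis by (simp only: w pz)
      qed simp
    qed
    also have "\<dots> = (\<integral>\<^sup>+x. ennreal (F x) * G (T x) * indicator P x \<partial>chart_measure c)"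
      by (rule nn_integral_chart_measure_indicator[OF c FGT P(1) P_c, symmetric])
    also have "\<dots> = (\<integral>\<^sup>+x. ennreal (F x) * G (T x) * indicator P x \<partial>vol)"
      by (rule nn_integral_volume_chart[OF compact_UNIV c FGT P(1) P_c, symmetric])
    finally show ?thesis by (simp only: H_def)
  qed
  show ?thesis
  proof (intro exI[of _ S] conjI ballI allI impI S_meas TP)
    show "S (T z) = z" if "z \<in> P" for z using ST that P(2) by blast
  qed (rule duality, simp_all)
qed

end

text \<open>T is injective on each piece with inverse \<open>S i\<close>, so a piece contributes at
  most one point of the fibre, present exactly when y lies in its image.\<close>

lemma sum_fibre_by_pieces:
  fixes h :: "'b \<Rightarrow> real"
  assumes fin: "finite (T -` {y})" and disj: "disjoint_family_on P {..<n::nat}" and UN: "(\<Union>i<n. P i) = UNIV"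
    and ST: "\<And>i z. i < n \<Longrightarrow> z \<in> P i \<Longrightarrow> S i (T z) = z"
  shows "(\<Sum>z\<in>T -` {y}. h z) = (\<Sum>i<n. h (S i y) * indicator (T ` P i) y)"
proof -
  have "T -` {y} = T -` {y} \<inter> (\<Union>i<n. P i)" by (simp only: UN Int_UNIV_right)
  then have "T -` {y} = (\<Union>i<n. T -` {y} \<inter> P i)" by (simp only: Int_UN_distrib)
  then have "(\<Sum>z\<in>T -` {y}. h z) = (\<Sum>z\<in>(\<Union>i<n. T -` {y} \<inter> P i). h z)"
    by (rule sum.cong) (rule refl)
  also have "\<dots> = (\<Sum>i<n. \<Sum>z\<in>T -` {y} \<inter> P i. h z)"
  proof (rule sum.UNION_disjoint)
    show "\<forall>i\<in>{..<n}. finite (T -` {y} \<inter> P i)" using fin by simp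
    show "\<forall>i\<in>{..<n}. \<forall>j\<in>{..<n}. i \<noteq> j \<longrightarrow> T -` {y} \<inter> P i \<inter> (T -` {y} \<inter> P j) = {}"
      using disj unfolding disjoint_family_on_def by blast
  qed simp
  also have "\<dots> = (\<Sum>i<n. h (S i y) * indicator (T ` P i) y)"
  proof (intro sum.cong refl)
    fix i assume "i \<in> {..<n}"
    then have i: "i < n" by simp
    show "(\<Sum>z\<in>T -` {y} \<inter> P i. h z) = h (S i y) * indicator (T ` P i) y"
    proof (cases "y \<in> T ` P i")
      case True
      then obtain z where z: "z \<in> P i" "y = T z" by blast
      have "S i y = z" unfolding z(2) by (rule ST[OF i z(1)])
      moreover have "T -` {y} \<inter> P i = {z}"
      proof (intro equalityI subsetI)
        fix w assume w: "w \<in> T -` {y} \<inter> P i"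
        then have "S i y = w" using ST[OF i, of w] by simp
        then show "w \<in> {z}" using \<open>S i y = z\<close> by simp
      qed (use z in simp)
      ultimately show ?thesis using True by simp
    next
      case False
      then have "T -` {y} \<inter> P i = {}" by blast
      then show ?thesis using False by simp
    qed
  qed
  finally show ?thesis .
qed

context expanding_map
begin

text \<open>Compactness gives a finite Borel partition into pieces on which T has an inverse branch.
  The one-branch dualities add up, and the sum over branches is the sum over the fibre.\<close>

lemma transfer_duality:
  assumes J: "J \<in> borel_measurable borel" and F: "F \<in> borel_measurable borel" "\<And>x. 0 \<le> F x"
  shows "(\<lambda>y. \<Sum>z\<in>T -` {y}. F z / J z) \<in> borel_measurable borel" (is ?meas)
    and "distr (density vol (\<lambda>x. ennreal (F x))) vol T = density vol (\<lambda>y. ennreal (\<Sum>z\<in>T -` {y}. F z / J z))" (is ?dual)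
proof -
  have "\<forall>x. \<exists>N K. open N \<and> x \<in> N \<and> N \<subseteq> K \<and> compact K \<and> inj_on T K \<and> K \<subseteq> chart_dom (chart_at A x)
     \<and> T ` K \<subseteq> chart_dom (chart_at A (T x))"
    using injectivity_nbhd by blast
  then obtain N K where NK: "\<forall>x. open (N x) \<and> x \<in> N x \<and> N x \<subseteq> K x \<and> compact (K x) \<and> inj_on T (K x)
      \<and> K x \<subseteq> chart_dom (chart_at A x) \<and> T ` K x \<subseteq> chart_dom (chart_at A (T x))"
    by metis
  have N: "open (N x)" "x \<in> N x" for x using NK by blast+
  obtain n :: nat and xs P where P: "\<And>i. i < n \<Longrightarrow> P i \<in> sets borel" and P_sub: "\<And>i. i < n \<Longrightarrow> P i \<subseteq> N (xs i)"
    and disj: "disjoint_family_on P {..<n}" and UN: "(\<Union>i<n. P i) = UNIV"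
    by (rule compact_finite_borel_partition[OF compact_UNIV, of N]) (use N in auto)
  have "\<forall>i. \<exists>S. i < n \<longrightarrow> S \<in> borel_measurable borel \<and> (\<forall>z\<in>P i. S (T z) = z) \<and> T ` P i \<in> sets borel \<and>
    (\<forall>F G. F \<in> borel_measurable borel \<longrightarrow> (\<forall>x. (0::real) \<le> F x) \<longrightarrow> G \<in> borel_measurable borel \<longrightarrow>
      (\<integral>\<^sup>+x. ennreal (F x) * G (T x) * indicator (P i) x \<partial>vol)
      = (\<integral>\<^sup>+y. ennreal (F (S y) / J (S y)) * G y * indicator (T ` P i) y \<partial>vol))"
  proof
    fix i
    show "\<exists>S. i < n \<longrightarrow> S \<in> borel_measurable borel \<and> (\<forall>z\<in>P i. S (T z) = z) \<and> T ` P i \<in> sets borel \<and>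
    (\<forall>F G. F \<in> borel_measurable borel \<longrightarrow> (\<forall>x. (0::real) \<le> F x) \<longrightarrow> G \<in> borel_measurable borel \<longrightarrow>
      (\<integral>\<^sup>+x. ennreal (F x) * G (T x) * indicator (P i) x \<partial>vol)
      = (\<integral>\<^sup>+y. ennreal (F (S y) / J (S y)) * G y * indicator (T ` P i) y \<partial>vol))"
    proof (cases "i < n")
      case True
      note Ki = spec[OF NK, of "xs i"]
      have "compact (K (xs i))" "inj_on T (K (xs i))" "K (xs i) \<subseteq> chart_dom (chart_at A (xs i))"
        "T ` K (xs i) \<subseteq> chart_dom (chart_at A (T (xs i)))" "P i \<subseteq> K (xs i)"
        using Ki P_sub[OF True] by blast+
      from transfer_piece[OF chart_at(1) chart_at(1) this(1-4) P[OF True] this(5) J]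
      show ?thesis by (rule ex_forward) (rule impI)
    qed simp
  qed
  from choice[OF this] obtain S where S: "\<forall>i. i < n \<longrightarrow> S i \<in> borel_measurable borel \<and> (\<forall>z\<in>P i. S i (T z) = z) \<and> T ` P i \<in> sets borel \<and>
    (\<forall>F G. F \<in> borel_measurable borel \<longrightarrow> (\<forall>x. (0::real) \<le> F x) \<longrightarrow> G \<in> borel_measurable borel \<longrightarrow>
      (\<integral>\<^sup>+x. ennreal (F x) * G (T x) * indicator (P i) x \<partial>vol)
      = (\<integral>\<^sup>+y. ennreal (F (S i y) / J (S i y)) * G y * indicator (T ` P i) y \<partial>vol))" ..
  note S' = S[THEN spec, THEN mp]
  note S_meas = S'[THEN conjunct1]
    and ST = S'[THEN conjunct2, THEN conjunct1, THEN bspec]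
    and TP = S'[THEN conjunct2, THEN conjunct2, THEN conjunct1]
  have S_dual: "(\<integral>\<^sup>+x. ennreal (F x) * G (T x) * indicator (P i) x \<partial>vol)
      = (\<integral>\<^sup>+y. ennreal (F (S i y) / J (S i y)) * G y * indicator (T ` P i) y \<partial>vol)"
    if "i < n" "G \<in> borel_measurable borel" for i G
  proof -
    have "\<forall>F G. F \<in> borel_measurable borel \<longrightarrow> (\<forall>x. (0::real) \<le> F x) \<longrightarrow> G \<in> borel_measurable borel \<longrightarrow>
      (\<integral>\<^sup>+x. ennreal (F x) * G (T x) * indicator (P i) x \<partial>vol)
      = (\<integral>\<^sup>+y. ennreal (F (S i y) / J (S i y)) * G y * indicator (T ` P i) y \<partial>vol)"
      using S[THEN spec, THEN mp, OF that(1)] by (elim conjE)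
    from this[rule_format, OF F that(2)] show ?thesis .
  qed
  define f where "f i y = F (S i y) / J (S i y) * indicator (T ` P i) y" for i y
  have f_nonneg: "0 \<le> f i y" for i y
    using F(2) abs_det_D_pos[of "S i y"] by (simp add: f_def)
  have f_meas: "f i \<in> borel_measurable borel" if "i < n" for i
    unfolding f_def
    using measurable_compose[OF S_meas[OF that] F(1)] measurable_compose[OF S_meas[OF that] J] TP[OF that]
    by (intro borel_measurable_times borel_measurable_divide borel_measurable_indicator)
  have fibre_sum: "(\<Sum>z\<in>T -` {y}. F z / J z) = (\<Sum>i<n. f i y)" for y
    unfolding f_def by (rule sum_fibre_by_pieces[OF finite_fibre disj UN ST])
  show ?meas
    unfolding fibre_sum using f_meas by (intro borel_measurable_sum) simp
  then have L_meas: "(\<lambda>y. \<Sum>i<n. f i y) \<in> borel_measurable borel" by (simp only: fibre_sum)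
  have T_meas: "T \<in> borel_measurable borel" by (rule borel_measurable_continuous_onI[OF continuous_T])
  have T_vol: "T \<in> measurable vol vol"
    using T_meas by (simp add: measurable_cong_sets[OF sets_vol sets_vol])
  show ?dual
  proof (rule measure_eqI)
    show "sets (distr (density vol (\<lambda>x. ennreal (F x))) vol T) = sets (density vol (\<lambda>y. ennreal (\<Sum>z\<in>T -` {y}. F z / J z)))"
      by simp
    fix B assume "B \<in> sets (distr (density vol (\<lambda>x. ennreal (F x))) vol T)"
    then have B: "B \<in> sets borel" by (simp add: sets_vol)
    have F_vol: "(\<lambda>x. ennreal (F x)) \<in> borel_measurable vol"
      using F(1) by (simp add: measurable_cong_sets[OF sets_vol refl])
    have L_vol: "(\<lambda>y. ennreal (\<Sum>i<n. f i y)) \<in> borel_measurable vol"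
      using L_meas by (simp add: measurable_cong_sets[OF sets_vol refl])
    have ind: "indicator B \<in> borel_measurable borel" using B by simp
    have TB: "T -` B \<in> sets borel" using measurable_sets[OF T_meas B] by simp
    have space_vol: "space vol = UNIV" using sets_eq_imp_space_eq[OF sets_vol] by simp
    have "emeasure (distr (density vol (\<lambda>x. ennreal (F x))) vol T) B = emeasure (density vol (\<lambda>x. ennreal (F x))) (T -` B)"
      using T_vol B by (subst emeasure_distr) (simp_all add: sets_vol space_vol)
    also have "\<dots> = (\<integral>\<^sup>+x. ennreal (F x) * indicator (T -` B) x \<partial>vol)"
      using F_vol TB by (intro emeasure_density) (simp_all add: sets_vol)
    also have "\<dots> = (\<integral>\<^sup>+x. (\<Sum>i<n. ennreal (F x) * indicator B (T x) * indicator (P i) x) \<partial>vol)"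
    proof (intro nn_integral_cong)
      fix x
      obtain i where i: "i < n" "x \<in> P i" using UN by blast
      have "(\<Sum>j<n. ennreal (F x) * indicator B (T x) * indicator (P j) x) = (\<Sum>j\<in>{i}. ennreal (F x) * indicator B (T x) * indicator (P j) x)"
      proof (rule sum.mono_neutral_right)
        show "\<forall>j\<in>{..<n} - {i}. ennreal (F x) * indicator B (T x) * indicator (P j) x = 0"
        proof
          fix j assume "j \<in> {..<n} - {i}"
          then have "P j \<inter> P i = {}" using disj i(1) unfolding disjoint_family_on_def by blast
          then show "ennreal (F x) * indicator B (T x) * indicator (P j) x = 0" using i(2) by (auto simp: indicator_def)
        qed
      qed (use i in auto)
      then show "ennreal (F x) * indicator (T -` B) x = (\<Sum>j<n. ennreal (F x) * indicator B (T x) * indicator (P j) x)"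
        using i(2) by (simp add: indicator_def)
    qed
    also have "\<dots> = (\<Sum>i<n. \<integral>\<^sup>+x. ennreal (F x) * indicator B (T x) * indicator (P i) x \<partial>vol)"
    proof (rule nn_integral_sum)
      fix i assume "i \<in> {..<n}"
      then have "P i \<in> sets borel" using P by simp
      then have "(\<lambda>x. ennreal (F x) * indicator B (T x) * indicator (P i) x) \<in> borel_measurable borel"
        using F(1) measurable_compose[OF T_meas ind]
        by (intro borel_measurable_times_ennreal measurable_compose[OF F(1) measurable_ennreal] borel_measurable_indicator)
      then show "(\<lambda>x. ennreal (F x) * indicator B (T x) * indicator (P i) x) \<in> borel_measurable vol"
        by (simp add: measurable_cong_sets[OF sets_vol refl])
    qed
    also have "\<dots> = (\<Sum>i<n. \<integral>\<^sup>+y. ennreal (f i y) * indicator B y \<partial>vol)"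
    proof (intro sum.cong refl)
      fix i assume "i \<in> {..<n}"
      then have i: "i < n" by simp
      have "(\<integral>\<^sup>+x. ennreal (F x) * indicator B (T x) * indicator (P i) x \<partial>vol)
        = (\<integral>\<^sup>+y. ennreal (F (S i y) / J (S i y)) * indicator B y * indicator (T ` P i) y \<partial>vol)"
        by (rule S_dual[OF i ind])
      also have "\<dots> = (\<integral>\<^sup>+y. ennreal (f i y) * indicator B y \<partial>vol)"
        by (intro nn_integral_cong) (auto simp: f_def indicator_def)
      finally show "(\<integral>\<^sup>+x. ennreal (F x) * indicator B (T x) * indicator (P i) x \<partial>vol)
        = (\<integral>\<^sup>+y. ennreal (f i y) * indicator B y \<partial>vol)" .
    qed
    also have "\<dots> = (\<integral>\<^sup>+y. (\<Sum>i<n. ennreal (f i y) * indicator B y) \<partial>vol)"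
    proof (rule nn_integral_sum[symmetric])
      fix i assume "i \<in> {..<n}"
      then have "(\<lambda>y. ennreal (f i y) * indicator B y) \<in> borel_measurable borel"
        using ind by (intro borel_measurable_times_ennreal measurable_compose[OF f_meas measurable_ennreal]) simp_all
      then show "(\<lambda>y. ennreal (f i y) * indicator B y) \<in> borel_measurable vol"
        by (simp add: measurable_cong_sets[OF sets_vol refl])
    qed
    also have "\<dots> = (\<integral>\<^sup>+y. ennreal (\<Sum>i<n. f i y) * indicator B y \<partial>vol)"
      using f_nonneg by (intro nn_integral_cong) (simp add: sum_distrib_right[symmetric] sum_ennreal)
    also have "\<dots> = emeasure (density vol (\<lambda>y. ennreal (\<Sum>i<n. f i y))) B"
      using L_vol B by (intro emeasure_density[symmetric]) (simp_all add: sets_vol)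
    finally show "emeasure (distr (density vol (\<lambda>x. ennreal (F x))) vol T) B
      = emeasure (density vol (\<lambda>y. ennreal (\<Sum>z\<in>T -` {y}. F z / J z))) B"
      by (simp only: fibre_sum)
  qed
qed

end

section \<open>Existence of the invariant measure and decay of correlations\<close>

text \<open>Meant for two quantities that differ by a constant and are bounded away from 0, such as
  two shifts of -ln r: they are then comparable up to a factor.\<close>

lemma le_one_plus_ratio_mult:
  fixes p p' m :: real
  assumes "0 < m" "m \<le> p"
  shows "p' \<le> (1 + \<bar>p' - p\<bar> / m) * p"
proof -
  have "p' - p \<le> \<bar>p' - p\<bar> / m * m" using assms by simp
  also have "\<dots> \<le> \<bar>p' - p\<bar> / m * p" using assms by (intro mult_left_mono) auto
  finally show ?thesis by (simp add: algebra_simps)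
qed

text \<open>Up to 1 both functions are the same negative power of -ln r plus a constant. Between 1
  and D, if D exceeds 1, both lie between positive bounds by monotonicity.\<close>

lemma log_modulus_comparable:
  assumes "log_modulus \<gamma> \<omega>" "0 < \<gamma>" "0 < D"
  shows "\<exists>C>0. \<forall>r. 0 \<le> r \<longrightarrow> r \<le> D \<longrightarrow> \<omega> r \<le> C * log_weight D \<gamma> r \<and> log_weight D \<gamma> r \<le> C * \<omega> r"
proof -
  from assms(1) obtain r0 where r0: "1 < r0" and \<omega>: "\<forall>r\<in>{0<..1}. \<omega> r = ln (r0 / r) powr (- \<gamma>)"
    and mono: "mono_on {0..} \<omega>" and \<omega>0: "\<omega> 0 = 0"
    unfolding log_modulus_def by blast
  define a where "a = ln r0"
  define b where "b = 1 + ln D"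
  have a: "0 < a" using r0 by (simp add: a_def)
  \<comment> \<open>The larger of the two factors by which a + s and b + s dominate each other; a
    bounds the former from below, 1 the latter.\<close>
  define q where "q = max (1 + \<bar>b - a\<bar> / a) (1 + \<bar>a - b\<bar> / 1)"
  have q: "1 \<le> q" using a by (simp add: q_def)
  have small: "\<omega> r \<le> q powr \<gamma> * log_weight D \<gamma> r \<and> log_weight D \<gamma> r \<le> q powr \<gamma> * \<omega> r"
    if r: "0 < r" "r \<le> 1" "r \<le> D" for r
  proof -
    define s where "s = - ln r"
    have s: "0 \<le> s" using r by (simp add: s_def)
    have as: "ln (r0 / r) = a + s" using r r0 by (simp add: a_def s_def ln_div)
    have bs: "1 + ln (D / r) = b + s" using r assms(3) by (simp add: b_def s_def ln_div)
    have "0 \<le> ln (D / r)" using r by simp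
    then have bs1: "1 \<le> b + s" using bs by linarith
    have "b + s \<le> (1 + \<bar>b - a\<bar> / a) * (a + s)"
      using le_one_plus_ratio_mult[of a "a + s" "b + s"] a s by simp
    also have "\<dots> \<le> q * (a + s)" using a s by (intro mult_right_mono) (auto simp: q_def)
    finally have 1: "b + s \<le> q * (a + s)" .
    have "a + s \<le> (1 + \<bar>a - b\<bar> / 1) * (b + s)"
      using le_one_plus_ratio_mult[of 1 "b + s" "a + s"] bs1 by simp
    also have "\<dots> \<le> q * (b + s)" using bs1 by (intro mult_right_mono) (auto simp: q_def)
    finally have 2: "a + s \<le> q * (b + s)" .
    have as_pos: "0 < a + s" using a s by simp
    have comp: "u powr (- \<gamma>) \<le> q powr \<gamma> * v powr (- \<gamma>)" if "0 < u" "0 < v" "v \<le> q * u" for u v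
    proof -
      have "(q * u) powr (- \<gamma>) \<le> v powr (- \<gamma>)" using that assms(2) by (intro powr_mono2') auto
      then have "q powr \<gamma> * (q powr (- \<gamma>) * u powr (- \<gamma>)) \<le> q powr \<gamma> * v powr (- \<gamma>)"
        using q that by (intro mult_left_mono) (auto simp: powr_mult)
      moreover have "q powr \<gamma> * q powr (- \<gamma>) = 1" using q by (simp flip: powr_add)
      ultimately show ?thesis by (simp flip: mult.assoc)
    qed
    have "\<omega> r = (a + s) powr (- \<gamma>)" using \<omega> r as by simp
    moreover have "log_weight D \<gamma> r = (b + s) powr (- \<gamma>)" using r bs by (simp add: log_weight_def)
    ultimately show ?thesis
      using comp[OF as_pos _ 1] comp[OF _ as_pos 2] bs1 by simp
  qed
  \<comment> \<open>The first summand serves r \<le> 1 in both directions. For larger r the second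
    bounds \<omega> by the weight and the third bounds the weight, which is at most 1, by
    \<omega>.\<close>
  define C where "C = q powr \<gamma> + \<bar>\<omega> D\<bar> / log_weight D \<gamma> (min 1 D) + 1 / \<omega> (min 1 D)"
  define e where "e = min 1 D"
  have e: "0 < e" "e \<le> 1" "e \<le> D" using assms(3) by (auto simp: e_def)
  have we: "0 < log_weight D \<gamma> e"
  proof -
    have "0 \<le> ln (D / e)" using e by simp
    then have "0 < 1 + ln (D / e)" by linarith
    then show ?thesis using e by (simp add: log_weight_def not_le)
  qed
  have \<omega>e: "0 < \<omega> e"
  proof -
    have "0 < log_weight D \<gamma> e" "log_weight D \<gamma> e \<le> q powr \<gamma> * \<omega> e" using we small[OF e] by auto
    then have "0 < q powr \<gamma> * \<omega> e" by linarith
    then show ?thesis using q by (simp add: zero_less_mult_iff)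
  qed
  have C_parts: "0 < q powr \<gamma>" "0 \<le> \<bar>\<omega> D\<bar> / log_weight D \<gamma> e" "0 \<le> 1 / \<omega> e" using q we \<omega>e by auto
  have C: "C = q powr \<gamma> + \<bar>\<omega> D\<bar> / log_weight D \<gamma> e + 1 / \<omega> e" by (simp add: C_def e_def)
  show ?thesis
  proof (intro exI[of _ C] conjI allI impI)
    show "0 < C" unfolding C using C_parts by linarith
    fix r :: real assume r: "0 \<le> r" "r \<le> D"
    have "\<omega> r \<le> C * log_weight D \<gamma> r \<and> log_weight D \<gamma> r \<le> C * \<omega> r"
    proof (cases "r = 0")
      case True
      then show ?thesis using \<omega>0 by simp
    next
      case False
      then have r_pos: "0 < r" using r by simp
      show ?thesis
      proof (cases "r \<le> 1")
        case True
        have s: "\<omega> r \<le> q powr \<gamma> * log_weight D \<gamma> r" "log_weight D \<gamma> r \<le> q powr \<gamma> * \<omega> r"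
          using small[OF r_pos True r(2)] by auto
        have "0 \<le> q powr \<gamma> * \<omega> r" using s(2) log_weight_nonneg[of D \<gamma> r] by linarith
        then have "0 \<le> \<omega> r" using C_parts(1) by (simp add: zero_le_mult_iff)
        moreover have "q powr \<gamma> \<le> C" unfolding C using C_parts by linarith
        ultimately have "q powr \<gamma> * log_weight D \<gamma> r \<le> C * log_weight D \<gamma> r" "q powr \<gamma> * \<omega> r \<le> C * \<omega> r"
          by (auto intro!: mult_right_mono)
        then show ?thesis using s by linarith
      next
        case False
        then have er: "e \<le> r" using e by simp
        have "\<omega> r \<le> \<omega> D" using mono_onD[OF mono, of r D] r by simp
        also have "\<omega> D \<le> \<bar>\<omega> D\<bar> / log_weight D \<gamma> e * log_weight D \<gamma> e" using we by simp
        also have "\<dots> \<le> \<bar>\<omega> D\<bar> / log_weight D \<gamma> e * log_weight D \<gamma> r"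
          using er r(2) assms(2) C_parts by (intro mult_left_mono log_weight_mono) auto
        also have "\<dots> \<le> C * log_weight D \<gamma> r"
          using C_parts by (intro mult_right_mono) (auto simp: C)
        finally have 1: "\<omega> r \<le> C * log_weight D \<gamma> r" .
        have \<omega>r: "\<omega> e \<le> \<omega> r" using mono_onD[OF mono, of e r] er e by simp
        have "log_weight D \<gamma> r \<le> 1" using r assms(2) by (intro log_weight_le_one) auto
        also have "1 = 1 / \<omega> e * \<omega> e" using \<omega>e by simp
        also have "\<dots> \<le> 1 / \<omega> e * \<omega> r" using \<omega>r C_parts by (intro mult_left_mono) auto
        also have "\<dots> \<le> C * \<omega> r"
          using C_parts \<omega>r \<omega>e by (intro mult_right_mono) (auto simp: C)
        finally show ?thesis using 1 by simp
      qed
    qed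
    then show "\<omega> r \<le> C * log_weight D \<gamma> r" "log_weight D \<gamma> r \<le> C * \<omega> r" by auto
  qed
qed

lemma log_weight_small:
  assumes "0 < e" "0 < \<gamma>" "0 < D"
  shows "\<exists>\<delta>>0. \<forall>r<\<delta>. log_weight D \<gamma> r < e"
proof -
  \<comment> \<open>Solves t^(-\<gamma>) = e / 2, half of the target, to leave room for the strict
    inequality.\<close>
  define t where "t = (e / 2) powr (- 1 / \<gamma>)"
  have "0 < t" using assms by (simp add: t_def)
  have te: "t powr (- \<gamma>) = e / 2" using assms by (simp add: t_def powr_powr)
  show ?thesis
  proof (intro exI[of _ "D * exp (- t)"] conjI allI impI)
    show "0 < D * exp (- t)" using assms by simp
    fix r assume r: "r < D * exp (- t)"
    show "log_weight D \<gamma> r < e"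
    proof (cases "r \<le> 0")
      case False
      then have "exp t \<le> D / r" using r by (simp add: exp_minus field_simps)
      then have "t \<le> ln (D / r)" using False assms by (simp add: ln_ge_iff)
      then have "(1 + ln (D / r)) powr (- \<gamma>) \<le> t powr (- \<gamma>)"
        using \<open>0 < t\<close> assms by (intro powr_mono2') auto
      then show ?thesis using False te assms by (simp add: log_weight_def)
    qed (use assms in \<open>simp add: log_weight_def\<close>)
  qed
qed

lemma (in riemannian) continuous_if_log_weight_modulus:
  assumes f: "\<And>x y. \<bar>f x - f y\<bar> \<le> H * log_weight D \<gamma> (riem_dist A g x y)" and "0 < \<gamma>" "0 < D"
  shows "continuous_on UNIV (f :: 'a \<Rightarrow> real)"
proof -
  have "isCont f x" for x
    unfolding continuous_at_open
  proof (intro allI impI, elim conjE)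
    fix U assume U: "open U" "f x \<in> U"
    obtain e where e: "0 < e" "ball (f x) e \<subseteq> U" using U open_contains_ball by blast
    have H: "0 < \<bar>H\<bar> + 1" by simp
    then obtain \<delta> where \<delta>: "0 < \<delta>" "\<forall>r<\<delta>. log_weight D \<gamma> r < e / (\<bar>H\<bar> + 1)"
      using log_weight_small[OF _ assms(2,3), of "e / (\<bar>H\<bar> + 1)"] e by auto
    obtain N where N: "open N" "x \<in> N" "\<forall>y\<in>N. riem_dist A g x y < \<delta> \<and> riem_dist A g y x < \<delta>"
      using riem_dist_small[OF \<delta>(1), of x] by blast
    have "f y \<in> U" if "y \<in> N" for y
    proof -
      define w where "w = log_weight D \<gamma> (riem_dist A g x y)"
      have w: "0 \<le> w" "w < e / (\<bar>H\<bar> + 1)" using N(3) \<delta>(2) that by (auto simp: w_def)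
      have "\<bar>f x - f y\<bar> \<le> H * w" unfolding w_def by (rule f)
      also have "\<dots> \<le> (\<bar>H\<bar> + 1) * w" using w by (intro mult_right_mono) auto
      also have "\<dots> < e" using w(2) H by (simp add: pos_less_divide_eq mult.commute)
      finally show ?thesis using e(2) by (auto simp: dist_real_def)
    qed
    then show "\<exists>S. open S \<and> x \<in> S \<and> (\<forall>x'\<in>S. f x' \<in> U)" using N by blast
  qed
  then show ?thesis by (simp add: continuous_on_eq_continuous_at)
qed

text \<open>For fixed points with positive modulus, admissibility of a constant is a lower bound on
  it, so the infimum is again admissible.\<close>

lemma Hol_modulus:
  assumes f: "f \<in> mod_space d \<omega>" and \<omega>: "\<And>x y. 0 \<le> \<omega> (d x y)"
  shows "0 \<le> Hol d \<omega> f" "\<bar>f x - f y\<bar> \<le> Hol d \<omega> f * \<omega> (d x y)"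
proof -
  let ?S = "{C. 0 \<le> C \<and> (\<forall>x y. \<bar>f x - f y\<bar> \<le> C * \<omega> (d x y))}"
  obtain C where C: "\<And>x y. \<bar>f x - f y\<bar> \<le> C * \<omega> (d x y)"
    using f unfolding mod_space_def by blast
  have "\<bar>f x - f y\<bar> \<le> \<bar>C\<bar> * \<omega> (d x y)" for x y
    using C[of x y] mult_right_mono[OF abs_ge_self[of C] \<omega>[of x y]] by linarith
  then have ne: "?S \<noteq> {}" by (auto intro!: exI[of _ "\<bar>C\<bar>"])
  show "0 \<le> Hol d \<omega> f"
    unfolding Hol_def by (rule cInf_greatest[OF ne]) simp
  show "\<bar>f x - f y\<bar> \<le> Hol d \<omega> f * \<omega> (d x y)"
  \<comment> \<open>Where the modulus vanishes, any admissible constant already gives f x = f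
    y.\<close>
  proof (cases "\<omega> (d x y) = 0")
    case True
    then show ?thesis using C[of x y] by simp
  next
    case False
    then have pos: "0 < \<omega> (d x y)" using \<omega>[of x y] by simp
    have "\<bar>f x - f y\<bar> / \<omega> (d x y) \<le> Hol d \<omega> f"
      unfolding Hol_def
    proof (rule cInf_greatest[OF ne])
      fix C' assume "C' \<in> ?S"
      then show "\<bar>f x - f y\<bar> / \<omega> (d x y) \<le> C'" using pos by (simp add: pos_divide_le_eq)
    qed
    then show ?thesis using pos by (simp add: pos_divide_le_eq)
  qed
qed


theorem corollary6:
  fixes A :: "('a::{second_countable_topology,t2_space}, 'n::finite) chart set"
    and g :: "('a, 'n) metric_tensor"
    and T :: "'a \<Rightarrow> 'a"
    and k :: nat
    and \<beta> :: real
    and \<omega> \<omega>' :: "real \<Rightarrow> real"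
  assumes "riemannian_manifold A g"
    and "compact (UNIV :: 'a set)"
    and "connected (UNIV :: 'a set)"
    and "C1_map A T"
    and "k_to_one k T"
    and "uniformly_expanding (riem_dist A g) k T"
    and "\<beta> > 1"
    and "log_modulus \<beta> \<omega>"
    and "log_modulus (\<beta> - 1) \<omega>'"
    and "abs_det_D A g T \<in> mod_space (riem_dist A g) \<omega>"
  shows "\<exists>\<mu> \<rho>. invariant_prob T \<mu>
           \<and> absolutely_continuous (riem_volume A g) \<mu>
           \<and> \<rho> \<in> mod_space (riem_dist A g) \<omega>'
           \<and> (\<forall>x. 0 \<le> \<rho> x)
           \<and> \<mu> = density (riem_volume A g) (\<lambda>x. ennreal (\<rho> x))
           \<and> polynomial_decay (riem_dist A g) \<omega>' (\<beta> - 1) T \<mu>"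
proof -
  let ?d = "riem_dist A g" and ?J = "abs_det_D A g T" and ?vol = "riem_volume A g"
  interpret riemannian A g by (rule riemannian.intro) (rule assms(1))
  obtain l where l: "1 < l" and branches: "\<forall>x y. \<exists>\<xi> \<eta>.
        bij_betw \<xi> {1..k} (T -` {x}) \<and> bij_betw \<eta> {1..k} (T -` {y}) \<and>
        (\<forall>j\<in>{1..k}. ?d (\<xi> j) (\<eta> j) \<le> ?d x y / l)"
    using assms(6) unfolding uniformly_expanding_def by blast
  have finite_fibre: "finite (T -` {x})" and card_fibre: "card (T -` {x}) = k" for x
    using assms(5) unfolding k_to_one_def by blast+
  \<comment> \<open>All fibres have the same cardinality k, and k is positive because the fibre over
    \<open>T undefined\<close> contains \<open>undefined\<close>.\<close>
  have fibre_nonempty: "T -` {x} \<noteq> {}" for x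
  proof -
    have "undefined \<in> T -` {T undefined}" by simp
    then have "0 < card (T -` {T undefined})" using finite_fibre card_gt_0_iff by blast
    then have "0 < card (T -` {x})" by (simp only: card_fibre)
    then show ?thesis by (simp only: card_gt_0_iff simp_thms)
  qed
  \<comment> \<open>Composing one enumeration with the inverse of the other turns the pair of
    enumerations into a bijection of the fibres.\<close>
  have matching: "\<exists>b. bij_betw b (T -` {x}) (T -` {y}) \<and> (\<forall>z\<in>T -` {x}. ?d z (b z) \<le> ?d x y / l)" for x y
  proof -
    obtain \<xi> \<eta> where \<xi>: "bij_betw \<xi> {1..k} (T -` {x})" and \<eta>: "bij_betw \<eta> {1..k} (T -` {y})"
      and close: "\<forall>j\<in>{1..k}. ?d (\<xi> j) (\<eta> j) \<le> ?d x y / l"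
      using branches by blast
    have "bij_betw (\<eta> \<circ> inv_into {1..k} \<xi>) (T -` {x}) (T -` {y})"
      by (rule bij_betw_trans[OF bij_betw_inv_into[OF \<xi>] \<eta>])
    moreover have "?d z ((\<eta> \<circ> inv_into {1..k} \<xi>) z) \<le> ?d x y / l" if z: "z \<in> T -` {x}" for z
    proof -
      have "inv_into {1..k} \<xi> z \<in> {1..k}"
        by (rule bij_betw_apply[OF bij_betw_inv_into[OF \<xi>] z])
      then have "?d (\<xi> (inv_into {1..k} \<xi> z)) (\<eta> (inv_into {1..k} \<xi> z)) \<le> ?d x y / l"
        using close by blast
      then show ?thesis by (simp only: bij_betw_inv_into_right[OF \<xi> z] o_apply)
    qed
    ultimately show ?thesis by blast
  qed
  interpret E: expanding_map A g T l
    by unfold_locales (fact assms(2) assms(3) assms(4) l finite_fibre fibre_nonempty matching)+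
  obtain D where D: "0 < D" "\<And>x y. ?d x y \<le> D"
    using riem_dist_bounded[OF assms(2,3)] by metis
  obtain B where B: "0 < B" "\<forall>r. 0 \<le> r \<longrightarrow> r \<le> D \<longrightarrow> \<omega> r \<le> B * log_weight D \<beta> r \<and> log_weight D \<beta> r \<le> B * \<omega> r"
    using log_modulus_comparable[OF assms(8) _ D(1)] assms(7) by auto
  have \<alpha>: "0 < \<beta> - 1" using assms(7) by simp
  obtain B' where B': "0 < B'" "\<forall>r. 0 \<le> r \<longrightarrow> r \<le> D \<longrightarrow>
      \<omega>' r \<le> B' * log_weight D (\<beta> - 1) r \<and> log_weight D (\<beta> - 1) r \<le> B' * \<omega>' r"
    using log_modulus_comparable[OF assms(9) \<alpha> D(1)] by blast
  have \<omega>: "\<omega> (?d x y) \<le> B * log_weight D \<beta> (?d x y)"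
    and \<omega>': "\<omega>' (?d x y) \<le> B' * log_weight D (\<beta> - 1) (?d x y)" "log_weight D (\<beta> - 1) (?d x y) \<le> B' * \<omega>' (?d x y)"
    for x y using B(2) B'(2) riem_dist_nonneg[of x y] D(2)[of x y] by blast+
  have \<omega>'_nonneg: "0 \<le> \<omega>' (?d x y)" for x y
  proof -
    have "0 \<le> B' * \<omega>' (?d x y)" using \<omega>'(2) log_weight_nonneg by (rule order_trans[rotated])
    then show ?thesis using B'(1) by (simp add: zero_le_mult_iff)
  qed
  obtain C where C: "\<And>x y. \<bar>?J x - ?J y\<bar> \<le> C * \<omega> (?d x y)"
    using assms(10) unfolding mod_space_def by blast
  define CJ where "CJ = \<bar>C\<bar> * B"
  have CJ: "0 \<le> CJ" using B(1) by (simp add: CJ_def)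
  have J_mod: "\<bar>?J x - ?J y\<bar> \<le> CJ * log_weight D \<beta> (?d x y)" for x y
  proof -
    have "0 \<le> B * \<omega> (?d x y)"
      using B(2) riem_dist_nonneg[of x y] D(2)[of x y] log_weight_nonneg[of D \<beta> "?d x y"] by (meson order_trans)
    then have "0 \<le> \<omega> (?d x y)" using B(1) by (simp add: zero_le_mult_iff)
    then have "C * \<omega> (?d x y) \<le> \<bar>C\<bar> * \<omega> (?d x y)" by (intro mult_right_mono) auto
    also have "\<dots> \<le> \<bar>C\<bar> * (B * log_weight D \<beta> (?d x y))" using \<omega> by (intro mult_left_mono) auto
    finally show ?thesis using C[of x y] by (simp add: CJ_def mult.assoc)
  qed
  have J_cont: "continuous_on UNIV ?J"
    by (rule continuous_if_log_weight_modulus[OF J_mod _ D(1)]) (use assms(7) in simp)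
  obtain x0 where x0: "\<And>x. ?J x0 \<le> ?J x"
    using continuous_attains_inf[OF assms(2) _ J_cont] by auto
  \<comment> \<open>The Jacobian is continuous and positive on a compact space, hence bounded below
    by its minimum; on [m, \<infinity>) the logarithm is Lipschitz with constant 1 / m.\<close>
  define m where "m = ?J x0"
  have m: "0 < m" "\<And>x. m \<le> ?J x" using E.abs_det_D_pos x0 by (simp_all add: m_def)
  \<comment> \<open>The exponent is kept as \<beta> - 1 + 1 to match the locale, where \<alpha> =
    \<beta> - 1.\<close>
  have ln_J: "\<bar>ln (?J x) - ln (?J y)\<bar> \<le> CJ / m * log_weight D (\<beta> - 1 + 1) (?d x y)" for x y
  proof -
    have half: "ln (?J x) - ln (?J y) \<le> \<bar>?J x - ?J y\<bar> / m" for x y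
    proof -
      have "ln (?J x) - ln (?J y) \<le> (?J x - ?J y) / ?J y"
        by (rule ln_diff_le[OF E.abs_det_D_pos E.abs_det_D_pos])
      also have "\<dots> \<le> \<bar>?J x - ?J y\<bar> / ?J y" using E.abs_det_D_pos[of y] by (intro divide_right_mono) auto
      also have "\<dots> \<le> \<bar>?J x - ?J y\<bar> / m" using m E.abs_det_D_pos[of y] by (intro divide_left_mono) auto
      finally show ?thesis .
    qed
    have "\<bar>ln (?J x) - ln (?J y)\<bar> \<le> \<bar>?J x - ?J y\<bar> / m"
      using half[of x y] half[of y x] by (simp add: abs_minus_commute abs_le_iff)
    also have "\<dots> \<le> CJ * log_weight D \<beta> (?d x y) / m" using J_mod m(1) by (intro divide_right_mono) auto
    finally show ?thesis by simp
  qed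
  have sets_vol: "sets ?vol = sets borel" by (rule E.sets_vol)
  have space_vol: "space ?vol = UNIV" using sets_eq_imp_space_eq[OF sets_vol] by simp
  have borel_vol: "f \<in> borel_measurable ?vol \<longleftrightarrow> f \<in> borel_measurable borel" for f :: "'a \<Rightarrow> real"
    by (simp only: measurable_cong_sets[OF sets_vol refl])
  have J_meas: "?J \<in> borel_measurable borel" by (rule borel_measurable_continuous_onI[OF J_cont])
  have T_meas: "T \<in> measurable ?vol ?vol"
    using borel_measurable_continuous_onI[OF E.continuous_T] by (simp only: measurable_cong_sets[OF sets_vol sets_vol])
  interpret L: expanding_transfer ?d T ?J l D "CJ / m" "\<beta> - 1" ?vol
  proof (intro expanding_transfer.intro expanding_branches.intro expanding_transfer_axioms.intro)
    show "finite_measure ?vol"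
      using volume_finite_pos(2)[OF assms(2)] by (intro finite_measureI) (simp add: space_vol)
    show "0 < measure ?vol UNIV"
      using volume_finite_pos[OF assms(2)] by (simp add: measure_def enn2real_positive_iff)
    show "f \<in> borel_measurable ?vol"
      if "\<And>x y. \<bar>f x - f y\<bar> \<le> H * log_weight D (\<beta> - 1) (?d x y)" for f H
      unfolding borel_vol
      by (rule borel_measurable_continuous_onI[OF continuous_if_log_weight_modulus[OF that \<alpha> D(1)]])
    show "(\<lambda>x. \<Sum>z\<in>T -` {x}. F z / ?J z) \<in> borel_measurable ?vol"
      if "F \<in> borel_measurable ?vol" "\<And>x. 0 \<le> F x" for F
      using that E.transfer_duality(1)[OF J_meas] by (simp only: borel_vol)
    show "distr (density ?vol (\<lambda>x. ennreal (F x))) ?vol T = density ?vol (\<lambda>x. ennreal (\<Sum>z\<in>T -` {x}. F z / ?J z))"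
      if "F \<in> borel_measurable ?vol" "\<And>x. 0 \<le> F x" for F
      using that E.transfer_duality(2)[OF J_meas] by (simp only: borel_vol)
    show "0 \<le> CJ / m" using CJ m(1) by simp
  qed (fact riem_dist_nonneg D l \<alpha> finite_fibre fibre_nonempty matching E.abs_det_D_pos ln_J space_vol T_meas)+
  show ?thesis
  proof (rule L.invariant_density_with_decay)
    fix \<rho> H C
    let ?\<mu> = "density ?vol (\<lambda>x. ennreal (\<rho> x))"
    assume \<rho>_mod: "\<And>x y. \<bar>\<rho> x - \<rho> y\<bar> \<le> H * log_weight D (\<beta> - 1) (?d x y)" and "0 \<le> H"
      and \<rho>_pos: "\<And>x. 0 < \<rho> x"
      and prob: "emeasure ?\<mu> UNIV = 1" and inv: "distr ?\<mu> ?\<mu> T = ?\<mu>"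
      and decay: "\<And>f H g t. (\<And>x y. \<bar>f x - f y\<bar> \<le> H * log_weight D (\<beta> - 1) (?d x y)) \<Longrightarrow> 0 \<le> H \<Longrightarrow>
        integrable ?\<mu> g \<Longrightarrow> 1 \<le> t \<Longrightarrow>
        \<bar>(\<integral>x. f x * g ((T ^^ t) x) \<partial>?\<mu>) - (\<integral>x. f x \<partial>?\<mu>) * (\<integral>x. g x \<partial>?\<mu>)\<bar>
        \<le> C * H * (\<integral>x. \<bar>g x\<bar> \<partial>?\<mu>) * real t powr (- (\<beta> - 1))"
    have \<rho>_meas: "\<rho> \<in> borel_measurable ?vol" by (rule L.modulus_measurable[OF \<rho>_mod])
    have "invariant_prob T ?\<mu>"
      unfolding invariant_prob_def using prob inv T_meas
      by (simp add: sets_vol space_vol measurable_cong_sets[OF sets_density sets_density])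
    moreover have "absolutely_continuous ?vol ?\<mu>"
      using \<rho>_meas by (intro absolutely_continuousI_density) simp
    moreover have "\<rho> \<in> mod_space ?d \<omega>'"
    proof -
      have "\<bar>\<rho> x - \<rho> y\<bar> \<le> (H * B') * \<omega>' (?d x y)" for x y
        using \<rho>_mod[of x y] mult_left_mono[OF \<omega>'(2)[of x y] \<open>0 \<le> H\<close>] by (simp only: mult.assoc)
      then show ?thesis unfolding mod_space_def by blast
    qed
    moreover have "polynomial_decay ?d \<omega>' (\<beta> - 1) T ?\<mu>"
      unfolding polynomial_decay_def
    \<comment> \<open>The factor B' translates the constant \<open>Hol\<close> with respect to
      \<omega>' into one with respect to the log weight.\<close>
    proof (intro exI[of _ "C * B'"] ballI allI impI)
      fix f g :: "'a \<Rightarrow> real" and t :: nat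
      assume f: "f \<in> mod_space ?d \<omega>'" and g: "integrable ?\<mu> g" and t: "1 \<le> t"
      define h where "h = Hol ?d \<omega>' f"
      have h: "0 \<le> h" "\<And>x y. \<bar>f x - f y\<bar> \<le> h * \<omega>' (?d x y)"
        using Hol_modulus[OF f \<omega>'_nonneg] by (simp_all add: h_def)
      have "\<bar>f x - f y\<bar> \<le> (h * B') * log_weight D (\<beta> - 1) (?d x y)" for x y
        using h(2)[of x y] mult_left_mono[OF \<omega>'(1)[of x y] h(1)] by (simp only: mult.assoc)
      then have "\<bar>(\<integral>x. f x * g ((T ^^ t) x) \<partial>?\<mu>) - (\<integral>x. f x \<partial>?\<mu>) * (\<integral>x. g x \<partial>?\<mu>)\<bar>
        \<le> C * (h * B') * (\<integral>x. \<bar>g x\<bar> \<partial>?\<mu>) * real t powr (- (\<beta> - 1))"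
        using h(1) B'(1) g t by (intro decay) auto
      also have "\<dots> = C * B' * Hol ?d \<omega>' f * (\<integral>x. \<bar>g x\<bar> \<partial>?\<mu>) / real t powr (\<beta> - 1)"
        unfolding powr_minus_divide by (simp add: h_def mult_ac)
      finally show "\<bar>(\<integral>x. f x * g ((T ^^ t) x) \<partial>?\<mu>) - (\<integral>x. f x \<partial>?\<mu>) * (\<integral>x. g x \<partial>?\<mu>)\<bar>
        \<le> C * B' * Hol ?d \<omega>' f * (\<integral>x. \<bar>g x\<bar> \<partial>?\<mu>) / real t powr (\<beta> - 1)" .
    qed
    ultimately show ?thesis
      using \<rho>_pos by (intro exI[of _ ?\<mu>] exI[of _ \<rho>]) (simp add: less_imp_le)
  qed
qed

end
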